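(* Let $(W,S)$ be a Coxeter system and let $J\subset S$ be finitary. Let $X\subset\mathrm{Cox}^2_\emptyset(W,S)$ denote the sub-CW-complex defined as follows: it contains all the $0$-cells associated to $(\emptyset,I)$-cosets $p$ ($I\subset S$ finitary) such that $J\subset\mathrm{LD}(\overline p)$, and it contains all the $k$-cells whose closure only contains these $0$-cells. Then there is a cell-preserving homeomorphism $X\to\mathrm{Cox}^2_J(W,S)$, which on $0$-cells sends each $(\emptyset,I)$-coset $p$ to the $(J,I)$-coset $q$ with $\overline p=\overline q$.
   Context: Let $(W,S)$ be a Coxeter system with identity $e$, length $\ell_W$ and Bruhat order. $\mathrm{LD}(w)=\{s\in S:\ell_W(sw)<\ell_W(w)\}$. $W_I$ is the parabolic subgroup generated by $I\subset S$; $I$ is finitary if $W_I$ is finite, and then $w_I$ is its longest element; $Is=I\sqcup\{s\}$. A $(J,I)$-coset is a double coset $p\in W_J\backslash W/W_I$ ($J,I$ finitary, part of the data), with unique Bruhat-maximal element $\overline p$ and Bruhat-minimal element $\underline p$. $\mathrm{Cox}^1_J(W,S)$ is the oriented graph with one vertex for each $(J,I)$-coset, for all finitary $I\subset S$, and an edge $p\to q$ whenever $p$ is a $(J,I)$-coset and $q$ a $(J,I')$-coset, $I$ and $I'$ differ by exactly one element, and the step $[p,q]$ is reduced, meaning: if $I\subset I'$, then $p\subset q$, $\underline p=\underline q$ and $J\cap\underline pI\underline p^{-1}=J\cap\underline qI'\underline q^{-1}$; if $I\supset I'$, then $q\subset p$ and $\overline q=\overline p$. Oriented paths from the $(J,J)$-coset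 containing $e$ to $p$ are precisely the reduced expressions of $p$: a reduced expression is a sequence $[J=I_0,\dots,I_d]$ of finitary subsets, consecutive ones differing by one element, all steps of whose forward path $p_0\ni e,p_1,\dots,p_d$ are reduced, where $p_i$ is a $(J,I_i)$-coset and $p_{i+1}$ is the $(J,I_{i+1})$-coset containing $\overline{p_i}$. $\mathrm{Cox}^2_J(W,S)$ is the 2-dimensional CW complex obtained from $\mathrm{Cox}^1_J(W,S)$ by attaching one $2$-cell for every application of a braid relation within a reduced expression, along the loop formed by the two paths given by the two sides of the relation (with common start and end vertices; applications yielding the same pair of paths give the same cell). $\mathrm{Cox}^2_\emptyset$ is the case $J=\emptyset$. Notation $[K+s-t]$ means $[K,K\sqcup\{s\},(K\sqcup\{s\})\setminus\{t\}]$, etc. Braid relations: $[K+s+t]\leftrightharpoons[K+t+s]$ ($s\ne t$ not in $K$, $K\cup\{s,t\}$ finitary); $[K-s-t]\leftrightharpoons[K-t-s]$ ($s\ne t$ in $K$, $K$ finitary); and the switchback relations $[K+s-t]\leftrightharpoons[K-u_1+s-u_2+u_1-\cdots-u_\delta+u_{\delta-1}]$ for $s\notin K$, $Ks$ finitary, $t\in Ks$, $s\ne w_{Ks}tw_{Ks}$, where $u_0=s$, $u_{-1}=w_{Ks}tw_{Ks}$, $I_i=Ks\setminus\{u_i\}$, $u_{i+1}=w_{I_i}u_{i-1}w_{I_i}$, $L_i=Ks\setminus\{u_i,u_{i-1}\}$, and $\delta$ is the largest integer such that $[I_0,L_1,I_1,\dots,L_k,I_k]$ is a reduced expression for all $1\le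 k\le\delta$ (one has $u_\delta=t$). *)

theory Defs
  imports "HOL-Algebra.Generated_Groups" "HOL-Analysis.Analysis"
begin

section \<open>Coxeter systems\<close>

definition word_prod :: "('a, 'b) monoid_scheme \<Rightarrow> 'a list \<Rightarrow> 'a" where
  "word_prod G ws = foldr (\<lambda>s x. s \<otimes>\<^bsub>G\<^esub> x) ws \<one>\<^bsub>G\<^esub>"

text \<open>The value 0 encodes the entry \<open>\<infinity>\<close> (no relation).\<close>

definition coxeter_matrix :: "'a set \<Rightarrow> ('a \<Rightarrow> 'a \<Rightarrow> nat) \<Rightarrow> bool" where
  "coxeter_matrix S m \<longleftrightarrow> (\<forall>s\<in>S. \<forall>t\<in>S. m s t = m t s \<and> (m s t = 1 \<longleftrightarrow> s = t))"

text \<open>The congruence on the free monoid on \<open>S\<close> generated by the relations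
  \<open>(s t)\<^sup>m \<sim> 1\<close> for \<open>m = m(s,t)\<close>.  As \<open>s s \<sim> 1\<close> is among them, the quotient monoid is the group
  with the presentation \<open>\<langle>S | (s t)\<^sup>m = 1\<rangle>\<close>.\<close>

inductive coxeter_cong :: "'a set \<Rightarrow> ('a \<Rightarrow> 'a \<Rightarrow> nat) \<Rightarrow> 'a list \<Rightarrow> 'a list \<Rightarrow> bool" for S m where
  rel: "\<lbrakk>u \<in> lists S; v \<in> lists S; s \<in> S; t \<in> S\<rbrakk>
    \<Longrightarrow> coxeter_cong S m (u @ concat (replicate (m s t) [s, t]) @ v) (u @ v)"
| refl: "u \<in> lists S \<Longrightarrow> coxeter_cong S m u u"
| sym: "coxeter_cong S m u v \<Longrightarrow> coxeter_cong S m v u"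
| trans: "\<lbrakk>coxeter_cong S m u v; coxeter_cong S m v w\<rbrakk> \<Longrightarrow> coxeter_cong S m u w"

locale coxeter_system = group G for G (structure) +
  fixes S :: "'a set"
  assumes S_subset: "S \<subseteq> carrier G"
    and generated: "carrier G = word_prod G ` lists S"
    and presented: "\<exists>m. coxeter_matrix S m \<and>
      (\<forall>u\<in>lists S. \<forall>v\<in>lists S. word_prod G u = word_prod G v \<longleftrightarrow> coxeter_cong S m u v)"

definition cox_length :: "('a, 'b) monoid_scheme \<Rightarrow> 'a set \<Rightarrow> 'a \<Rightarrow> nat" where
  "cox_length G S w = (LEAST n. \<exists>ws\<in>lists S. length ws = n \<and> word_prod G ws = w)"

definition left_descents :: "('a, 'b) monoid_scheme \<Rightarrow> 'a set \<Rightarrow> 'a \<Rightarrow> 'a set" where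
  "left_descents G S w = {s \<in> S. cox_length G S (s \<otimes>\<^bsub>G\<^esub> w) < cox_length G S w}"

definition conj_by :: "('a, 'b) monoid_scheme \<Rightarrow> 'a \<Rightarrow> 'a \<Rightarrow> 'a" where
  "conj_by G w x = w \<otimes>\<^bsub>G\<^esub> x \<otimes>\<^bsub>G\<^esub> inv\<^bsub>G\<^esub> w"

definition reflections :: "('a, 'b) monoid_scheme \<Rightarrow> 'a set \<Rightarrow> 'a set" where
  "reflections G S = {conj_by G w s | w s. w \<in> carrier G \<and> s \<in> S}"

definition bruhat_le :: "('a, 'b) monoid_scheme \<Rightarrow> 'a set \<Rightarrow> 'a \<Rightarrow> 'a \<Rightarrow> bool" where
  "bruhat_le G S = (\<lambda>x y. x \<in> carrier G \<and>
     (\<exists>t\<in>reflections G S. y = x \<otimes>\<^bsub>G\<^esub> t \<and> cox_length G S x < cox_length G S y))\<^sup>*\<^sup>*"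

definition finitary :: "('a, 'b) monoid_scheme \<Rightarrow> 'a set \<Rightarrow> 'a set \<Rightarrow> bool" where
  "finitary G S I \<longleftrightarrow> I \<subseteq> S \<and> finite (generate G I)"

definition longest :: "('a, 'b) monoid_scheme \<Rightarrow> 'a set \<Rightarrow> 'a set \<Rightarrow> 'a" where
  "longest G S I = (THE w. w \<in> generate G I \<and>
     (\<forall>x\<in>generate G I. cox_length G S x \<le> cox_length G S w))"

section \<open>Double cosets and the graph of reduced steps\<close>

definition double_coset :: "('a, 'b) monoid_scheme \<Rightarrow> 'a set \<Rightarrow> 'a set \<Rightarrow> 'a \<Rightarrow> 'a set" where
  "double_coset G J I w = (generate G J #>\<^bsub>G\<^esub> w) <#>\<^bsub>G\<^esub> generate G I"

definition coset_max :: "('a, 'b) monoid_scheme \<Rightarrow> 'a set \<Rightarrow> 'a set \<Rightarrow> 'a" where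
  "coset_max G S p = (THE x. x \<in> p \<and> (\<forall>y\<in>p. bruhat_le G S x y \<longrightarrow> y = x))"

definition coset_min :: "('a, 'b) monoid_scheme \<Rightarrow> 'a set \<Rightarrow> 'a set \<Rightarrow> 'a" where
  "coset_min G S p = (THE x. x \<in> p \<and> (\<forall>y\<in>p. bruhat_le G S y x \<longrightarrow> y = x))"

text \<open>A \<open>(J,I)\<close>-coset \<open>p\<close> is represented by the pair \<open>(I, p)\<close>; the set \<open>J\<close> is always a fixed
  parameter.  The index \<open>I\<close> is part of the data, since one subset of the group can be a coset for
  several \<open>I\<close>.\<close>

type_synonym 'a vertex = "'a set \<times> 'a set"

definition cox_vertices :: "('a, 'b) monoid_scheme \<Rightarrow> 'a set \<Rightarrow> 'a set \<Rightarrow> 'a vertex set" where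
  "cox_vertices G S J = {(I, double_coset G J I w) | I w. finitary G S I \<and> w \<in> carrier G}"

definition reduced_up :: "('a, 'b) monoid_scheme \<Rightarrow> 'a set \<Rightarrow> 'a set \<Rightarrow> 'a vertex \<Rightarrow> 'a vertex \<Rightarrow> bool" where
  "reduced_up G S J = (\<lambda>(I, p) (I', q).
     (\<exists>s. s \<notin> I \<and> I' = insert s I) \<and> p \<subseteq> q \<and> coset_min G S p = coset_min G S q \<and>
     J \<inter> conj_by G (coset_min G S p) ` I = J \<inter> conj_by G (coset_min G S q) ` I')"

definition reduced_down :: "('a, 'b) monoid_scheme \<Rightarrow> 'a set \<Rightarrow> 'a vertex \<Rightarrow> 'a vertex \<Rightarrow> bool" where
  "reduced_down G S = (\<lambda>(I, p) (I', q).
     (\<exists>s. s \<notin> I' \<and> I = insert s I') \<and> q \<subseteq> p \<and> coset_max G S q = coset_max G S p)"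

definition cox_edges :: "('a, 'b) monoid_scheme \<Rightarrow> 'a set \<Rightarrow> 'a set \<Rightarrow> ('a vertex \<times> 'a vertex) set" where
  "cox_edges G S J = {(x, y). x \<in> cox_vertices G S J \<and> y \<in> cox_vertices G S J \<and>
     (reduced_up G S J x y \<or> reduced_down G S x y)}"

section \<open>Reduced expressions and braid relations\<close>

primrec forward_coset :: "('a, 'b) monoid_scheme \<Rightarrow> 'a set \<Rightarrow> 'a set \<Rightarrow> 'a set list \<Rightarrow> nat \<Rightarrow> 'a set" where
  "forward_coset G S J Is 0 = double_coset G J J \<one>\<^bsub>G\<^esub>"
| "forward_coset G S J Is (Suc i) =
     double_coset G J (Is ! Suc i) (coset_max G S (forward_coset G S J Is i))"

definition forward_path :: "('a, 'b) monoid_scheme \<Rightarrow> 'a set \<Rightarrow> 'a set \<Rightarrow> 'a set list \<Rightarrow> 'a vertex list" where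
  "forward_path G S J Is = map (\<lambda>i. (Is ! i, forward_coset G S J Is i)) [0..<length Is]"

definition reduced_expression :: "('a, 'b) monoid_scheme \<Rightarrow> 'a set \<Rightarrow> 'a set \<Rightarrow> 'a set list \<Rightarrow> bool" where
  "reduced_expression G S J Is \<longleftrightarrow> Is \<noteq> [] \<and> hd Is = J \<and> (\<forall>I\<in>set Is. finitary G S I) \<and>
     successively (\<lambda>x y. (x, y) \<in> cox_edges G S J) (forward_path G S J Is)"

text \<open>The sequence \<open>u\<^sub>0, u\<^sub>1, \<dots>\<close> of the switchback relation for \<open>M = K \<union> {s}\<close> and \<open>t \<in> M\<close>; the term
  \<open>u\<^bsub>-1\<^esub> = w\<^sub>M t w\<^sub>M\<close> is inlined.  All conjugating elements are involutions.\<close>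

fun switchback_elt :: "('a, 'b) monoid_scheme \<Rightarrow> 'a set \<Rightarrow> 'a set \<Rightarrow> 'a \<Rightarrow> 'a \<Rightarrow> nat \<Rightarrow> 'a" where
  "switchback_elt G S M s t 0 = s"
| "switchback_elt G S M s t (Suc 0) =
     conj_by G (longest G S (M - {s})) (conj_by G (longest G S M) t)"
| "switchback_elt G S M s t (Suc (Suc i)) =
     conj_by G (longest G S (M - {switchback_elt G S M s t (Suc i)})) (switchback_elt G S M s t i)"

text \<open>The sequence \<open>[I\<^sub>0, L\<^sub>1, I\<^sub>1, \<dots>, L\<^sub>k, I\<^sub>k]\<close>.\<close>

definition switchback_expr :: "('a, 'b) monoid_scheme \<Rightarrow> 'a set \<Rightarrow> 'a set \<Rightarrow> 'a \<Rightarrow> 'a \<Rightarrow> nat \<Rightarrow> 'a set list" where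
  "switchback_expr G S M s t k = (let u = switchback_elt G S M s t in
     (M - {u 0}) # concat (map (\<lambda>i. [M - {u i, u (i - 1)}, M - {u i}]) [1..<Suc k]))"

definition switchback_reduced_upto ::
    "('a, 'b) monoid_scheme \<Rightarrow> 'a set \<Rightarrow> 'a set \<Rightarrow> 'a \<Rightarrow> 'a \<Rightarrow> nat \<Rightarrow> bool" where
  "switchback_reduced_upto G S M s t d \<longleftrightarrow>
     (\<forall>k\<in>{1..d}. reduced_expression G S (M - {s}) (switchback_expr G S M s t k))"

inductive braid_rel :: "('a, 'b) monoid_scheme \<Rightarrow> 'a set \<Rightarrow> 'a set list \<Rightarrow> 'a set list \<Rightarrow> bool" for G S where
  up_up: "\<lbrakk>finitary G S (K \<union> {s, t}); s \<notin> K; t \<notin> K; s \<noteq> t\<rbrakk>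
    \<Longrightarrow> braid_rel G S [K, K \<union> {s}, K \<union> {s, t}] [K, K \<union> {t}, K \<union> {s, t}]"
| down_down: "\<lbrakk>finitary G S K; s \<in> K; t \<in> K; s \<noteq> t\<rbrakk>
    \<Longrightarrow> braid_rel G S [K, K - {s}, K - {s, t}] [K, K - {t}, K - {s, t}]"
| switchback: "\<lbrakk>s \<notin> K; M = K \<union> {s}; finitary G S M; t \<in> M; s \<noteq> conj_by G (longest G S M) t;
      switchback_reduced_upto G S M s t d; \<And>d'. switchback_reduced_upto G S M s t d' \<Longrightarrow> d' \<le> d\<rbrakk>
    \<Longrightarrow> braid_rel G S [K, M, M - {t}] (switchback_expr G S M s t d)"

text \<open>\<open>segment xs n l\<close> is the block of \<open>l\<close> consecutive entries of \<open>xs\<close> starting at position \<open>n\<close>.\<close>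

definition segment :: "'c list \<Rightarrow> nat \<Rightarrow> nat \<Rightarrow> 'c list" where
  "segment xs n l = take l (drop n xs)"

text \<open>One element for each unordered pair of paths given by the two sides of a braid relation applied
  within a reduced expression.  Applying a braid relation to a reduced expression gives a
  reduced expression of the same double coset, so the two sides are treated symmetrically here.\<close>

definition braid_loops :: "('a, 'b) monoid_scheme \<Rightarrow> 'a set \<Rightarrow> 'a set \<Rightarrow> 'a vertex list set set" where
  "braid_loops G S J = {{\<alpha>, \<beta>} | \<alpha> \<beta>. \<exists>A B l r. braid_rel G S l r \<and>
     reduced_expression G S J (A @ l @ B) \<and> reduced_expression G S J (A @ r @ B) \<and>
     \<alpha> = segment (forward_path G S J (A @ l @ B)) (length A) (length l) \<and>
     \<beta> = segment (forward_path G S J (A @ r @ B)) (length A) (length r) \<and>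
     hd \<alpha> = hd \<beta> \<and> last \<alpha> = last \<beta>}"

section \<open>Two-dimensional CW complexes\<close>

text \<open>Combinatorial data: a directed graph together with a set of unordered pairs of directed paths
  (lists of consecutive vertices) with common endpoints, along which discs are attached.\<close>

record 'v complex2 =
  verts :: "'v set"
  edges :: "('v \<times> 'v) set"
  discs :: "'v list set set"

definition wf_path :: "('v, 'x) complex2_scheme \<Rightarrow> 'v list \<Rightarrow> bool" where
  "wf_path C xs \<longleftrightarrow> xs \<noteq> [] \<and> set xs \<subseteq> verts C \<and> successively (\<lambda>x y. (x, y) \<in> edges C) xs"

definition wf_complex2 :: "('v, 'x) complex2_scheme \<Rightarrow> bool" where
  "wf_complex2 C \<longleftrightarrow> edges C \<subseteq> verts C \<times> verts C \<and>
     (\<forall>D\<in>discs C. \<exists>p q. D = {p, q} \<and> wf_path C p \<and> wf_path C q \<and> hd p = hd q \<and> last p = last q)"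

text \<open>As a set, a CW complex is the disjoint union of its open cells: vertices, open intervals and
  open discs.\<close>

datatype 'v point = Vertex 'v | EdgePt "'v \<times> 'v" real | DiscPt "'v list set" complex

definition open_cells :: "('v, 'x) complex2_scheme \<Rightarrow> nat \<Rightarrow> 'v point set set" where
  "open_cells C k =
    (if k = 0 then {{Vertex v} | v. v \<in> verts C}
     else if k = 1 then {EdgePt e ` {0<..<1} | e. e \<in> edges C}
     else if k = 2 then {DiscPt D ` ball 0 1 | D. D \<in> discs C}
     else {})"

definition cw_points :: "('v, 'x) complex2_scheme \<Rightarrow> 'v point set" where
  "cw_points C = (\<Union>k. \<Union> (open_cells C k))"

text \<open>The characteristic map of an edge, on the interval \<open>[0,1]\<close>.\<close>

definition edge_map :: "'v \<times> 'v \<Rightarrow> real \<Rightarrow> 'v point" where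
  "edge_map e x = (if x \<le> 0 then Vertex (fst e) else if 1 \<le> x then Vertex (snd e) else EdgePt e x)"

text \<open>The path through the given vertices, parametrised by \<open>[0,1]\<close> with all edges taking the same time.\<close>

definition path_map :: "'v list \<Rightarrow> real \<Rightarrow> 'v point" where
  "path_map vs x = (let y = x * real (length vs - 1); i = nat \<lfloor>y\<rfloor> in
     if i < length vs - 1 then edge_map (vs ! i, vs ! Suc i) (y - real i) else Vertex (last vs))"

text \<open>The characteristic map of a disc, on the closed unit disc: the upper and the lower unit
  half-circle, run through from \<open>1\<close> to \<open>-1\<close>, follow the two paths.  Which of the two is the upper
  one is an arbitrary choice; the other choice differs by a reflection of the disc.\<close>

definition disc_map :: "'v list set \<Rightarrow> complex \<Rightarrow> 'v point" where
  "disc_map D z = (if norm z < 1 then DiscPt D z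
     else let (p, q) = (SOME (p, q). D = {p, q})
          in path_map (if 0 \<le> Im z then p else q) ((1 - Re z) / 2))"

text \<open>The quotient topology with respect to all characteristic maps, i.e. the topology of the space
  obtained from the discrete set of vertices by attaching the edges and then the discs.\<close>

definition cw_space :: "('v, 'x) complex2_scheme \<Rightarrow> 'v point topology" where
  "cw_space C = topology (\<lambda>U. U \<subseteq> cw_points C \<and>
     (\<forall>e\<in>edges C. openin (top_of_set {0..1}) {x \<in> {0..1}. edge_map e x \<in> U}) \<and>
     (\<forall>D\<in>discs C. openin (top_of_set (cball 0 1)) {z \<in> cball 0 1. disc_map D z \<in> U}))"

definition cells_within :: "('v, 'x) complex2_scheme \<Rightarrow> 'v set \<Rightarrow> 'v point set set" where
  "cells_within C V = {c. (\<exists>k. c \<in> open_cells C k) \<and>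
     (\<forall>v\<in>verts C. Vertex v \<in> (cw_space C) closure_of c \<longrightarrow> v \<in> V)}"

text \<open>The union of the 0-cells in \<open>V\<close> and of all cells whose closure contains no other 0-cells.\<close>

definition full_subcomplex :: "('v, 'x) complex2_scheme \<Rightarrow> 'v set \<Rightarrow> 'v point set" where
  "full_subcomplex C V = Vertex ` (V \<inter> verts C) \<union> \<Union> (cells_within C V)"

text \<open>For a subcomplex of the first complex, given by its set \<open>X\<close> of points.\<close>

definition cell_preserving_homeo ::
    "('v, 'x) complex2_scheme \<Rightarrow> 'v point set \<Rightarrow> ('w, 'y) complex2_scheme \<Rightarrow> ('v point \<Rightarrow> 'w point) \<Rightarrow> bool" where
  "cell_preserving_homeo C X D h \<longleftrightarrow> homeomorphic_map (subtopology (cw_space C) X) (cw_space D) h \<and>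
     (\<forall>k. \<forall>c\<in>open_cells C k. c \<subseteq> X \<longrightarrow> h ` c \<in> open_cells D k)"

lemma istopology_cw:
  "istopology (\<lambda>U. U \<subseteq> cw_points C \<and>
     (\<forall>e\<in>edges C. openin (top_of_set {0..1}) {x \<in> {0..1}. edge_map e x \<in> U}) \<and>
     (\<forall>D\<in>discs C. openin (top_of_set (cball 0 1)) {z \<in> cball 0 1. disc_map D z \<in> U}))"
proof -
  have int: "{x \<in> A. f x \<in> U \<inter> V} = {x \<in> A. f x \<in> U} \<inter> {x \<in> A. f x \<in> V}" for A U V and f :: "'c \<Rightarrow> 'd"
    by auto
  have un: "{x \<in> A. f x \<in> \<Union>\<U>} = (\<Union>U\<in>\<U>. {x \<in> A. f x \<in> U})" for A \<U> and f :: "'c \<Rightarrow> 'd"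
    by auto
  show ?thesis
    unfolding istopology_def int un by (auto intro!: openin_Int openin_Union)
qed

lemma openin_cw_space:
  "openin (cw_space C) U \<longleftrightarrow> U \<subseteq> cw_points C \<and>
     (\<forall>e\<in>edges C. openin (top_of_set {0..1}) {x \<in> {0..1}. edge_map e x \<in> U}) \<and>
     (\<forall>D\<in>discs C. openin (top_of_set (cball 0 1)) {z \<in> cball 0 1. disc_map D z \<in> U})"
  unfolding cw_space_def by (simp only: topology_inverse'[OF istopology_cw])

lemma Vertex_in_cw_points: "v \<in> verts C \<Longrightarrow> Vertex v \<in> cw_points C"
  unfolding cw_points_def open_cells_def by (intro UN_I[of 0]) auto

lemma EdgePt_in_cw_points: "e \<in> edges C \<Longrightarrow> 0 < x \<Longrightarrow> x < 1 \<Longrightarrow> EdgePt e x \<in> cw_points C"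
  unfolding cw_points_def open_cells_def
  by (cases e, intro UN_I[of 1] UnionI[of "EdgePt e ` {0<..<1}"]) auto

lemma DiscPt_in_cw_points: "D \<in> discs C \<Longrightarrow> norm z < 1 \<Longrightarrow> DiscPt D z \<in> cw_points C"
  unfolding cw_points_def open_cells_def
  by (intro UN_I[of 2] UnionI[of "DiscPt D ` ball 0 1"]) auto

lemma edge_map_in_cw_points:
  assumes "wf_complex2 C" "e \<in> edges C" shows "edge_map e x \<in> cw_points C"
  using assms unfolding edge_map_def wf_complex2_def
  by (auto intro!: Vertex_in_cw_points EdgePt_in_cw_points)

lemma path_map_in_cw_points:
  assumes "wf_complex2 C" "wf_path C vs" shows "path_map vs x \<in> cw_points C"
proof -
  have "(vs ! i, vs ! Suc i) \<in> edges C" if "i < length vs - 1" for i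
    using assms that unfolding wf_path_def successively_conv_nth by auto
  moreover have "last vs \<in> verts C"
    using assms unfolding wf_path_def by (meson last_in_set subsetD)
  ultimately show ?thesis
    unfolding path_map_def Let_def
    by (simp add: edge_map_in_cw_points[OF assms(1)] Vertex_in_cw_points del: of_nat_diff)
qed

lemma disc_map_in_cw_points:
  assumes wf: "wf_complex2 C" and D: "D \<in> discs C" shows "disc_map D z \<in> cw_points C"
proof -
  obtain p q where pq: "D = {p, q}" "wf_path C p" "wf_path C q"
    using assms unfolding wf_complex2_def by blast
  obtain p' q' where e: "(SOME (p, q). D = {p, q}) = (p', q')" by fastforce
  have "D = {p', q'}"
    using someI[of "\<lambda>(p, q). D = {p, q}" "(p, q)"] pq e by auto
  then have "wf_path C p'" "wf_path C q'" using pq by (auto simp: doubleton_eq_iff)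
  then show ?thesis
    unfolding disc_map_def e
    by (auto intro: path_map_in_cw_points[OF wf] DiscPt_in_cw_points[OF D])
qed

lemma topspace_cw_space:
  assumes "wf_complex2 C" shows "topspace (cw_space C) = cw_points C"
proof -
  have 1: "{x \<in> {0..1}. edge_map e x \<in> cw_points C} = {0..1}" if "e \<in> edges C" for e
    using edge_map_in_cw_points[OF assms that] by auto
  have 2: "{z \<in> cball 0 1. disc_map D z \<in> cw_points C} = cball 0 1" if "D \<in> discs C" for D
    using disc_map_in_cw_points[OF assms that] by auto
  have self: "openin (top_of_set T) T" for T :: "'c::topological_space set"
    using openin_topspace[of "top_of_set T"] by simp
  have "openin (cw_space C) (cw_points C)"
    unfolding openin_cw_space
  proof (intro conjI ballI)
    fix e assume "e \<in> edges C"
    from 1[OF this] show "openin (top_of_set {0..1}) {x \<in> {0..1}. edge_map e x \<in> cw_points C}"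
      by (simp only: self)
  next
    fix D assume "D \<in> discs C"
    from 2[OF this] show "openin (top_of_set (cball 0 1)) {z \<in> cball 0 1. disc_map D z \<in> cw_points C}"
      by (simp only: self)
  qed simp
  then show ?thesis
    using openin_subset openin_cw_space[of C "topspace (cw_space C)"] by blast
qed

section \<open>The complex of reduced expressions\<close>

definition cox2 :: "('a, 'b) monoid_scheme \<Rightarrow> 'a set \<Rightarrow> 'a set \<Rightarrow> 'a vertex complex2" where
  "cox2 G S J = \<lparr>verts = cox_vertices G S J, edges = cox_edges G S J, discs = braid_loops G S J\<rparr>"

lemma reduced_expression_in_vertices:
  assumes "group G" "reduced_expression G S J Is"
  shows "set (forward_path G S J Is) \<subseteq> cox_vertices G S J"
proof -
  have "forward_path G S J Is ! i \<in> cox_vertices G S J" if i: "i < length Is" for i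
  proof (cases i)
    case 0
    have "Is ! 0 = J" "J \<in> set Is"
      using assms(2) unfolding reduced_expression_def by (auto simp: hd_conv_nth)
    moreover have "\<one>\<^bsub>G\<^esub> \<in> carrier G"
      using assms(1) by (simp add: group.is_monoid monoid.one_closed)
    ultimately show ?thesis
      using assms(2) 0 i unfolding reduced_expression_def cox_vertices_def forward_path_def
      by (auto simp: upt_conv_Cons)
  next
    case (Suc j)
    then have "(forward_path G S J Is ! j, forward_path G S J Is ! i) \<in> cox_edges G S J"
      using assms(2) i unfolding reduced_expression_def successively_conv_nth
      by (auto simp: forward_path_def)
    then show ?thesis unfolding cox_edges_def by auto
  qed
  then show ?thesis
    by (auto simp: set_conv_nth forward_path_def)
qed

lemma braid_rel_nonempty: "braid_rel G S l r \<Longrightarrow> l \<noteq> [] \<and> r \<noteq> []"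
  by (induction rule: braid_rel.induct) (auto simp: switchback_expr_def Let_def)

lemma wf_path_segment:
  assumes "group G" "reduced_expression G S J (A @ l @ B)" "l \<noteq> []"
  shows "wf_path (cox2 G S J) (segment (forward_path G S J (A @ l @ B)) (length A) (length l))"
proof -
  let ?p = "forward_path G S J (A @ l @ B)"
  have "segment ?p (length A) (length l) \<noteq> []"
    using assms(3) unfolding segment_def forward_path_def by simp
  moreover have "set (segment ?p (length A) (length l)) \<subseteq> set ?p"
    unfolding segment_def by (meson set_drop_subset set_take_subset subset_trans)
  moreover have "successively (\<lambda>x y. (x, y) \<in> cox_edges G S J) (segment ?p (length A) (length l))"
    using assms(2) unfolding reduced_expression_def segment_def successively_conv_nth by auto
  ultimately show ?thesis
    using reduced_expression_in_vertices[OF assms(1,2)] unfolding wf_path_def cox2_def by auto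
qed

lemma wf_cox2:
  assumes "group G" shows "wf_complex2 (cox2 G S J)"
  unfolding wf_complex2_def
proof (intro conjI ballI)
  show "edges (cox2 G S J) \<subseteq> verts (cox2 G S J) \<times> verts (cox2 G S J)"
    unfolding cox2_def cox_edges_def by auto
next
  fix D assume "D \<in> discs (cox2 G S J)"
  then obtain \<alpha> \<beta> A B l r where *: "D = {\<alpha>, \<beta>}" "braid_rel G S l r"
    "reduced_expression G S J (A @ l @ B)" "reduced_expression G S J (A @ r @ B)"
    "\<alpha> = segment (forward_path G S J (A @ l @ B)) (length A) (length l)"
    "\<beta> = segment (forward_path G S J (A @ r @ B)) (length A) (length r)"
    "hd \<alpha> = hd \<beta>" "last \<alpha> = last \<beta>"
    unfolding cox2_def braid_loops_def by auto
  have "wf_path (cox2 G S J) \<alpha>" "wf_path (cox2 G S J) \<beta>"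
    using wf_path_segment[OF assms *(3)] wf_path_segment[OF assms *(4)] braid_rel_nonempty[OF *(2)]
    unfolding *(5,6) by blast+
  then show "\<exists>p q. D = {p, q} \<and> wf_path (cox2 G S J) p \<and> wf_path (cox2 G S J) q \<and>
      hd p = hd q \<and> last p = last q"
    using * by blast
qed

end

theory Submission
  imports Defs
begin

text \<open>A \<open>(J,I)\<close>-coset is determined by \<open>I\<close> and its maximal element \<open>w\<close>, and the pairs \<open>(I, w)\<close> that
  occur are those with \<open>J \<subseteq> LD(w)\<close> and \<open>I \<subseteq> RD(w)\<close>.  Hence the vertices for \<open>J\<close> are the vertices for
  the empty set that satisfy \<open>J \<subseteq> LD(w)\<close>, and it has to be seen that edges and discs, too, can be
  described by the pairs \<open>(I, w)\<close> without reference to \<open>J\<close>.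

  For a downward step this is clear, as it keeps \<open>w\<close>.  For an upward step the reason is the formula
  \<open>w w\<^sub>I = w\<^sub>J c m\<close> (\<open>bimax_formula\<close>), where \<open>m\<close> is the minimal element of the coset and \<open>c\<close> the
  longest element of \<open>W\<^sub>K\<close> with \<open>K = J \<inter> m I m\<^sup>-\<^sup>1\<close>.  A reduced upward step is one that keeps \<open>m\<close>
  and \<open>K\<close>, and by the formula this happens exactly when \<open>w w\<^sub>I\<close> is kept (\<open>reduced_up_iff\<close>), a
  condition free of \<open>J\<close>.

  A disc is attached along two parallel paths whose types are related by a braid relation, provided
  that these paths occur within reduced expressions.  Since every vertex can be reached from the
  base vertex (\<open>max_reach_base\<close>), that proviso always holds (\<open>braid_loops_eq\<close>), so the discs are
  determined by the graph.

  Thus the complex for \<open>J\<close> is isomorphic to the complex that the one for the empty set induces on a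
  set of vertices (\<open>complex_iso_same_max_coset\<close>).  The rest is topology: the cells whose closures
  contain only the given vertices are the cells of the induced complex, which carries the subspace
  topology, and isomorphic complexes are homeomorphic (\<open>cell_preserving_homeo_induced\<close>).

  The combinatorics of double cosets rests on the exchange condition, which is derived from the
  presentation by counting, modulo 2, the reflections attached to the letters of a word.\<close>

section \<open>The exchange condition\<close>

context coxeter_system
begin

abbreviation wp :: "'a list \<Rightarrow> 'a" where "wp \<equiv> word_prod G"
abbreviation len :: "'a \<Rightarrow> nat" where "len \<equiv> cox_length G S"

lemma S_closed [simp]: "s \<in> S \<Longrightarrow> s \<in> carrier G"
  using S_subset by auto

lemma wp_Nil [simp]: "wp [] = \<one>" and wp_Cons [simp]: "wp (s # u) = s \<otimes> wp u"
  by (simp_all add: word_prod_def)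

lemma wp_closed [simp]: "u \<in> lists S \<Longrightarrow> wp u \<in> carrier G"
  by (induction u) auto

lemma wp_append: "u \<in> lists S \<Longrightarrow> v \<in> lists S \<Longrightarrow> wp (u @ v) = wp u \<otimes> wp v"
  by (induction u) (auto simp: m_assoc)

lemma gen_sq [simp]: assumes "s \<in> S" shows "s \<otimes> s = \<one>"
proof -
  obtain m where m: "coxeter_matrix S m"
    "\<And>u v. u \<in> lists S \<Longrightarrow> v \<in> lists S \<Longrightarrow> wp u = wp v \<longleftrightarrow> coxeter_cong S m u v"
    using presented by auto
  have "m s s = 1" using m(1) assms unfolding coxeter_matrix_def by blast
  then have "coxeter_cong S m [s, s] []"
    using coxeter_cong.rel[of "[]" S "[]" s s m] assms by simp
  then have "wp [s, s] = wp []" using m(2)[of "[s,s]" "[]"] assms by simp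
  then show ?thesis using assms by simp
qed

lemma gen_inv [simp]: "s \<in> S \<Longrightarrow> inv s = s"
  by (rule inv_equality) auto

lemma gen_cancel [simp]: "s \<in> S \<Longrightarrow> x \<in> carrier G \<Longrightarrow> s \<otimes> (s \<otimes> x) = x"
  by (simp add: m_assoc[symmetric])

lemma wp_rev: "u \<in> lists S \<Longrightarrow> wp (rev u) = inv (wp u)"
  by (induction u) (auto simp: wp_append inv_mult_group in_lists_conv_set)

text \<open>The reflection of the letter at position \<open>i\<close> is the conjugate of that letter by the prefix in
  front of it; multiplying the word by it from the left deletes that letter.\<close>

primrec letter_reflections :: "'a list \<Rightarrow> 'a list" where
  "letter_reflections [] = []"
| "letter_reflections (s # u) = s # map (conj_by G s) (letter_reflections u)"

lemma letter_reflections_closed: "u \<in> lists S \<Longrightarrow> set (letter_reflections u) \<subseteq> carrier G"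
  by (induction u) (auto simp: conj_by_def)

lemma conj_by_mult: "g \<in> carrier G \<Longrightarrow> h \<in> carrier G \<Longrightarrow> x \<in> carrier G \<Longrightarrow>
    conj_by G (g \<otimes> h) x = conj_by G g (conj_by G h x)"
  by (simp add: conj_by_def inv_mult_group m_assoc)

lemma conj_by_one [simp]: "x \<in> carrier G \<Longrightarrow> conj_by G \<one> x = x"
  by (simp add: conj_by_def)

lemma conj_by_closed [simp]: "g \<in> carrier G \<Longrightarrow> x \<in> carrier G \<Longrightarrow> conj_by G g x \<in> carrier G"
  by (simp add: conj_by_def)

lemma conj_by_inv_cancel [simp]:
  "g \<in> carrier G \<Longrightarrow> x \<in> carrier G \<Longrightarrow> conj_by G (inv g) (conj_by G g x) = x"
  "g \<in> carrier G \<Longrightarrow> x \<in> carrier G \<Longrightarrow> conj_by G g (conj_by G (inv g) x) = x"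
  by (simp_all add: conj_by_mult[symmetric])

lemma conj_by_eq_iff: "g \<in> carrier G \<Longrightarrow> x \<in> carrier G \<Longrightarrow> y \<in> carrier G \<Longrightarrow>
    conj_by G g x = y \<longleftrightarrow> x = conj_by G (inv g) y"
  by (metis conj_by_inv_cancel)

lemma letter_reflections_append: "u \<in> lists S \<Longrightarrow> v \<in> lists S \<Longrightarrow>
    letter_reflections (u @ v) = letter_reflections u @ map (conj_by G (wp u)) (letter_reflections v)"
proof (induction u)
  case Nil
  then show ?case using letter_reflections_closed[of v] by (auto intro!: map_idI[symmetric])
next
  case (Cons s u)
  then show ?case using letter_reflections_closed[of v]
    by (auto simp: conj_by_mult subset_iff)
qed

lemma count_map_conj:
  "g \<in> carrier G \<Longrightarrow> set L \<subseteq> carrier G \<Longrightarrow> t \<in> carrier G \<Longrightarrow>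
    count_list (map (conj_by G g) L) t = count_list L (conj_by G (inv g) t)"
  by (induction L) (auto simp: conj_by_eq_iff)

text \<open>Conjugation by \<open>s t\<close> takes \<open>(s t)\<^sup>i s\<close> to the same expression with exponent \<open>i + 2\<close>.  If
  \<open>(s t)\<^sup>k = 1\<close>, then \<open>i\<close> and \<open>i + k\<close> give the same reflection, and the list consists of two equal
  halves.\<close>

lemma letter_reflections_dihedral:
  assumes "s \<in> S" "t \<in> S"
  shows "letter_reflections (concat (replicate k [s, t])) = map (\<lambda>i. (s \<otimes> t) [^] i \<otimes> s) [0..<2 * k]"
proof (induction k)
  case (Suc k)
  have shift: "conj_by G s (conj_by G t ((s \<otimes> t) [^] i \<otimes> s)) = (s \<otimes> t) [^] Suc (Suc i) \<otimes> s" for i :: nat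
  proof -
    have "conj_by G s (conj_by G t ((s \<otimes> t) [^] i \<otimes> s)) = (s \<otimes> t) \<otimes> (s \<otimes> t) [^] i \<otimes> (s \<otimes> t \<otimes> s)"
      using assms by (simp add: conj_by_def m_assoc)
    also have "\<dots> = (s \<otimes> t) [^] Suc i \<otimes> (s \<otimes> t \<otimes> s)"
      using nat_pow_Suc2[of "s \<otimes> t" i] assms by simp
    also have "\<dots> = (s \<otimes> t) [^] Suc (Suc i) \<otimes> s" using assms by (simp add: m_assoc)
    finally show ?thesis .
  qed
  have "[0..<2 * Suc k] = 0 # Suc 0 # map (\<lambda>i. Suc (Suc i)) [0..<2 * k]"
    by (rule nth_equalityI) (auto simp: nth_Cons simp del: upt_Suc split: nat.split)
  then show ?case using Suc assms shift
    by (simp add: o_def conj_by_def del: upt_Suc nat_pow_Suc) 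
qed simp

lemma even_letter_reflections_relation:
  assumes "s \<in> S" "t \<in> S" "wp (concat (replicate k [s, t])) = \<one>"
  shows "even (count_list (letter_reflections (concat (replicate k [s, t]))) x)"
proof -
  have pow: "wp (concat (replicate i [s, t])) = (s \<otimes> t) [^] i" for i
    using assms(1,2)
  proof (induction i)
    case (Suc i)
    then show ?case using nat_pow_Suc2[of "s \<otimes> t" i] by (simp add: m_assoc del: nat_pow_Suc)
  qed simp
  have 1: "(s \<otimes> t) [^] k = \<one>" using assms(3) pow by simp
  let ?f = "\<lambda>i. (s \<otimes> t) [^] (i::nat) \<otimes> s"
  have "map ?f [0..<2 * k] = map ?f [0..<k] @ map ?f [k..<k + k]"
    by (metis map_append mult_2 upt_add_eq_append zero_le)
  also have "map ?f [k..<k + k] = map (\<lambda>i. ?f (i + k)) [0..<k]"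
    by (rule nth_equalityI) (auto simp: add.commute)
  also have "\<dots> = map ?f [0..<k]"
    using 1 assms(1,2) by (simp add: nat_pow_mult[symmetric])
  finally show ?thesis unfolding letter_reflections_dihedral[OF assms(1,2)]
    by (simp add: count_list_append)
qed

lemma coxeter_cong_lists: "coxeter_cong S m u v \<Longrightarrow> u \<in> lists S \<and> v \<in> lists S"
proof (induction rule: coxeter_cong.induct)
  case (rel u v s t)
  have "concat (replicate k [s, t]) \<in> lists S" for k using rel by (induction k) auto
  with rel show ?case by simp
qed auto

text \<open>Inserting a relation \<open>(s t)\<^sup>m\<close> conjugates the later reflections by the identity and adds
  reflections with even multiplicity, since both halves of the relation contribute the same ones.\<close>

lemma letter_reflections_parity:
  assumes "u \<in> lists S" "v \<in> lists S" "wp u = wp v" "x \<in> carrier G"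
  shows "even (count_list (letter_reflections u) x) \<longleftrightarrow> even (count_list (letter_reflections v) x)"
    and "even (length u) \<longleftrightarrow> even (length v)"
proof -
  obtain m where m: "coxeter_matrix S m"
    "\<And>u v. u \<in> lists S \<Longrightarrow> v \<in> lists S \<Longrightarrow> wp u = wp v \<longleftrightarrow> coxeter_cong S m u v"
    using presented by auto
  have "coxeter_cong S m u v" using m(2) assms by blast
  then have "(\<forall>x\<in>carrier G. even (count_list (letter_reflections u) x) \<longleftrightarrow> even (count_list (letter_reflections v) x))
      \<and> (even (length u) \<longleftrightarrow> even (length v))"
  proof (induction rule: coxeter_cong.induct)
    case (rel u v s t)
    let ?r = "concat (replicate (m s t) [s, t])"
    have r: "?r \<in> lists S" using coxeter_cong_lists[OF coxeter_cong.rel[OF rel]] by simp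
    have "coxeter_cong S m ?r []" using coxeter_cong.rel[of "[]" S "[]" s t m] rel by simp
    then have one: "wp ?r = \<one>" using m(2)[OF r, of "[]"] by simp
    have ev: "even (count_list (letter_reflections ?r) x)" for x
      by (rule even_letter_reflections_relation[OF rel(3,4) one])
    have split: "letter_reflections (u @ ?r @ v) = letter_reflections u
        @ map (conj_by G (wp u)) (letter_reflections ?r) @ map (conj_by G (wp u)) (letter_reflections v)"
      using rel r one letter_reflections_closed[of v]
      by (simp add: letter_reflections_append subset_iff)
    have "even (length ?r)" by (simp add: length_concat sum_list_replicate)
    then have "even (length (u @ ?r @ v)) \<longleftrightarrow> even (length (u @ v))"
      by simp
    moreover have "even (count_list (letter_reflections (u @ ?r @ v)) x)
        \<longleftrightarrow> even (count_list (letter_reflections (u @ v)) x)" if x: "x \<in> carrier G" for x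
    proof -
      have "even (count_list (map (conj_by G (wp u)) (letter_reflections ?r)) x)"
        using count_map_conj[of "wp u" "letter_reflections ?r" x] ev rel r letter_reflections_closed[OF r] x
        by simp
      then show ?thesis unfolding split using rel by (simp add: letter_reflections_append count_list_append)
    qed
    ultimately show ?case by blast
  qed auto
  then show "even (count_list (letter_reflections u) x) \<longleftrightarrow> even (count_list (letter_reflections v) x)"
    "even (length u) \<longleftrightarrow> even (length v)" using assms(4) by blast+
qed

lemma letter_reflection_deletes:
  "u \<in> lists S \<Longrightarrow> x \<in> set (letter_reflections u) \<Longrightarrow> \<exists>a s b. u = a @ s # b \<and> x \<otimes> wp u = wp (a @ b)"
proof (induction u arbitrary: x)
  case (Cons s u)
  show ?case
  proof (cases "x = s")
    case True
    then have "s # u = [] @ s # u" "x \<otimes> wp (s # u) = wp ([] @ u)" using Cons.prems by auto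
    then show ?thesis by blast
  next
    case False
    then obtain y where y: "y \<in> set (letter_reflections u)" "x = conj_by G s y"
      using Cons.prems by auto
    have yc: "y \<in> carrier G" using letter_reflections_closed[of u] y Cons.prems by auto
    obtain a r b where ab: "u = a @ r # b" "y \<otimes> wp u = wp (a @ b)"
      using Cons.IH[of y] Cons.prems y by auto
    have "s # u = (s # a) @ r # b" using ab by simp
    moreover have "x \<otimes> wp (s # u) = s \<otimes> (y \<otimes> wp u)"
      using Cons.prems y yc by (simp add: conj_by_def m_assoc)
    ultimately show ?thesis using ab by (metis append_Cons wp_Cons)
  qed
qed simp

lemma len_le: "u \<in> lists S \<Longrightarrow> len (wp u) \<le> length u"
  unfolding cox_length_def by (rule Least_le) blast

lemma reduced_word_exists:
  assumes "w \<in> carrier G" obtains u where "u \<in> lists S" "wp u = w" "length u = len w"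
proof -
  obtain v where "v \<in> lists S" "wp v = w" using assms generated by auto
  then have "\<exists>n. \<exists>u\<in>lists S. length u = n \<and> wp u = w" by blast
  from LeastI_ex[OF this] show ?thesis using that unfolding cox_length_def by blast
qed

lemma len_one [simp]: "len \<one> = 0"
  using len_le[of "[]"] by simp

lemma len_0_iff: "w \<in> carrier G \<Longrightarrow> len w = 0 \<longleftrightarrow> w = \<one>"
  by (metis len_one length_0_conv reduced_word_exists wp_Nil)

lemma len_inv [simp]: assumes "w \<in> carrier G" shows "len (inv w) = len w"
proof -
  have "len (inv w) \<le> len w" if w: "w \<in> carrier G" for w
  proof -
    obtain u where "u \<in> lists S" "wp u = w" "length u = len w" by (rule reduced_word_exists[OF w])
    then show ?thesis using len_le[of "rev u"] wp_rev[of u] by (simp add: in_lists_conv_set)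
  qed
  from this[of w] this[of "inv w"] assms show ?thesis by simp
qed

lemma len_mult_le: assumes "v \<in> carrier G" "w \<in> carrier G" shows "len (v \<otimes> w) \<le> len v + len w"
proof -
  obtain a b where "a \<in> lists S" "wp a = v" "length a = len v" "b \<in> lists S" "wp b = w" "length b = len w"
    by (metis assms reduced_word_exists)
  then show ?thesis using len_le[of "a @ b"] by (auto simp: wp_append)
qed

lemma even_len: "u \<in> lists S \<Longrightarrow> even (len (wp u)) \<longleftrightarrow> even (length u)"
  using letter_reflections_parity(2)[of _ u \<one>] reduced_word_exists[of "wp u"] by (metis one_closed wp_closed)

lemma even_len_gen_mult: assumes "s \<in> S" "w \<in> carrier G"
  shows "even (len (s \<otimes> w)) \<longleftrightarrow> odd (len w)"
proof -
  obtain u where u: "u \<in> lists S" "wp u = w" "length u = len w" by (rule reduced_word_exists[OF assms(2)])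
  then show ?thesis using even_len[of u] even_len[of "s # u"] assms by auto
qed

lemma len_gen [simp]: assumes "s \<in> S" shows "len s = 1"
  using even_len_gen_mult[of s \<one>] len_le[of "[s]"] assms by (auto simp: le_Suc_eq)

lemma len_gen_mult_cases:
  assumes "s \<in> S" "w \<in> carrier G"
  shows "len (s \<otimes> w) = Suc (len w) \<or> len w = Suc (len (s \<otimes> w))"
  using even_len_gen_mult[OF assms] len_mult_le[of s w] len_mult_le[of s "s \<otimes> w"] assms
  by (auto simp: le_Suc_eq)

text \<open>If \<open>s w\<close> is shorter than \<open>w\<close>, the value of \<open>u\<close>, then \<open>s\<close> is a letter reflection of a word of \<open>w\<close> starting
  with \<open>s\<close>, with odd multiplicity; by parity it is one of every word of \<open>w\<close>.\<close>

theorem exchange: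
  assumes "s \<in> S" "u \<in> lists S" "len (s \<otimes> wp u) < len (wp u)"
  obtains a r b where "u = a @ r # b" "s \<otimes> wp u = wp (a @ b)"
proof -
  obtain v where v: "v \<in> lists S" "wp v = s \<otimes> wp u" "length v = len (s \<otimes> wp u)"
    by (rule reduced_word_exists[of "s \<otimes> wp u"]) (use assms in auto)
  have su: "wp (s # v) = wp u" using v assms by simp
  \<comment> \<open>Otherwise \<open>s\<close> would delete a letter of \<open>v\<close>, making \<open>w = s (s w)\<close> shorter than \<open>s w\<close>.\<close>
  have "s \<notin> set (letter_reflections v)"
  proof
    assume "s \<in> set (letter_reflections v)"
    then obtain a r b where ab: "v = a @ r # b" "s \<otimes> wp v = wp (a @ b)"
      using letter_reflection_deletes[of v s] v by blast
    then have "len (wp u) \<le> length (a @ b)" using su v len_le[of "a @ b"] by auto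
    then show False using ab v assms by simp
  qed
  then have "s \<notin> set (map (conj_by G s) (letter_reflections v))"
    using letter_reflections_closed[of v] v assms
    by (auto simp: conj_by_eq_iff subset_iff eq_commute[of s]) (simp add: conj_by_def m_assoc)
  then have "odd (count_list (letter_reflections (s # v)) s)" by (simp add: count_list_0_iff)
  then have "odd (count_list (letter_reflections u) s)"
    using letter_reflections_parity(1)[of "s # v" u s] su v assms by simp
  then have "s \<in> set (letter_reflections u)" by (metis count_list_0_iff even_zero)
  then show ?thesis using letter_reflection_deletes[of u s] assms that by blast
qed

lemma len_mult_gen:
  assumes "s \<in> S" "w \<in> carrier G" shows "len (w \<otimes> s) = len (s \<otimes> inv w)"
  using len_inv[of "w \<otimes> s"] assms by (simp add: inv_mult_group)

lemma len_mult_gen_cases: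
  assumes "s \<in> S" "w \<in> carrier G"
  shows "len (w \<otimes> s) = Suc (len w) \<or> len w = Suc (len (w \<otimes> s))"
  using len_gen_mult_cases[of s "inv w"] len_mult_gen[of s w] assms by simp

corollary exchange_right:
  assumes "s \<in> S" "u \<in> lists S" "len (wp u \<otimes> s) < len (wp u)"
  obtains a r b where "u = a @ r # b" "wp u \<otimes> s = wp (a @ b)"
proof -
  have ru: "rev u \<in> lists S" using assms by (simp add: in_lists_conv_set)
  obtain a r b where ab: "rev u = a @ r # b" "s \<otimes> wp (rev u) = wp (a @ b)"
    using exchange[of s "rev u"] assms ru len_mult_gen[of s "wp u"] by (auto simp: wp_rev)
  have l: "a \<in> lists S" "b \<in> lists S" using ab ru by auto
  have "u = rev b @ r # rev a" using arg_cong[OF ab(1), of rev] by simp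
  moreover have "wp u \<otimes> s = wp (rev b @ rev a)"
    using arg_cong[OF ab(2), of "\<lambda>x. inv x"] assms l wp_rev[of "a @ b"] by (simp add: wp_rev inv_mult_group)
  ultimately show ?thesis using that by blast
qed

end

section \<open>Parabolic double cosets\<close>

context coxeter_system
begin

abbreviation RD :: "'a \<Rightarrow> 'a set" where "RD w \<equiv> {s \<in> S. len (w \<otimes> s) < len w}"
abbreviation LD :: "'a \<Rightarrow> 'a set" where "LD w \<equiv> left_descents G S w"
abbreviation W :: "'a set \<Rightarrow> 'a set" where "W I \<equiv> generate G I"
abbreviation DC :: "'a set \<Rightarrow> 'a set \<Rightarrow> 'a \<Rightarrow> 'a set" where "DC J I w \<equiv> double_coset G J I w"

lemma W_eq_words: assumes "I \<subseteq> S" shows "W I = wp ` lists I"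
proof
  have IS: "u \<in> lists I \<Longrightarrow> u \<in> lists S" for u using assms by auto
  show "W I \<subseteq> wp ` lists I"
  proof
    fix x assume "x \<in> W I"
    then show "x \<in> wp ` lists I"
    proof (induction rule: generate.induct)
      case one
      have "\<one> = wp []" by simp
      then show ?case by blast
    next
      case (incl h)
      then have "h = wp [h]" using assms by auto
      then show ?case using incl by (intro image_eqI[of _ _ "[h]"]) auto
    next
      case (inv h)
      then have "inv h = wp [h]" using assms by auto
      then show ?case using inv by (intro image_eqI[of _ _ "[h]"]) auto
    next
      case (eng h1 h2)
      then obtain u v where "u \<in> lists I" "v \<in> lists I" "h1 = wp u" "h2 = wp v" by blast
      then show ?case using wp_append[of u v] IS by (intro image_eqI[of _ _ "u @ v"]) auto
    qed
  qed
  have "wp u \<in> W I" if "u \<in> lists I" for u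
    using that by (induction u) (auto intro: generate.intros)
  then show "wp ` lists I \<subseteq> W I" by auto
qed

lemma W_subgroup: "I \<subseteq> S \<Longrightarrow> subgroup (W I) G"
  by (rule generate_is_subgroup) (use S_subset in auto)

lemma W_closed [simp]: "I \<subseteq> S \<Longrightarrow> a \<in> W I \<Longrightarrow> a \<in> carrier G"
  using W_subgroup subgroup.subset by blast

lemma W_mult [simp]: "a \<in> W I \<Longrightarrow> b \<in> W I \<Longrightarrow> a \<otimes> b \<in> W I"
  by (rule generate.eng)

lemma W_inv [simp]: "I \<subseteq> S \<Longrightarrow> a \<in> W I \<Longrightarrow> inv a \<in> W I"
  by (rule subgroup.m_inv_closed[OF W_subgroup])

lemma W_one [simp]: "\<one> \<in> W I"
  by (rule generate.one)

lemma W_gen [simp]: "s \<in> I \<Longrightarrow> s \<in> W I"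
  by (rule generate.incl)

lemma W_word: "I \<subseteq> S \<Longrightarrow> u \<in> lists I \<Longrightarrow> wp u \<in> W I"
  using W_eq_words by blast

lemma W_mono: "I \<subseteq> K \<Longrightarrow> W I \<subseteq> W K"
  by (rule mono_generate)

text \<open>Exchange only deletes letters, so a word in \<open>I\<close> can be shortened to a reduced word in \<open>I\<close>.\<close>

lemma W_reduced_word:
  assumes "I \<subseteq> S" "a \<in> W I"
  obtains u where "u \<in> lists I" "wp u = a" "length u = len a"
proof -
  have "\<exists>v\<in>lists I. wp v = wp u \<and> length v = len (wp u)" if "u \<in> lists I" for u
    using that
  proof (induction u)
    case (Cons s u)
    then obtain v where v: "v \<in> lists I" "wp v = wp u" "length v = len (wp u)" by auto
    have s: "s \<in> I" "s \<in> S" "v \<in> lists S" "u \<in> lists S" using Cons.hyps v assms by auto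
    have wu: "wp u \<in> carrier G" using s(4) by simp
    show ?case
    proof (cases "len (s \<otimes> wp v) < len (wp v)")
      case True
      then obtain a r b where ab: "v = a @ r # b" "s \<otimes> wp v = wp (a @ b)"
        using exchange[of s v] s by metis
      have "len (s \<otimes> wp v) = length (a @ b)"
        using len_gen_mult_cases[of s "wp v"] True s v ab wu by auto
      then show ?thesis using ab v s by (intro bexI[of _ "a @ b"]) auto
    next
      case False
      then have "length (s # v) = len (wp (s # v))" using len_gen_mult_cases[of s "wp v"] s v wu False by auto
      then show ?thesis using v s by (intro bexI[of _ "s # v"]) auto
    qed
  qed auto
  then show ?thesis using assms W_eq_words that by (metis imageE)
qed

lemma double_coset_iff:
  assumes "J \<subseteq> S" "I \<subseteq> S" "w \<in> carrier G"
  shows "x \<in> DC J I w \<longleftrightarrow> (\<exists>a\<in>W J. \<exists>b\<in>W I. x = a \<otimes> w \<otimes> b)"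
  by (auto simp: double_coset_def r_coset_def set_mult_def)

lemma double_cosetI: "a \<in> W J \<Longrightarrow> b \<in> W I \<Longrightarrow> a \<otimes> w \<otimes> b \<in> DC J I w"
  by (auto simp: double_coset_def r_coset_def set_mult_def)

context
  fixes J I :: "'a set"
  assumes J: "J \<subseteq> S" and I: "I \<subseteq> S"
begin

lemma double_coset_closed: "w \<in> carrier G \<Longrightarrow> x \<in> DC J I w \<Longrightarrow> x \<in> carrier G"
  using J I by (auto simp: double_coset_iff)

lemma double_coset_self: "w \<in> carrier G \<Longrightarrow> w \<in> DC J I w"
  using double_cosetI[of \<one> J \<one> I w] by simp

lemma double_coset_mult:
  assumes "w \<in> carrier G" "x \<in> DC J I w" "a \<in> W J" "b \<in> W I" shows "a \<otimes> x \<otimes> b \<in> DC J I w"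
proof -
  obtain c d where cd: "c \<in> W J" "d \<in> W I" "x = c \<otimes> w \<otimes> d" using assms(2) J I assms(1) double_coset_iff by metis
  then have "a \<otimes> x \<otimes> b = (a \<otimes> c) \<otimes> w \<otimes> (d \<otimes> b)" using assms J I W_closed by (simp add: m_assoc)
  then show ?thesis using double_cosetI[of "a \<otimes> c" J "d \<otimes> b" I w] cd assms by simp
qed

lemma double_coset_mult_left:
  "w \<in> carrier G \<Longrightarrow> x \<in> DC J I w \<Longrightarrow> a \<in> W J \<Longrightarrow> a \<otimes> x \<in> DC J I w"
  using double_coset_mult[of w x a \<one>] J W_closed[OF J] double_coset_closed by simp

lemma double_coset_mult_right:
  "w \<in> carrier G \<Longrightarrow> x \<in> DC J I w \<Longrightarrow> b \<in> W I \<Longrightarrow> x \<otimes> b \<in> DC J I w"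
  using double_coset_mult[of w x \<one> b] I W_closed[OF I] double_coset_closed by simp

lemma double_coset_sym:
  assumes "w \<in> carrier G" "x \<in> DC J I w" shows "w \<in> DC J I x"
proof -
  obtain c d where cd: "c \<in> W J" "d \<in> W I" "x = c \<otimes> w \<otimes> d" using assms(2) J I assms(1) double_coset_iff by metis
  then have cl: "c \<in> carrier G" "d \<in> carrier G" using J I by auto
  then have "inv c \<otimes> x = w \<otimes> d" using cd assms by (simp add: m_assoc l_inv[of c] flip: m_assoc[of "inv c" c])
  then have "w = inv c \<otimes> x \<otimes> inv d" using cl assms by (simp add: m_assoc)
  then show ?thesis using cd J I double_cosetI[of "inv c" J "inv d" I x] by simp
qed

lemma double_coset_eq:
  assumes "w \<in> carrier G" "x \<in> DC J I w" shows "DC J I x = DC J I w"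
proof -
  have x: "x \<in> carrier G" using assms double_coset_closed by blast
  have "DC J I x \<subseteq> DC J I w"
    using double_coset_mult[OF assms] by (auto simp: double_coset_iff[OF J I x])
  moreover have "DC J I w \<subseteq> DC J I x"
    using double_coset_mult[OF x double_coset_sym[OF assms]]
    by (auto simp: double_coset_iff[OF J I assms(1)])
  ultimately show ?thesis by blast
qed

end

lemma double_coset_inv:
  assumes "J \<subseteq> S" "I \<subseteq> S" "w \<in> carrier G" "x \<in> DC J I w" shows "inv x \<in> DC I J (inv w)"
proof -
  obtain c d where cd: "c \<in> W J" "d \<in> W I" "x = c \<otimes> w \<otimes> d" using assms double_coset_iff by metis
  then have "inv x = inv d \<otimes> inv w \<otimes> inv c" using assms W_closed by (simp add: inv_mult_group m_assoc)
  then show ?thesis using double_cosetI[of "inv d" I "inv c" J "inv w"] cd assms by simp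
qed

text \<open>Only multiplication by single generators is tested; that these local conditions single out one
  element of each double coset is the content of \<open>bimin_unique\<close> and \<open>bimax_unique\<close>.\<close>

definition bimin :: "'a set \<Rightarrow> 'a set \<Rightarrow> 'a \<Rightarrow> bool" where
  "bimin J I m \<longleftrightarrow> m \<in> carrier G \<and> (\<forall>s\<in>J. len m < len (s \<otimes> m)) \<and> (\<forall>s\<in>I. len m < len (m \<otimes> s))"

definition bimax :: "'a set \<Rightarrow> 'a set \<Rightarrow> 'a \<Rightarrow> bool" where
  "bimax J I w \<longleftrightarrow> w \<in> carrier G \<and> J \<subseteq> LD w \<and> I \<subseteq> RD w"

lemma split_at_letter:
  "p @ r # q = a @ b \<Longrightarrow>
    (\<exists>q'. a = p @ r # q' \<and> q = q' @ b) \<or> (\<exists>p'. b = p' @ r # q \<and> p = a @ p')"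
  by (auto simp: append_eq_append_conv2 Cons_eq_append_conv append_eq_Cons_conv)

text \<open>If multiplication by a generator shortens a length-additive product \<open>a m b\<close>, then exchange
  deletes a letter of \<open>a\<close> or of \<open>b\<close>, for a shorter \<open>m\<close> would contradict minimality.\<close>

lemma additive_factorization_step:
  assumes J: "J \<subseteq> S" and I: "I \<subseteq> S" and m: "m \<in> carrier G"
    and min: "\<And>x. x \<in> DC J I m \<Longrightarrow> len m \<le> len x"
    and a: "a \<in> W J" and b: "b \<in> W I" and add: "len (a \<otimes> m \<otimes> b) = len a + len m + len b"
    and s: "s \<in> J"
  shows "\<exists>a'\<in>W J. \<exists>b'\<in>W I. s \<otimes> (a \<otimes> m \<otimes> b) = a' \<otimes> m \<otimes> b' \<and>
    len (a' \<otimes> m \<otimes> b') = len a' + len m + len b'"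
proof -
  let ?x = "a \<otimes> m \<otimes> b"
  have sS: "s \<in> S" using s J by auto
  have ac: "a \<in> carrier G" and bc: "b \<in> carrier G" using a b J I by auto
  note cl = ac bc m sS
  obtain ua where ua: "ua \<in> lists J" "wp ua = a" "length ua = len a" by (rule W_reduced_word[OF J a])
  obtain ub where ub: "ub \<in> lists I" "wp ub = b" "length ub = len b" by (rule W_reduced_word[OF I b])
  obtain um where um: "um \<in> lists S" "wp um = m" "length um = len m" by (rule reduced_word_exists[OF m])
  have lS: "ua \<in> lists S" "ub \<in> lists S" using ua ub J I by auto
  have le: "len (c \<otimes> m \<otimes> d) \<le> len c + len m + len d" if "c \<in> carrier G" "d \<in> carrier G" for c d
    using len_mult_le[of "c \<otimes> m" d] len_mult_le[of c m] that m by simp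
  consider "len (s \<otimes> ?x) = Suc (len ?x)" | "len ?x = Suc (len (s \<otimes> ?x))"
    using len_gen_mult_cases[of s ?x] cl by auto
  then show ?thesis
  proof cases
    case 1
    have eq: "s \<otimes> ?x = (s \<otimes> a) \<otimes> m \<otimes> b" using cl by (simp add: m_assoc)
    have "len (s \<otimes> a) \<le> Suc (len a)" using len_mult_le[of s a] cl by simp
    then have "len (s \<otimes> a \<otimes> m \<otimes> b) = len (s \<otimes> a) + len m + len b"
      using 1 add eq le[of "s \<otimes> a" b] cl by simp
    then show ?thesis using eq a b s by (intro bexI[of _ "s \<otimes> a"] bexI[of _ b]) auto
  next
    case 2
    have x: "wp (ua @ um @ ub) = ?x" using ua um ub lS by (simp add: wp_append m_assoc cl)
    have "len (s \<otimes> wp (ua @ um @ ub)) < len (wp (ua @ um @ ub))" using 2 x by simp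
    then obtain p r q where pq: "ua @ um @ ub = p @ r # q" "s \<otimes> ?x = wp (p @ q)"
      using exchange[OF sS, of "ua @ um @ ub"] lS um x by (metis append_in_lists_conv)
    consider (A) q' where "ua = p @ r # q'" "q = q' @ um @ ub"
      | (M) p' q' where "um = p' @ r # q'" "p = ua @ p'" "q = q' @ ub"
      | (B) p' where "ub = p' @ r # q" "p = ua @ um @ p'"
      using split_at_letter[OF pq(1)[symmetric]] split_at_letter[of _ r q um ub] by (metis append.assoc)
    then show ?thesis
    proof cases
      case A
      let ?a = "wp (p @ q')"
      have pq': "p @ q' \<in> lists J" using A ua by auto
      then have aJ: "?a \<in> W J" by (rule W_word[OF J])
      have l: "p \<in> lists S" "q' \<in> lists S" using A lS by auto
      have eq: "s \<otimes> ?x = ?a \<otimes> m \<otimes> b"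
        using pq(2) A l um ub lS by (simp add: wp_append m_assoc cl)
      have "len ?a < len a" using len_le[of "p @ q'"] l A ua by simp
      then have "len (?a \<otimes> m \<otimes> b) = len ?a + len m + len b"
        using 2 add eq le[of ?a b] aJ J bc by simp
      then show ?thesis using eq aJ b by blast
    next
      case M
      let ?m = "wp (p' @ q')"
      have l: "p' \<in> lists S" "q' \<in> lists S" using M um by auto
      have mc: "?m \<in> carrier G" using l by simp
      have eq: "s \<otimes> ?x = a \<otimes> ?m \<otimes> b"
        using pq(2) M l ua ub lS by (simp add: wp_append m_assoc cl)
      have "?x \<in> DC J I m" using a b by (rule double_cosetI)
      then have "s \<otimes> ?x \<in> DC J I m" using double_coset_mult_left[OF J I m] s by simp
      then have "DC J I (s \<otimes> ?x) = DC J I m" using double_coset_eq[OF J I m] by simp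
      moreover have "DC J I (s \<otimes> ?x) = DC J I ?m"
        using double_coset_eq[OF J I mc] double_cosetI[OF a b, of ?m] eq by simp
      ultimately have "?m \<in> DC J I m" using double_coset_self[OF J I mc] by simp
      then have "len m \<le> len ?m" by (rule min)
      moreover have "len ?m < len m" using len_le[of "p' @ q'"] l M um by simp
      ultimately show ?thesis by simp
    next
      case B
      let ?b = "wp (p' @ q)"
      have "p' @ q \<in> lists I" using B ub by auto
      then have bI: "?b \<in> W I" by (rule W_word[OF I])
      have l: "p' \<in> lists S" "q \<in> lists S" using B lS by auto
      have eq: "s \<otimes> ?x = a \<otimes> m \<otimes> ?b"
        using pq(2) B l um ua lS by (simp add: wp_append m_assoc cl)
      have "len ?b < len b" using len_le[of "p' @ q"] l B ub by simp
      then have "len (a \<otimes> m \<otimes> ?b) = len a + len m + len ?b"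
        using 2 add eq le[of a ?b] bI I ac by simp
      then show ?thesis using eq bI a by blast
    qed
  qed
qed

text \<open>Every element of the double coset arises from \<open>m\<close> by multiplication with generators on both
  sides.  The preceding lemma treats generators on the left, and by passing to inverses those on the
  right.\<close>

lemma additive_factorization_minimal:
  assumes J: "J \<subseteq> S" and I: "I \<subseteq> S" and m: "m \<in> carrier G"
    and min: "\<And>x. x \<in> DC J I m \<Longrightarrow> len m \<le> len x" and x: "x \<in> DC J I m"
  shows "\<exists>a\<in>W J. \<exists>b\<in>W I. x = a \<otimes> m \<otimes> b \<and> len x = len a + len m + len b"
proof -
  define P where "P = (\<lambda>J I m x. \<exists>a\<in>W J. \<exists>b\<in>W I. x = a \<otimes> m \<otimes> b \<and> len x = len a + len m + len b)"
  have Pinv: "P I J (inv m) (inv x)" if PJI: "P J I m x" "J \<subseteq> S" "I \<subseteq> S" "m \<in> carrier G" for J I m x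
  proof -
    obtain a b where ab: "a \<in> W J" "b \<in> W I" "x = a \<otimes> m \<otimes> b" "len x = len a + len m + len b"
      using PJI unfolding P_def by blast
    then have cl: "a \<in> carrier G" "b \<in> carrier G" using that by auto
    have "inv x = inv b \<otimes> inv m \<otimes> inv a" using ab cl that by (simp add: inv_mult_group m_assoc)
    moreover have "len (inv x) = len (inv b) + len (inv m) + len (inv a)"
      using ab(3,4) cl that by simp
    ultimately show ?thesis using ab that unfolding P_def
      by (intro bexI[of _ "inv b"] bexI[of _ "inv a"]) auto
  qed
  have left: "P J I m (s \<otimes> x)" if "P J I m x" "s \<in> J" for s x
    using additive_factorization_step[OF J I m min _ _ _ that(2)] that(1) unfolding P_def by metis
  have right: "P J I m (x \<otimes> s)" if "P J I m x" "s \<in> I" "x \<in> carrier G" for s x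
  proof -
    have "len (inv m) \<le> len y" if y: "y \<in> DC I J (inv m)" for y
    proof -
      have "inv y \<in> DC J I m" using double_coset_inv[OF I J _ y] m by simp
      then show ?thesis using min[of "inv y"] double_coset_closed[OF I J _ y] m by simp
    qed
    note step = additive_factorization_step[OF I J inv_closed[OF m] this _ _ _ that(2)]
    have "P I J (inv m) (s \<otimes> inv x)"
      using Pinv[OF that(1) J I m] step unfolding P_def by metis
    then have "P J I (inv (inv m)) (inv (s \<otimes> inv x))" using Pinv[of I J "inv m"] I J m by blast
    then show ?thesis using m that I by (simp add: inv_mult_group subset_iff)
  qed
  have "P J I m m" unfolding P_def using m by (intro bexI[of _ \<one>]) auto
  then have R: "P J I m (m \<otimes> wp v)" if "v \<in> lists I" for v
    using that
  proof (induction v rule: rev_induct)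
    case (snoc s v)
    have "v \<in> lists S" "s \<in> S" using snoc.prems I by auto
    then show ?case using right[of "m \<otimes> wp v" s] snoc m by (simp add: wp_append m_assoc)
  qed (use m in simp)
  have L: "P J I m (wp u \<otimes> (m \<otimes> wp v))" if "u \<in> lists J" "v \<in> lists I" for u v
    using that(1)
  proof (induction u)
    case Nil
    then show ?case using R[OF that(2)] m that(2) I wp_closed[of v] by (simp add: lists_mono[THEN subsetD])
  next
    case (Cons s u)
    have "u \<in> lists S" "s \<in> S" "v \<in> lists S" using Cons.hyps J I that(2) by auto
    then show ?case using left[of "wp u \<otimes> (m \<otimes> wp v)" s] Cons m by (simp add: m_assoc)
  qed
  obtain a b where ab: "a \<in> W J" "b \<in> W I" "x = a \<otimes> m \<otimes> b" using x double_coset_iff[OF J I m] by blast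
  then obtain u v where uv: "u \<in> lists J" "v \<in> lists I" "a = wp u" "b = wp v"
    using W_eq_words J I by (metis imageE)
  have "u \<in> lists S" "v \<in> lists S" using uv I J by auto
  then show ?thesis using L[OF uv(1,2)] ab uv m unfolding P_def by (simp add: m_assoc)
qed

text \<open>If one of the outer factors of a length-additive product \<open>a m b\<close> is not trivial, its outermost
  letter shortens the product.\<close>

lemma bimin_eq_minimal:
  assumes J: "J \<subseteq> S" and I: "I \<subseteq> S" and m: "m \<in> carrier G"
    and min: "\<And>x. x \<in> DC J I m \<Longrightarrow> len m \<le> len x" and x: "x \<in> DC J I m" "bimin J I x"
  shows "x = m"
proof -
  obtain a b where ab: "a \<in> W J" "b \<in> W I" "x = a \<otimes> m \<otimes> b" "len x = len a + len m + len b"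
    using additive_factorization_minimal[OF J I m min x(1)] by blast
  have cl: "a \<in> carrier G" "b \<in> carrier G" using ab J I by auto
  obtain u where u: "u \<in> lists J" "wp u = a" "length u = len a" by (rule W_reduced_word[OF J ab(1)])
  obtain v where v: "v \<in> lists I" "wp v = b" "length v = len b" by (rule W_reduced_word[OF I ab(2)])
  have "u = []"
  proof (cases u)
    case (Cons s u')
    then have s: "s \<in> J" "s \<in> S" "u' \<in> lists S" using u J by auto
    have "a = s \<otimes> wp u'" using u(2) Cons by simp
    then have "s \<otimes> x = wp u' \<otimes> m \<otimes> b" unfolding ab(3) using s cl(2) m by (simp add: m_assoc)
    then have "len (s \<otimes> x) \<le> length u' + len m + len b"
      using len_mult_le[of "wp u' \<otimes> m" b] len_mult_le[of "wp u'" m] len_le[of u'] s cl m by simp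
    then have "len (s \<otimes> x) < len x" using ab(4) u(3) Cons by simp
    then show ?thesis using x(2) s unfolding bimin_def by (meson less_asym)
  qed
  moreover have "v = []"
  proof (cases v rule: rev_cases)
    case (snoc v' s)
    then have s: "s \<in> I" "s \<in> S" "v' \<in> lists S" using v I by auto
    have "b = wp v' \<otimes> s" using v(2) snoc s by (simp add: wp_append)
    then have "x \<otimes> s = a \<otimes> m \<otimes> wp v'" unfolding ab(3) using s cl(1) m by (simp add: m_assoc)
    then have "len (x \<otimes> s) \<le> len a + len m + length v'"
      using len_mult_le[of "a \<otimes> m" "wp v'"] len_mult_le[of a m] len_le[of v'] s cl m by simp
    then have "len (x \<otimes> s) < len x" using ab(4) v(3) snoc by simp
    then show ?thesis using x(2) s unfolding bimin_def by (meson less_asym)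
  qed simp
  ultimately have "a = \<one>" "b = \<one>" using u v by auto
  then show ?thesis using ab(3) m by simp
qed

lemma minimal_length_imp_bimin:
  assumes J: "J \<subseteq> S" and I: "I \<subseteq> S" and m: "m \<in> carrier G"
    and min: "\<And>x. x \<in> DC J I m \<Longrightarrow> len m \<le> len x"
  shows "bimin J I m"
  unfolding bimin_def
proof (intro conjI ballI)
  have self: "m \<in> DC J I m" by (rule double_coset_self[OF J I m])
  show "len m < len (s \<otimes> m)" if "s \<in> J" for s
    using min[OF double_coset_mult_left[OF J I m self, of s]] len_gen_mult_cases[of s m] that J m by auto
  show "len m < len (m \<otimes> s)" if "s \<in> I" for s
    using min[OF double_coset_mult_right[OF J I m self, of s]] len_mult_gen_cases[of s m] that I m by auto
qed (rule m)

lemma minimal_length_exists: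
  assumes J: "J \<subseteq> S" and I: "I \<subseteq> S" and w: "w \<in> carrier G"
  obtains m where "m \<in> DC J I w" "m \<in> carrier G" "DC J I m = DC J I w" "\<And>x. x \<in> DC J I m \<Longrightarrow> len m \<le> len x"
proof -
  obtain m where m: "m \<in> DC J I w" "\<And>x. x \<in> DC J I w \<Longrightarrow> len m \<le> len x"
    using ex_has_least_nat[of "\<lambda>x. x \<in> DC J I w" w len] double_coset_self[OF J I w] by blast
  then show ?thesis using that double_coset_eq[OF J I w] double_coset_closed[OF J I w] by metis
qed

lemma bimin_exists:
  assumes J: "J \<subseteq> S" and I: "I \<subseteq> S" and w: "w \<in> carrier G"
  obtains m where "m \<in> DC J I w" "DC J I m = DC J I w" "bimin J I m"
  using minimal_length_exists[OF assms] minimal_length_imp_bimin[OF J I] by metis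

lemma bimin_minimal:
  assumes J: "J \<subseteq> S" and I: "I \<subseteq> S" and m: "bimin J I m" and x: "x \<in> DC J I m"
  shows "len m \<le> len x"
proof -
  have mc: "m \<in> carrier G" using m unfolding bimin_def by simp
  obtain n where n: "n \<in> DC J I m" "n \<in> carrier G" "DC J I n = DC J I m" "\<And>x. x \<in> DC J I n \<Longrightarrow> len n \<le> len x"
    by (rule minimal_length_exists[OF J I mc]) blast
  have "m = n" using bimin_eq_minimal[OF J I n(2,4)] n(3) m double_coset_self[OF J I mc] by simp
  then show ?thesis using n(4) x by simp
qed

lemma bimin_unique:
  assumes J: "J \<subseteq> S" and I: "I \<subseteq> S" and m: "bimin J I m" and x: "x \<in> DC J I m" "bimin J I x"
  shows "x = m"
  using bimin_eq_minimal[OF J I _ bimin_minimal[OF J I m] x] m unfolding bimin_def by blast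

theorem additive_factorization:
  assumes J: "J \<subseteq> S" and I: "I \<subseteq> S" and m: "bimin J I m" and x: "x \<in> DC J I m"
  obtains a b where "a \<in> W J" "b \<in> W I" "x = a \<otimes> m \<otimes> b" "len x = len a + len m + len b"
  using additive_factorization_minimal[OF J I _ bimin_minimal[OF J I m] x] m unfolding bimin_def by blast

lemma len_mult_left_min:
  assumes J: "J \<subseteq> S" and m: "bimin J {} m" and a: "a \<in> W J"
  shows "len (a \<otimes> m) = len a + len m"
proof -
  have mc: "m \<in> carrier G" using m unfolding bimin_def by simp
  have "a \<otimes> m \<otimes> \<one> \<in> DC J {} m" by (rule double_cosetI[OF a W_one])
  then obtain a' b where ab: "a' \<in> W J" "b \<in> W {}" "a \<otimes> m \<otimes> \<one> = a' \<otimes> m \<otimes> b"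
    "len (a \<otimes> m \<otimes> \<one>) = len a' + len m + len b"
    using additive_factorization[OF J _ m] by blast
  have "b = \<one>" using ab(2) generate_empty by simp
  moreover have cl: "a \<in> carrier G" "a' \<in> carrier G" using a ab J by auto
  ultimately have "a = a'" using ab(3) mc by simp
  then show ?thesis using ab(4) \<open>b = \<one>\<close> cl mc by simp
qed

lemma bimin_inv: "J \<subseteq> S \<Longrightarrow> I \<subseteq> S \<Longrightarrow> bimin J I m \<Longrightarrow> bimin I J (inv m)"
proof -
  assume a: "J \<subseteq> S" "I \<subseteq> S" "bimin J I m"
  then have mc: "m \<in> carrier G" unfolding bimin_def by simp
  have 1: "len (s \<otimes> inv m) = len (m \<otimes> s)" if "s \<in> S" for s using len_mult_gen[of s m] that mc by simp
  have 2: "len (inv m \<otimes> s) = len (s \<otimes> m)" if "s \<in> S" for s using len_mult_gen[of s "inv m"] that mc by simp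
  show ?thesis using a mc unfolding bimin_def by (auto simp: 1 2 subset_iff)
qed

lemma len_mult_right_min:
  assumes I: "I \<subseteq> S" and m: "bimin {} I m" and b: "b \<in> W I"
  shows "len (m \<otimes> b) = len m + len b"
proof -
  have c: "m \<in> carrier G" "b \<in> carrier G" using m b I unfolding bimin_def by auto
  have "len (inv b \<otimes> inv m) = len (inv b) + len (inv m)"
    by (rule len_mult_left_min[OF I bimin_inv[OF _ I m]]) (use b I in auto)
  then show ?thesis using c len_inv[of "m \<otimes> b"] by (simp add: inv_mult_group)
qed

lemma bimin_mono: "bimin J I m \<Longrightarrow> J' \<subseteq> J \<Longrightarrow> I' \<subseteq> I \<Longrightarrow> bimin J' I' m"
  unfolding bimin_def by blast

text \<open>Exchange moves one right descent after the other to the end of a reduced word, so every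
  element of \<open>W\<^sub>I\<close> is a suffix of \<open>w\<close> as soon as all generators in \<open>I\<close> are.\<close>

lemma len_mult_descents:
  assumes w: "w \<in> carrier G" and I: "I \<subseteq> RD w" and b: "b \<in> W I"
  shows "len (w \<otimes> b) + len b = len w"
proof -
  have IS: "I \<subseteq> S" using I by auto
  have "len (w \<otimes> inv (wp u)) + length u = len w" if "u \<in> lists I" "length u = len (wp u)" for u
    using that
  proof (induction u rule: rev_induct)
    case Nil
    then show ?case using w by simp
  next
    case (snoc t u)
    have u: "u \<in> lists I" "u \<in> lists S" "t \<in> I" "t \<in> S" using snoc.prems IS by auto
    have "len (wp u \<otimes> t) \<le> Suc (len (wp u))" using len_mult_gen_cases[of t "wp u"] u by auto
    then have ru: "length u = len (wp u)" using snoc.prems u len_le[of u] by (simp add: wp_append)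
    let ?c = "w \<otimes> inv (wp u)"
    obtain c where c: "c \<in> lists S" "wp c = ?c" "length c = len ?c"
      by (rule reduced_word_exists[of ?c]) (use w u in auto)
    have IH: "len ?c + length u = len w" using snoc.IH u ru by simp
    have wcu: "wp (c @ u) = w" using c u w by (simp add: wp_append m_assoc)
    have "len (wp (c @ u) \<otimes> t) < len (wp (c @ u))" using wcu u I by auto
    then obtain p r q where pq: "c @ u = p @ r # q" "w \<otimes> t = wp (p @ q)"
      using exchange_right[OF u(4), of "c @ u"] c u wcu by (metis append_in_lists_conv)
    consider (C) q' where "c = p @ r # q'" "q = q' @ u" | (U) p' where "u = p' @ r # q" "p = c @ p'"
      using split_at_letter[OF pq(1)[symmetric]] by blast
    then show ?case
    proof cases
      case C
      have l: "p \<in> lists S" "q' \<in> lists S" using C c by auto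
      have "w \<otimes> t = wp (p @ q') \<otimes> wp u" using pq(2) C l u by (simp add: wp_append m_assoc)
      then have "w = wp (p @ q') \<otimes> wp u \<otimes> t" using w u l
        by (metis gen_sq S_closed m_assoc m_closed r_one wp_closed append_in_lists_conv)
      then have "w \<otimes> inv (wp (u @ [t])) = wp (p @ q')"
        using w u l by (simp add: wp_append inv_mult_group inv_solve_right' m_assoc)
      then have "len (w \<otimes> inv (wp (u @ [t]))) < len ?c" using len_le[of "p @ q'"] C c l by simp
      moreover have "len w \<le> len (w \<otimes> inv (wp (u @ [t]))) + length (u @ [t])"
        using len_mult_le[of "w \<otimes> inv (wp (u @ [t]))" "wp (u @ [t])"] w u snoc.prems by (simp add: m_assoc)
      ultimately show ?thesis using IH by simp
    next
      case U
      have l: "p' \<in> lists S" "q \<in> lists S" using U u by auto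
      have "w \<otimes> t = ?c \<otimes> wp (p' @ q)" using pq(2) U l c by (simp add: wp_append m_assoc w)
      moreover have "w \<otimes> t = ?c \<otimes> (wp u \<otimes> t)" using w u by (simp add: m_assoc flip: m_assoc[of "inv (wp u)" "wp u"])
      ultimately have "wp u \<otimes> t = wp (p' @ q)" using w u l by simp
      then have "len (wp (u @ [t])) \<le> length (p' @ q)" using len_le[of "p' @ q"] l u by (simp add: wp_append)
      then show ?thesis using U snoc.prems by simp
    qed
  qed
  moreover obtain u where "u \<in> lists I" "wp u = inv b" "length u = len (inv b)"
    by (rule W_reduced_word[OF IS, of "inv b"]) (use b IS in auto)
  ultimately show ?thesis using b IS by fastforce
qed

end

section \<open>Longest elements and the maximum of a double coset\<close>

context coxeter_system
begin

abbreviation wl :: "'a set \<Rightarrow> 'a" where "wl I \<equiv> longest G S I"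

lemma finitaryD: "finitary G S I \<Longrightarrow> I \<subseteq> S" "finitary G S I \<Longrightarrow> finite (W I)"
  by (simp_all add: finitary_def)

lemma finitary_mono: "finitary G S I \<Longrightarrow> K \<subseteq> I \<Longrightarrow> finitary G S K"
  unfolding finitary_def using W_mono[of K I] by (auto intro: finite_subset)

lemma max_length_exists:
  assumes "finite A" "a \<in> A" obtains x where "x \<in> A" "\<And>y. y \<in> A \<Longrightarrow> len y \<le> len x"
proof -
  have "Max (len ` A) \<in> len ` A" using assms by (intro Max_in) auto
  then obtain x where "x \<in> A" "len x = Max (len ` A)" by auto
  then show ?thesis using that assms by simp
qed

lemma finitary_empty: "finitary G S {}"
  by (simp add: finitary_def generate_empty)

text \<open>Every \<open>b \<in> W\<^sub>I\<close> can be split off \<open>x\<close> length-additively.\<close>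

lemma all_descents_longest:
  assumes "I \<subseteq> S" "x \<in> W I" "I \<subseteq> RD x" "b \<in> W I"
  shows "len b \<le> len x" "len b = len x \<Longrightarrow> b = x"
proof -
  have c: "x \<in> carrier G" "b \<in> carrier G" using assms by auto
  have eq: "len (x \<otimes> inv b) + len b = len x"
    using len_mult_descents[OF c(1) assms(3), of "inv b"] assms c by simp
  then show "len b \<le> len x" by simp
  assume "len b = len x"
  then have "x \<otimes> inv b = \<one>" using eq c by (simp add: len_0_iff)
  then show "b = x" using c by (metis inv_closed inv_equality inv_inv)
qed

lemma longest_eqI:
  assumes "I \<subseteq> S" "x \<in> W I" "I \<subseteq> RD x" shows "wl I = x"
  unfolding longest_def
proof (rule the_equality)
  show "x \<in> W I \<and> (\<forall>b\<in>W I. len b \<le> len x)" using all_descents_longest[OF assms] assms by blast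
  show "b = x" if "b \<in> W I \<and> (\<forall>x\<in>W I. len x \<le> len b)" for b
    using all_descents_longest[OF assms, of b] that assms(2) by (simp add: le_antisym)
qed

lemma longest_props:
  assumes I: "finitary G S I" shows "wl I \<in> W I" "I \<subseteq> RD (wl I)"
proof -
  have IS: "I \<subseteq> S" and fin: "finite (W I)" using I by (auto dest: finitaryD)
  obtain x where x: "x \<in> W I" "\<And>b. b \<in> W I \<Longrightarrow> len b \<le> len x"
    using max_length_exists[OF fin W_one] by metis
  have "I \<subseteq> RD x"
  proof
    fix s assume s: "s \<in> I"
    then have "x \<otimes> s \<in> W I" using x by simp
    then show "s \<in> RD x" using x(2)[of "x \<otimes> s"] len_mult_gen_cases[of s x] s IS x(1) by auto
  qed
  then have "wl I = x" by (rule longest_eqI[OF IS x(1)])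
  then show "wl I \<in> W I" "I \<subseteq> RD (wl I)" using x \<open>I \<subseteq> RD x\<close> by auto
qed

lemma longest_closed [simp]: "finitary G S I \<Longrightarrow> wl I \<in> carrier G"
  by (rule W_closed[OF finitaryD(1) longest_props(1)])

lemma longest_inv [simp]: assumes I: "finitary G S I" shows "inv (wl I) = wl I"
  using all_descents_longest(2)[OF finitaryD(1)[OF I] longest_props[OF I], of "inv (wl I)"]
    longest_props[OF I] I finitaryD by simp

lemma longest_sq [simp]: "finitary G S I \<Longrightarrow> wl I \<otimes> wl I = \<one>"
  using r_inv[of "wl I"] by simp

lemma longest_cancel [simp]:
  "finitary G S I \<Longrightarrow> x \<in> carrier G \<Longrightarrow> wl I \<otimes> (wl I \<otimes> x) = x"
  by (simp flip: m_assoc)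

lemma len_longest_mult:
  assumes I: "finitary G S I" and b: "b \<in> W I" shows "len (wl I \<otimes> b) + len b = len (wl I)"
  using len_mult_descents[OF _ longest_props(2)[OF I] b] I by simp

lemma len_mult_longest:
  assumes I: "finitary G S I" and b: "b \<in> W I" shows "len (b \<otimes> wl I) + len b = len (wl I)"
proof -
  have c: "b \<in> carrier G" "inv b \<in> W I" using b finitaryD(1)[OF I] by auto
  then show ?thesis using len_longest_mult[OF I c(2)] len_inv[of "b \<otimes> wl I"] I by (simp add: inv_mult_group)
qed

text \<open>By exchange \<open>s x\<close> is again in \<open>W\<^sub>K\<close>, hence so is \<open>s\<close>, which has a reduced word of one letter.\<close>

lemma parabolic_left_descent:
  assumes K: "K \<subseteq> S" and x: "x \<in> W K" and s: "s \<in> S" "len (s \<otimes> x) < len x"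
  shows "s \<in> K"
proof -
  obtain u where u: "u \<in> lists K" "wp u = x" "length u = len x" by (rule W_reduced_word[OF K x])
  have uS: "u \<in> lists S" using u K by auto
  then obtain a r b where ab: "u = a @ r # b" "s \<otimes> x = wp (a @ b)" using exchange[OF s(1), of u] s u by metis
  have xc: "x \<in> carrier G" using x K by simp
  have "wp (a @ b) \<in> W K" using W_word[OF K, of "a @ b"] ab u by auto
  then have "(s \<otimes> x) \<otimes> inv x \<in> W K" using ab x K by simp
  then have "s \<in> W K" using s xc by (simp add: m_assoc)
  then obtain v where v: "v \<in> lists K" "wp v = s" "length v = len s" by (rule W_reduced_word[OF K])
  then obtain t where "v = [t]" using s by (auto simp: length_Suc_conv)
  then show ?thesis using v K by (auto simp: subset_iff)
qed

lemma left_descents_longest: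
  assumes K: "finitary G S K" shows "LD (wl K) = K"
proof
  have KS: "K \<subseteq> S" using K by (rule finitaryD)
  show "LD (wl K) \<subseteq> K"
    using parabolic_left_descent[OF KS longest_props(1)[OF K]] unfolding left_descents_def by auto
  show "K \<subseteq> LD (wl K)"
  proof
    fix s assume s: "s \<in> K"
    then have "len (s \<otimes> wl K) + len s = len (wl K)" using len_mult_longest[OF K, of s] by simp
    then show "s \<in> LD (wl K)" using s KS unfolding left_descents_def by auto
  qed
qed

lemma left_descents_eq_longest:
  assumes J: "finitary G S J" and e: "e \<in> W J" "J \<subseteq> LD e" shows "e = wl J"
proof -
  have JS: "J \<subseteq> S" using J by (rule finitaryD)
  have ec: "e \<in> carrier G" using e JS by simp
  have "J \<subseteq> RD (inv e)" using e(2) JS len_mult_gen[of _ "inv e"] ec unfolding left_descents_def by auto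
  then have "wl J = inv e" using longest_eqI[OF JS, of "inv e"] e JS by auto
  then show ?thesis using longest_inv[OF J] ec by simp
qed

lemma conj_by_mult_right:
  "g \<in> carrier G \<Longrightarrow> x \<in> carrier G \<Longrightarrow> y \<in> carrier G \<Longrightarrow>
    conj_by G g (x \<otimes> y) = conj_by G g x \<otimes> conj_by G g y"
  by (simp add: conj_by_def m_assoc flip: m_assoc[of "inv g" g])

lemma conj_W:
  assumes I: "I \<subseteq> S" and m: "m \<in> carrier G" and K: "K \<subseteq> S" "K \<subseteq> conj_by G m ` I" and c: "c \<in> W K"
  shows "conj_by G (inv m) c \<in> W I"
proof -
  have gen: "conj_by G (inv m) h \<in> W I" if h: "h \<in> K" for h
  proof -
    obtain t where t: "t \<in> I" "h = conj_by G m t" using h K by blast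
    then have "conj_by G (inv m) h = t" using m I by (auto simp: subset_iff)
    then show ?thesis using t by simp
  qed
  show ?thesis using c
  proof (induction rule: generate.induct)
    case one
    then show ?case using m by (simp add: conj_by_def)
  next
    case (inv h)
    then have "inv h = h" using K by auto
    then show ?case using gen[OF inv] by simp
  next
    case (eng h1 h2)
    then show ?case using m K(1) by (simp add: conj_by_mult_right)
  qed (rule gen)
qed

text \<open>For \<open>K = J \<inter> m I m\<^sup>-\<^sup>1\<close> the longest element \<open>c\<close> of \<open>W\<^sub>K\<close> can be moved across \<open>m\<close>,
  giving \<open>c m w\<^sub>I = m (d w\<^sub>I)\<close> with \<open>d \<in> W\<^sub>I\<close> as long as \<open>c\<close>.  A generator \<open>s \<in> J\<close> shortening
  this from the left can be moved across \<open>m\<close> as well, hence lies in \<open>K\<close>; but then it shortens \<open>c\<close>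
  and \<open>d\<close>, and therefore lengthens \<open>d w\<^sub>I\<close>.\<close>

lemma longest_intersection_left_min:
  assumes J: "finitary G S J" and I: "finitary G S I" and m: "bimin J I m"
  defines "K \<equiv> J \<inter> conj_by G m ` I"
  shows "bimin J {} (wl K \<otimes> m \<otimes> wl I)"
proof -
  have JS: "J \<subseteq> S" and IS: "I \<subseteq> S" using J I by (auto dest: finitaryD)
  have mc: "m \<in> carrier G" using m unfolding bimin_def by simp
  have K: "finitary G S K" by (rule finitary_mono[OF J]) (simp add: K_def)
  have KS: "K \<subseteq> S" using K by (rule finitaryD)
  let ?v = "wl I"
  define d where "d = conj_by G (inv m) (wl K)"
  have cK: "wl K \<in> W K" by (rule longest_props[OF K])
  have cJ: "wl K \<in> W J" using cK W_mono[of K J] by (auto simp: K_def)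
  have dI: "d \<in> W I" unfolding d_def by (rule conj_W[OF IS mc KS _ cK]) (simp add: K_def)
  have vI: "?v \<in> W I" by (rule longest_props[OF I])
  have dc: "d \<in> carrier G" using dI IS by simp
  note cl = mc dc longest_closed[OF I] longest_closed[OF K]
  have cm: "wl K \<otimes> m = m \<otimes> d" unfolding d_def conj_by_def using cl by (simp add: m_assoc flip: m_assoc[of m "inv m"])
  have left: "len (a \<otimes> m) = len a + len m" if "a \<in> W J" for a
    by (rule len_mult_left_min[OF JS bimin_mono[OF m] that]) auto
  have right: "len (m \<otimes> b) = len m + len b" if "b \<in> W I" for b
    by (rule len_mult_right_min[OF IS bimin_mono[OF m] that]) auto
  have ld: "len d = len (wl K)" using left[OF cJ] right[OF dI] cm by simp
  define n where "n = m \<otimes> (d \<otimes> ?v)"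
  have n_eq: "wl K \<otimes> m \<otimes> ?v = n" unfolding n_def cm using cl by (simp add: m_assoc)
  have nc: "n \<in> carrier G" unfolding n_def using cl by simp
  have ln: "len n + len d = len m + len ?v"
    unfolding n_def using right[of "d \<otimes> ?v"] dI vI len_mult_longest[OF I dI] by simp
  have "len n < len (s \<otimes> n)" if s: "s \<in> J" for s
  proof (rule ccontr)
    assume "\<not> len n < len (s \<otimes> n)"
    moreover have sS: "s \<in> S" using s JS by auto
    ultimately have lt: "len (s \<otimes> n) < len n" using len_gen_mult_cases[OF sS nc] by auto
    obtain um where um: "um \<in> lists S" "wp um = m" "length um = len m" by (rule reduced_word_exists[OF mc])
    obtain ub where ub: "ub \<in> lists I" "wp ub = d \<otimes> ?v" "length ub = len (d \<otimes> ?v)"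
      by (rule W_reduced_word[OF IS, of "d \<otimes> ?v"]) (use dI vI in auto)
    have ubS: "ub \<in> lists S" using ub IS by auto
    have wn: "wp (um @ ub) = n" using um ub ubS by (simp add: wp_append n_def)
    obtain p r q where pq: "um @ ub = p @ r # q" "s \<otimes> n = wp (p @ q)"
      using exchange[OF sS, of "um @ ub"] um ubS lt wn by (metis append_in_lists_conv)
    consider (M) q' where "um = p @ r # q'" "q = q' @ ub" | (B) p' where "ub = p' @ r # q" "p = um @ p'"
      using split_at_letter[OF pq(1)[symmetric]] by blast
    then show False
    proof cases
      case M
      have l: "p \<in> lists S" "q' \<in> lists S" using M um by auto
      have "s \<otimes> m \<otimes> (d \<otimes> ?v) = wp (p @ q') \<otimes> (d \<otimes> ?v)"
        using pq(2) M l ubS ub(2) cl sS by (simp add: wp_append n_def m_assoc)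
      then have "s \<otimes> m = wp (p @ q')" using cl sS l by simp
      then have "len (s \<otimes> m) < len m" using len_le[of "p @ q'"] l M um by simp
      then show False using m s unfolding bimin_def by (meson less_asym)
    next
      case B
      have l: "p' \<in> lists S" "q \<in> lists S" using B ubS by auto
      have bI: "wp (p' @ q) \<in> W I" by (rule W_word[OF IS]) (use B ub in auto)
      have bc: "wp (p' @ q) \<in> carrier G" using bI IS by simp
      define e where "e = wp (p' @ q) \<otimes> inv (d \<otimes> ?v)"
      have eI: "e \<in> W I" unfolding e_def using bI dI vI IS by simp
      have ec: "e \<in> carrier G" using eI IS by simp
      have "s \<otimes> m \<otimes> (d \<otimes> ?v) = m \<otimes> wp (p' @ q)"
        using pq(2) B l um cl sS by (simp add: wp_append n_def m_assoc)
      then have sm: "s \<otimes> m = m \<otimes> e" unfolding e_def using cl sS bc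
        by (metis inv_closed inv_solve_right m_assoc m_closed S_closed)
      have "len e = 1" using left[of s] right[OF eI] sm s sS by simp
      moreover obtain w where w: "w \<in> lists I" "wp w = e" "length w = len e" by (rule W_reduced_word[OF IS eI])
      ultimately obtain t where "w = [t]" by (auto simp: length_Suc_conv)
      then have tI: "e \<in> I" using w IS by (auto simp: subset_iff)
      have "s = conj_by G m e" unfolding conj_by_def sm[symmetric] using sS mc by (simp add: m_assoc)
      then have sK: "s \<in> K" using s tI unfolding K_def by blast
      have "s \<otimes> wl K \<otimes> m = m \<otimes> (e \<otimes> d)" using cm sm cl sS ec by (metis S_closed m_assoc)
      then have "len (e \<otimes> d) = len (s \<otimes> wl K)"
        using left[of "s \<otimes> wl K"] right[of "e \<otimes> d"] s cJ eI dI by simp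
      moreover have "len (s \<otimes> wl K) < len (wl K)"
        using left_descents_longest[OF K] sK unfolding left_descents_def by auto
      moreover have "s \<otimes> n = m \<otimes> (e \<otimes> d \<otimes> ?v)" unfolding n_def using sm cl sS ec by (metis S_closed m_assoc m_closed)
      then have "len (s \<otimes> n) + len (e \<otimes> d) = len m + len ?v"
        using right[of "e \<otimes> d \<otimes> ?v"] eI dI vI len_mult_longest[OF I, of "e \<otimes> d"] by simp
      ultimately show False using lt ln ld by simp
    qed
  qed
  then show ?thesis unfolding n_eq bimin_def using nc by simp
qed

text \<open>Removing \<open>w\<^sub>I\<close> from a maximal element \<open>w\<close> leaves \<open>a m\<close> with \<open>a \<in> W\<^sub>J\<close>, and \<open>J \<subseteq> LD(w)\<close> forces
  \<open>a c\<close> to be the longest element of \<open>W\<^sub>J\<close>.\<close>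

theorem bimax_formula:
  assumes J: "finitary G S J" and I: "finitary G S I" and m: "bimin J I m"
    and w: "bimax J I w" "w \<in> DC J I m"
  shows "w \<otimes> wl I = wl J \<otimes> wl (J \<inter> conj_by G m ` I) \<otimes> m"
proof -
  have JS: "J \<subseteq> S" and IS: "I \<subseteq> S" using J I by (auto dest: finitaryD)
  have mc: "m \<in> carrier G" and wc: "w \<in> carrier G" and wJ: "J \<subseteq> LD w" and wI: "I \<subseteq> RD w"
    using m w unfolding bimin_def bimax_def by auto
  define K where "K = J \<inter> conj_by G m ` I"
  have K: "finitary G S K" by (rule finitary_mono[OF J]) (simp add: K_def)
  have vI: "wl I \<in> W I" by (rule longest_props[OF I])
  have cJ: "wl K \<in> W J" using longest_props(1)[OF K] W_mono[of K J] by (auto simp: K_def)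
  define x where "x = w \<otimes> wl I"
  have xc: "x \<in> carrier G" unfolding x_def using wc I by simp
  have "len x < len (x \<otimes> s)" if s: "s \<in> I" for s
  proof -
    have sS: "s \<in> S" using s IS by auto
    have "len x + len (wl I) = len w" unfolding x_def by (rule len_mult_descents[OF wc wI vI])
    moreover have "x \<otimes> s = w \<otimes> (wl I \<otimes> s)" unfolding x_def using wc I sS by (simp add: m_assoc)
    then have "len (x \<otimes> s) + len (wl I \<otimes> s) = len w" using len_mult_descents[OF wc wI, of "wl I \<otimes> s"] vI s by simp
    moreover have "len (wl I \<otimes> s) < len (wl I)" using longest_props(2)[OF I] s by auto
    ultimately show ?thesis by simp
  qed
  then have xmin: "bimin {} I x" using xc unfolding bimin_def by simp
  have "x \<in> DC J I m" unfolding x_def by (rule double_coset_mult_right[OF JS IS mc w(2) vI])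
  then obtain a b where ab: "a \<in> W J" "b \<in> W I" "x = a \<otimes> m \<otimes> b" "len x = len a + len m + len b"
    by (rule additive_factorization[OF JS IS m])
  have cl: "a \<in> carrier G" "b \<in> carrier G" using ab JS IS by auto
  have "x \<in> DC {} I (a \<otimes> m)" using double_cosetI[of \<one> "{}" b I "a \<otimes> m"] ab(2) ab(3) cl mc by simp
  then have "a \<otimes> m \<in> DC {} I x" using double_coset_sym[where J = "{}" and I = I and w = "a \<otimes> m" and x = x] IS cl mc by simp
  then have "len x \<le> len (a \<otimes> m)" using bimin_minimal[OF _ IS xmin] by simp
  then have "len b = 0" using ab(4) len_mult_le[OF cl(1) mc] by simp
  then have xam: "x = a \<otimes> m" using ab(3) cl mc by (simp add: len_0_iff)
  define n where "n = wl K \<otimes> m \<otimes> wl I"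
  have nmin: "bimin J {} n" unfolding n_def K_def by (rule longest_intersection_left_min[OF J I m])
  have nc: "n \<in> carrier G" using nmin unfolding bimin_def by simp
  define e where "e = a \<otimes> wl K"
  have eJ: "e \<in> W J" unfolding e_def using ab cJ by simp
  have ec: "e \<in> carrier G" using eJ JS by simp
  have "w = x \<otimes> wl I" unfolding x_def using wc I by (simp add: m_assoc)
  then have wen: "w = e \<otimes> n" unfolding xam e_def n_def using cl mc I K by (simp add: m_assoc)
  have "s \<in> LD e" if s: "s \<in> J" for s
  proof -
    have sS: "s \<in> S" using s JS by auto
    have "len (s \<otimes> w) < len w" using wJ s unfolding left_descents_def by auto
    moreover have "s \<otimes> w = (s \<otimes> e) \<otimes> n" unfolding wen using ec nc sS by (simp add: m_assoc)
    ultimately have "len (s \<otimes> e) < len e"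
      using len_mult_left_min[OF JS nmin, of "s \<otimes> e"] len_mult_left_min[OF JS nmin eJ] eJ s wen by simp
    then show ?thesis using sS unfolding left_descents_def by simp
  qed
  then have "e = wl J" using left_descents_eq_longest[OF J eJ] by blast
  then have "a = wl J \<otimes> wl K" unfolding e_def using cl K by (metis inv_solve_right longest_closed longest_inv m_closed e_def ec)
  then show ?thesis using xam unfolding x_def K_def by simp
qed

corollary bimax_unique:
  assumes J: "finitary G S J" and I: "finitary G S I" and w: "bimax J I w"
    and x: "bimax J I x" "x \<in> DC J I w"
  shows "x = w"
proof -
  have JS: "J \<subseteq> S" and IS: "I \<subseteq> S" using J I by (auto dest: finitaryD)
  have c: "w \<in> carrier G" "x \<in> carrier G" using w x unfolding bimax_def by auto
  obtain m where m: "m \<in> DC J I w" "DC J I m = DC J I w" "bimin J I m" by (rule bimin_exists[OF JS IS c(1)])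
  have "w \<in> DC J I m" "x \<in> DC J I m" using m x double_coset_self[OF JS IS c(1)] by auto
  then have "w \<otimes> wl I = x \<otimes> wl I" using bimax_formula[OF J I m(3)] w x by simp
  then show ?thesis using c I by simp
qed

lemma max_length_imp_bimax:
  assumes J: "J \<subseteq> S" and I: "I \<subseteq> S" and w: "w \<in> carrier G"
    and max: "\<And>x. x \<in> DC J I w \<Longrightarrow> len x \<le> len w"
  shows "bimax J I w"
proof -
  have self: "w \<in> DC J I w" by (rule double_coset_self[OF J I w])
  have "len (s \<otimes> w) < len w" if "s \<in> J" for s
    using max[OF double_coset_mult_left[OF J I w self, of s]] len_gen_mult_cases[of s w] that J w by auto
  moreover have "len (w \<otimes> s) < len w" if "s \<in> I" for s
    using max[OF double_coset_mult_right[OF J I w self, of s]] len_mult_gen_cases[of s w] that I w by auto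
  ultimately show ?thesis unfolding bimax_def left_descents_def using w J I by auto
qed

lemma bimax_exists:
  assumes J: "finitary G S J" and I: "finitary G S I" and w: "w \<in> carrier G"
  obtains x where "x \<in> DC J I w" "DC J I x = DC J I w" "bimax J I x" "\<And>y. y \<in> DC J I w \<Longrightarrow> len y \<le> len x"
proof -
  have JS: "J \<subseteq> S" and IS: "I \<subseteq> S" using J I by (auto dest: finitaryD)
  have "DC J I w \<subseteq> (\<lambda>(a, b). a \<otimes> w \<otimes> b) ` (W J \<times> W I)"
    using double_coset_iff[OF JS IS w] by auto
  then have fin: "finite (DC J I w)"
    by (rule finite_subset) (use J I finitaryD in auto)
  obtain x where x: "x \<in> DC J I w" "\<And>b. b \<in> DC J I w \<Longrightarrow> len b \<le> len x"
    using max_length_exists[OF fin double_coset_self[OF JS IS w]] by metis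
  have eq: "DC J I x = DC J I w" by (rule double_coset_eq[OF JS IS w x(1)])
  have "bimax J I x"
    by (rule max_length_imp_bimax[OF JS IS]) (use x eq double_coset_closed[OF JS IS w] in auto)
  then show ?thesis using that x eq by blast
qed

lemma bimax_max_length:
  assumes J: "finitary G S J" and I: "finitary G S I" and w: "bimax J I w" and y: "y \<in> DC J I w"
  shows "len y \<le> len w"
proof -
  have wc: "w \<in> carrier G" using w unfolding bimax_def by auto
  obtain x where x: "x \<in> DC J I w" "bimax J I x" "\<And>y. y \<in> DC J I w \<Longrightarrow> len y \<le> len x"
    using bimax_exists[OF J I wc] by metis
  then show ?thesis using bimax_unique[OF J I w x(2,1)] y by simp
qed

subsection \<open>Bruhat-extremal elements\<close>

lemma bruhat_len: "bruhat_le G S x y \<Longrightarrow> x = y \<or> len x < len y"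
  unfolding bruhat_le_def by (induction rule: rtranclp_induct) auto

lemma bruhat_mult_gen:
  assumes "w \<in> carrier G" "s \<in> S" "len w < len (w \<otimes> s)" shows "bruhat_le G S w (w \<otimes> s)"
proof -
  have "s = conj_by G \<one> s" using assms by simp
  then have "s \<in> reflections G S" unfolding reflections_def using assms by blast
  then show ?thesis unfolding bruhat_le_def using assms by (intro r_into_rtranclp) auto
qed

lemma bruhat_gen_mult:
  assumes "w \<in> carrier G" "s \<in> S" "len w < len (s \<otimes> w)" shows "bruhat_le G S w (s \<otimes> w)"
proof -
  have "conj_by G (inv w) s \<in> reflections G S" unfolding reflections_def using assms inv_closed by blast
  moreover have "s \<otimes> w = w \<otimes> conj_by G (inv w) s" using assms
    by (simp add: conj_by_def m_assoc flip: m_assoc[of w "inv w"])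
  ultimately show ?thesis unfolding bruhat_le_def using assms(1,3) by (intro r_into_rtranclp) auto
qed

lemma coset_max_eq:
  assumes J: "finitary G S J" and I: "finitary G S I" and w: "bimax J I w"
  shows "coset_max G S (DC J I w) = w"
  unfolding coset_max_def
proof (rule the_equality)
  have JS: "J \<subseteq> S" and IS: "I \<subseteq> S" using J I by (auto dest: finitaryD)
  have wc: "w \<in> carrier G" using w unfolding bimax_def by auto
  show "w \<in> DC J I w \<and> (\<forall>y\<in>DC J I w. bruhat_le G S w y \<longrightarrow> y = w)"
    using double_coset_self[OF JS IS wc] bruhat_len bimax_max_length[OF J I w] by fastforce
  fix x assume x: "x \<in> DC J I w \<and> (\<forall>y\<in>DC J I w. bruhat_le G S x y \<longrightarrow> y = x)"
  then have xc: "x \<in> carrier G" using double_coset_closed[OF JS IS wc] by blast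
  have "len (s \<otimes> x) < len x" if s: "s \<in> J" for s
  proof (rule ccontr)
    assume "\<not> len (s \<otimes> x) < len x"
    then have lt: "len x < len (s \<otimes> x)" using len_gen_mult_cases[of s x] s JS xc by auto
    then have "s \<otimes> x = x"
      using bruhat_gen_mult[OF xc _ lt] x double_coset_mult_left[OF JS IS wc _ W_gen[OF s]] s JS by blast
    then show False using lt by simp
  qed
  moreover have "len (x \<otimes> s) < len x" if s: "s \<in> I" for s
  proof (rule ccontr)
    assume "\<not> len (x \<otimes> s) < len x"
    then have lt: "len x < len (x \<otimes> s)" using len_mult_gen_cases[of s x] s IS xc by auto
    then have "x \<otimes> s = x"
      using bruhat_mult_gen[OF xc _ lt] x double_coset_mult_right[OF JS IS wc _ W_gen[OF s]] s IS by blast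
    then show False using lt by simp
  qed
  ultimately have "bimax J I x" unfolding bimax_def left_descents_def using xc JS IS by auto
  then show "x = w" using bimax_unique[OF J I w] x by blast
qed

lemma coset_min_eq:
  assumes J: "J \<subseteq> S" and I: "I \<subseteq> S" and m: "bimin J I m"
  shows "coset_min G S (DC J I m) = m"
  unfolding coset_min_def
proof (rule the_equality)
  have mc: "m \<in> carrier G" using m unfolding bimin_def by auto
  show "m \<in> DC J I m \<and> (\<forall>y\<in>DC J I m. bruhat_le G S y m \<longrightarrow> y = m)"
    using double_coset_self[OF J I mc] bruhat_len bimin_minimal[OF J I m] by fastforce
  fix x assume x: "x \<in> DC J I m \<and> (\<forall>y\<in>DC J I m. bruhat_le G S y x \<longrightarrow> y = x)"
  then have xc: "x \<in> carrier G" using double_coset_closed[OF J I mc] by blast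
  have "len x < len (s \<otimes> x)" if s: "s \<in> J" for s
  proof (rule ccontr)
    have sS: "s \<in> S" using s J by auto
    assume "\<not> len x < len (s \<otimes> x)"
    then have lt: "len (s \<otimes> x) < len x" using len_gen_mult_cases[of s x] sS xc by auto
    then have "bruhat_le G S (s \<otimes> x) x" using bruhat_gen_mult[of "s \<otimes> x" s] sS xc by simp
    then have "s \<otimes> x = x" using x double_coset_mult_left[OF J I mc _ W_gen[OF s]] by blast
    then show False using lt by simp
  qed
  moreover have "len x < len (x \<otimes> s)" if s: "s \<in> I" for s
  proof (rule ccontr)
    have sS: "s \<in> S" using s I by auto
    assume "\<not> len x < len (x \<otimes> s)"
    then have lt: "len (x \<otimes> s) < len x" using len_mult_gen_cases[of s x] sS xc by auto
    then have "bruhat_le G S (x \<otimes> s) x" using bruhat_mult_gen[of "x \<otimes> s" s] sS xc by (simp add: m_assoc)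
    then have "x \<otimes> s = x" using x double_coset_mult_right[OF J I mc _ W_gen[OF s]] by blast
    then show False using lt by simp
  qed
  ultimately have "bimin J I x" unfolding bimin_def using xc by auto
  then show "x = m" using bimin_unique[OF J I m] x by blast
qed

end

section \<open>Full subcomplexes and isomorphisms of 2-dimensional complexes\<close>

definition induced_complex :: "'v complex2 \<Rightarrow> 'v set \<Rightarrow> 'v complex2" where
  "induced_complex C V = \<lparr>verts = verts C \<inter> V, edges = {e \<in> edges C. fst e \<in> V \<and> snd e \<in> V},
     discs = {D \<in> discs C. \<forall>p\<in>D. set p \<subseteq> V}\<rparr>"

lemma induced_complex_simps [simp]:
  "verts (induced_complex C V) = verts C \<inter> V"
  "edges (induced_complex C V) = {e \<in> edges C. fst e \<in> V \<and> snd e \<in> V}"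
  "discs (induced_complex C V) = {D \<in> discs C. \<forall>p\<in>D. set p \<subseteq> V}"
  by (simp_all add: induced_complex_def)

lemma wf_path_induced: "wf_path C p \<Longrightarrow> set p \<subseteq> V \<Longrightarrow> wf_path (induced_complex C V) p"
  unfolding wf_path_def by (auto simp: successively_conv_nth)

lemma wf_induced_complex:
  assumes "wf_complex2 C" shows "wf_complex2 (induced_complex C V)"
  unfolding wf_complex2_def
proof (intro conjI ballI)
  show "edges (induced_complex C V) \<subseteq> verts (induced_complex C V) \<times> verts (induced_complex C V)"
    using assms unfolding wf_complex2_def by auto
  fix D assume D: "D \<in> discs (induced_complex C V)"
  then obtain p q where pq: "D = {p, q}" "wf_path C p" "wf_path C q" "hd p = hd q" "last p = last q"
    using assms unfolding wf_complex2_def by auto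
  then have "set p \<subseteq> V" "set q \<subseteq> V" using D by auto
  then show "\<exists>p q. D = {p, q} \<and> wf_path (induced_complex C V) p \<and> wf_path (induced_complex C V) q
      \<and> hd p = hd q \<and> last p = last q"
    using pq wf_path_induced[of C p V] wf_path_induced[of C q V] by (intro exI[of _ p] exI[of _ q]) simp
qed

lemma open_cells_simps [simp]:
  "open_cells C 0 = (\<lambda>v. {Vertex v}) ` verts C"
  "open_cells C (Suc 0) = (\<lambda>e. EdgePt e ` {0<..<1}) ` edges C"
  "open_cells C 2 = (\<lambda>D. DiscPt D ` ball 0 1) ` discs C"
  unfolding open_cells_def Setcompr_eq_image by simp_all

lemma open_cells_dim: "c \<in> open_cells C k \<Longrightarrow> k = 0 \<or> k = Suc 0 \<or> k = 2"
  unfolding open_cells_def by (auto split: if_splits)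

lemma cw_points_iff:
  "Vertex v \<in> cw_points C \<longleftrightarrow> v \<in> verts C"
  "EdgePt e x \<in> cw_points C \<longleftrightarrow> e \<in> edges C \<and> 0 < x \<and> x < 1"
  "DiscPt D z \<in> cw_points C \<longleftrightarrow> D \<in> discs C \<and> norm z < 1"
proof -
  have eq: "y \<in> cw_points C \<longleftrightarrow>
    (\<exists>c\<in>open_cells C 0. y \<in> c) \<or> (\<exists>c\<in>open_cells C (Suc 0). y \<in> c) \<or> (\<exists>c\<in>open_cells C 2. y \<in> c)" for y
    using open_cells_dim[of _ C] unfolding cw_points_def by blast
  show "Vertex v \<in> cw_points C \<longleftrightarrow> v \<in> verts C"
    "EdgePt e x \<in> cw_points C \<longleftrightarrow> e \<in> edges C \<and> 0 < x \<and> x < 1"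
    "DiscPt D z \<in> cw_points C \<longleftrightarrow> D \<in> discs C \<and> norm z < 1"
    unfolding eq by (auto simp: image_iff)
qed

subsection \<open>Points on paths and discs\<close>

lemma path_map_end:
  assumes "real (length p - 1) \<le> t * real (length p - 1)" shows "path_map p t = Vertex (last p)"
proof -
  have "\<not> nat \<lfloor>t * real (length p - 1)\<rfloor> < length p - 1"
    using le_nat_floor[OF assms] by simp
  then show ?thesis unfolding path_map_def Let_def by (simp only: if_False)
qed

lemma path_map_on_edge:
  assumes i: "i < length p - 1" and t: "0 \<le> t * real (length p - 1) - real i" "t * real (length p - 1) - real i \<le> 1"
  shows "path_map p t = edge_map (p ! i, p ! Suc i) (t * real (length p - 1) - real i)"
proof (cases "t * real (length p - 1) - real i = 1")
  case False
  then have "nat \<lfloor>t * real (length p - 1)\<rfloor> = i" using t by (simp add: nat_eq_iff floor_eq_iff)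
  then show ?thesis using i unfolding path_map_def Let_def by simp
next
  case True
  then have y: "t * real (length p - 1) = real (Suc i)" unfolding of_nat_Suc by linarith
  have f: "nat \<lfloor>t * real (length p - 1)\<rfloor> = Suc i" unfolding y by (metis floor_of_nat nat_int)
  have "path_map p t = Vertex (p ! Suc i)"
  proof (cases "Suc i < length p - 1")
    case True
    then show ?thesis unfolding path_map_def Let_def f unfolding y by (simp add: edge_map_def)
  next
    case False
    then have "Suc i = length p - 1" using i by simp
    moreover have "p \<noteq> []" using i by auto
    moreover have "path_map p t = Vertex (last p)"
      by (rule path_map_end) (metis y \<open>Suc i = length p - 1\<close> order_refl)
    ultimately show ?thesis by (simp add: last_conv_nth)
  qed
  then show ?thesis unfolding True by (simp add: edge_map_def)
qed

lemma path_map_vertex: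
  assumes "i < length p" shows "path_map p (real i / real (length p - 1)) = Vertex (p ! i)"
proof (cases "i < length p - 1")
  case True
  then show ?thesis using path_map_on_edge[OF True, of "real i / real (length p - 1)"] by (simp add: edge_map_def)
next
  case False
  then have i: "i = length p - 1" "p \<noteq> []" using assms by auto
  have "path_map p (real i / real (length p - 1)) = Vertex (last p)"
    unfolding i(1) by (rule path_map_end) (cases "length p - 1 = 0"; simp)
  then show ?thesis using i by (simp add: last_conv_nth)
qed

lemma path_map_0: "p \<noteq> [] \<Longrightarrow> path_map p 0 = Vertex (hd p)"
  using path_map_vertex[of 0 p] by (simp add: hd_conv_nth)

lemma path_map_1: "p \<noteq> [] \<Longrightarrow> path_map p 1 = Vertex (last p)"
  unfolding path_map_def Let_def by simp

lemma path_edge_of_parameter: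
  assumes "1 < length p" "0 \<le> t" "t \<le> 1"
  obtains i where "i < length p - 1" "0 \<le> t * real (length p - 1) - real i" "t * real (length p - 1) - real i \<le> 1"
proof (cases "t = 1")
  case True
  then show ?thesis using assms that[of "length p - 2"] by (simp add: of_nat_diff)
next
  case False
  define n where "n = length p - 1"
  define i where "i = nat \<lfloor>t * real n\<rfloor>"
  have "0 < n" using assms n_def by simp
  then have lt: "t * real n < real n" and pos: "0 \<le> t * real n" using assms False by auto
  then have "real i = real_of_int \<lfloor>t * real n\<rfloor>" unfolding i_def by simp
  then have "0 \<le> t * real n - real i" "t * real n - real i \<le> 1" by linarith+
  moreover have "i < n" using calculation lt by linarith
  ultimately show ?thesis using that[of i] unfolding n_def by blast
qed

lemma closed_path_preimage:
  assumes F: "\<And>i. i < length p - 1 \<Longrightarrow> closed {x \<in> {0..1}. edge_map (p ! i, p ! Suc i) x \<in> F}"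
  shows "closed {t \<in> {0..1}. path_map p t \<in> F}"
proof (cases "1 < length p")
  case False
  then have "path_map p t = Vertex (last p)" for t unfolding path_map_def Let_def by simp
  then have "{t \<in> {0..1}. path_map p t \<in> F} = (if Vertex (last p) \<in> F then {0..1} else {})" by auto
  then show ?thesis by (auto split: if_splits)
next
  case True
  define n where "n = length p - 1"
  define A where "A i = {x \<in> {0..1}. edge_map (p ! i, p ! Suc i) x \<in> F}" for i
  have "{t \<in> {0..1}. path_map p t \<in> F} = {0..1} \<inter> (\<Union>i<n. (\<lambda>t. t * real n - real i) -` A i)"
  proof (intro Set.set_eqI iffI)
    fix t assume t: "t \<in> {t \<in> {0..1}. path_map p t \<in> F}"
    then obtain i where i: "i < length p - 1" "0 \<le> t * real (length p - 1) - real i" "t * real (length p - 1) - real i \<le> 1"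
      using path_edge_of_parameter[OF True, of t] by auto
    then have "t * real n - real i \<in> A i" using path_map_on_edge[OF i] t unfolding A_def n_def by simp
    then show "t \<in> {0..1} \<inter> (\<Union>i<n. (\<lambda>t. t * real n - real i) -` A i)" using i t unfolding n_def by blast
  next
    fix t assume "t \<in> {0..1} \<inter> (\<Union>i<n. (\<lambda>t. t * real n - real i) -` A i)"
    then obtain i where "t \<in> {0..1}" "i < n" "t * real n - real i \<in> A i" by blast
    then show "t \<in> {t \<in> {0..1}. path_map p t \<in> F}"
      using path_map_on_edge[of i p t] unfolding A_def n_def by auto
  qed
  moreover have "closed ((\<lambda>t. t * real n - real i) -` A i)" if "i < n" for i
    by (rule closed_vimage) (use F that in \<open>auto simp: A_def n_def intro!: continuous_intros\<close>)
  ultimately show ?thesis by (simp add: closed_Int closed_UN)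
qed

definition disc_sides :: "'v list set \<Rightarrow> 'v list \<times> 'v list" where
  "disc_sides D = (SOME (p, q). D = {p, q})"

lemma disc_sidesE:
  assumes "wf_complex2 C" "D \<in> discs C"
  obtains p q where "disc_sides D = (p, q)" "D = {p, q}" "wf_path C p" "wf_path C q" "hd p = hd q" "last p = last q"
proof -
  obtain p q where pq: "D = {p, q}" "wf_path C p" "wf_path C q" "hd p = hd q" "last p = last q"
    using assms unfolding wf_complex2_def by blast
  obtain p' q' where e: "disc_sides D = (p', q')" by fastforce
  then have "D = {p', q'}"
    using someI[of "\<lambda>(p, q). D = {p, q}" "(p, q)"] pq unfolding disc_sides_def by auto
  then show ?thesis using that[OF e] pq by (auto simp: doubleton_eq_iff)
qed

text \<open>At \<open>1\<close> and \<open>-1\<close> both paths may be used, since they have the same ends; so each closed half-circle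
  follows one path.\<close>

lemma disc_map_boundary:
  assumes "disc_sides D = (p, q)" "p \<noteq> []" "q \<noteq> []" "hd p = hd q" "last p = last q" and z: "norm z = 1"
  shows "0 \<le> Im z \<Longrightarrow> disc_map D z = path_map p ((1 - Re z) / 2)"
    and "Im z \<le> 0 \<Longrightarrow> disc_map D z = path_map q ((1 - Re z) / 2)"
proof -
  have eq: "disc_map D z = path_map (if 0 \<le> Im z then p else q) ((1 - Re z) / 2)"
    using assms(1) z unfolding disc_map_def disc_sides_def by simp
  then show "0 \<le> Im z \<Longrightarrow> disc_map D z = path_map p ((1 - Re z) / 2)" by simp
  show "disc_map D z = path_map q ((1 - Re z) / 2)" if "Im z \<le> 0"
  proof (cases "Im z = 0")
    case True
    then have "\<bar>Re z\<bar> = 1" using z by (simp add: cmod_def)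
    then have "Re z = 1 \<or> Re z = -1" by linarith
    moreover have "path_map p 0 = path_map q 0" "path_map p 1 = path_map q 1"
      using path_map_0[of p] path_map_0[of q] path_map_1[of p] path_map_1[of q] assms by simp_all
    ultimately have "path_map p ((1 - Re z) / 2) = path_map q ((1 - Re z) / 2)" by auto
    then show ?thesis using eq True by simp
  next
    case False
    then show ?thesis using eq that by simp
  qed
qed

lemma disc_boundary_param:
  assumes "0 \<le> t" "t \<le> 1" obtains z where "norm z = 1" "0 \<le> Im z" "(1 - Re z) / 2 = t"
proof -
  have "(1 - 2 * t)\<^sup>2 \<le> 1" using assms by (simp add: abs_square_le_1)
  then have "norm (Complex (1 - 2 * t) (sqrt (1 - (1 - 2 * t)\<^sup>2))) = 1" by (simp add: cmod_def)
  moreover have "0 \<le> sqrt (1 - (1 - 2 * t)\<^sup>2)" using \<open>(1 - 2 * t)\<^sup>2 \<le> 1\<close> by simp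
  ultimately show ?thesis using that[of "Complex (1 - 2 * t) (sqrt (1 - (1 - 2 * t)\<^sup>2))"] by simp
qed

lemma disc_map_hits_vertices:
  assumes wf: "wf_complex2 C" and D: "D \<in> discs C" and p: "p \<in> D" "v \<in> set p"
  obtains z where "norm z = 1" "disc_map D z = Vertex v"
proof -
  obtain p' q' where s: "disc_sides D = (p', q')" "D = {p', q'}" "wf_path C p'" "wf_path C q'"
    "hd p' = hd q'" "last p' = last q'" by (rule disc_sidesE[OF wf D])
  have ne: "p' \<noteq> []" "q' \<noteq> []" using s unfolding wf_path_def by auto
  obtain i where i: "i < length p" "p ! i = v" using p by (metis in_set_conv_nth)
  let ?t = "real i / real (length p - 1)"
  have "0 \<le> ?t" "?t \<le> 1" using i by (auto simp: divide_le_eq_1)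
  then obtain z where z: "norm z = 1" "0 \<le> Im z" "(1 - Re z) / 2 = ?t" by (rule disc_boundary_param)
  have v: "path_map p ?t = Vertex v" using path_map_vertex i by blast
  show ?thesis
  proof (cases "p = p'")
    case True
    then show ?thesis using that[of z] disc_map_boundary(1)[OF s(1) ne s(5,6) z(1,2)] z v by simp
  next
    case False
    then have "p = q'" using p s by auto
    then show ?thesis using that[of "cnj z"] disc_map_boundary(2)[OF s(1) ne s(5,6), of "cnj z"] z v by simp
  qed
qed

subsection \<open>A full subcomplex carries the topology of the induced complex\<close>

lemma closedin_cw_space:
  assumes wf: "wf_complex2 C"
  shows "closedin (cw_space C) F \<longleftrightarrow> F \<subseteq> cw_points C \<and>
    (\<forall>e\<in>edges C. closed {x \<in> {0..1}. edge_map e x \<in> F}) \<and>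
    (\<forall>D\<in>discs C. closed {z \<in> cball 0 1. disc_map D z \<in> F})"
proof -
  have op: "openin (top_of_set A) {x \<in> A. g x \<in> cw_points C - F} \<longleftrightarrow> closed {x \<in> A. g x \<in> F}"
    if "closed A" "\<And>x. g x \<in> cw_points C" for A :: "'c::topological_space set" and g
  proof -
    have "{x \<in> A. g x \<in> cw_points C - F} = A - {x \<in> A. g x \<in> F}" using that(2) by auto
    moreover have "closedin (top_of_set A) {x \<in> A. g x \<in> F} \<longleftrightarrow> closed {x \<in> A. g x \<in> F}"
      using that(1) by (auto simp: closedin_closed_eq)
    ultimately show ?thesis by (simp add: closedin_def)
  qed
  show ?thesis
    unfolding closedin_def topspace_cw_space[OF wf] openin_cw_space
    using op[of "{0..1}" "edge_map _"] op[of "cball 0 1" "disc_map _"]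
      edge_map_in_cw_points[OF wf] disc_map_in_cw_points[OF wf] by auto
qed

lemma wf_path_edges: "wf_path C p \<Longrightarrow> i < length p - 1 \<Longrightarrow> (p ! i, p ! Suc i) \<in> edges C"
  unfolding wf_path_def successively_conv_nth by auto

text \<open>A cell outside the induced complex meets it only in its boundary: an edge in at most two
  points, and a disc in the part of its boundary circle that the two paths map into it.\<close>

lemma closedin_induced_imp_closedin:
  assumes wf: "wf_complex2 C" and F: "closedin (cw_space (induced_complex C V)) F"
  shows "closedin (cw_space C) F"
proof -
  let ?C = "induced_complex C V"
  note wf' = wf_induced_complex[OF wf, of V]
  have FC: "F \<subseteq> cw_points ?C" and Fe: "\<And>e. e \<in> edges ?C \<Longrightarrow> closed {x \<in> {0..1}. edge_map e x \<in> F}"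
    and Fd: "\<And>D. D \<in> discs ?C \<Longrightarrow> closed {z \<in> cball 0 1. disc_map D z \<in> F}"
    using F unfolding closedin_cw_space[OF wf'] by auto
  have sub: "y \<in> cw_points C" if "y \<in> cw_points ?C" for y using that by (cases y) (auto simp: cw_points_iff)
  have E: "closed {x \<in> {0..1}. edge_map e x \<in> F}" if "e \<in> edges C" for e
  proof (cases "e \<in> edges ?C")
    case False
    then have "EdgePt e x \<notin> F" for x using FC cw_points_iff(2)[of e x ?C] by blast
    then have "{x \<in> {0..1}. edge_map e x \<in> F} \<subseteq> {0, 1}" unfolding edge_map_def by auto
    then show ?thesis by (meson finite.emptyI finite.insertI finite_imp_closed finite_subset)
  qed (rule Fe)
  have "closed {z \<in> cball 0 1. disc_map D z \<in> F}" if D: "D \<in> discs C" for D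
  proof (cases "D \<in> discs ?C")
    case False
    then have no: "DiscPt D z \<notin> F" for z using FC cw_points_iff(3)[of D z ?C] by blast
    obtain p q where s: "disc_sides D = (p, q)" "D = {p, q}" "wf_path C p" "wf_path C q"
      "hd p = hd q" "last p = last q" by (rule disc_sidesE[OF wf D])
    have ne: "p \<noteq> []" "q \<noteq> []" using s unfolding wf_path_def by auto
    note bd = disc_map_boundary[OF s(1) ne s(5,6)]
    let ?P = "\<lambda>p. {t \<in> {0..1}. path_map p t \<in> F}"
    let ?g = "\<lambda>z. (1 - Re z) / 2"
    have P: "closed (?P p)" if "wf_path C p" for p
      by (rule closed_path_preimage) (use E wf_path_edges[OF that] in auto)
    have g: "?g z \<in> {0..1}" if "norm z = 1" for z using abs_Re_le_cmod[of z] that by auto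
    have "{z \<in> cball 0 1. disc_map D z \<in> F} =
        (sphere 0 1 \<inter> {z. 0 \<le> Im z} \<inter> ?g -` ?P p) \<union> (sphere 0 1 \<inter> {z. Im z \<le> 0} \<inter> ?g -` ?P q)"
    proof (intro Set.set_eqI iffI)
      fix z assume z: "z \<in> {z \<in> cball 0 1. disc_map D z \<in> F}"
      then have n: "norm z = 1" using no unfolding disc_map_def by (cases "norm z < 1") auto
      show "z \<in> (sphere 0 1 \<inter> {z. 0 \<le> Im z} \<inter> ?g -` ?P p) \<union> (sphere 0 1 \<inter> {z. Im z \<le> 0} \<inter> ?g -` ?P q)"
        using z n bd[OF n] g[OF n] by (cases "0 \<le> Im z") auto
    next
      fix z assume z: "z \<in> (sphere 0 1 \<inter> {z. 0 \<le> Im z} \<inter> ?g -` ?P p) \<union> (sphere 0 1 \<inter> {z. Im z \<le> 0} \<inter> ?g -` ?P q)"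
      then have n: "norm z = 1" by auto
      show "z \<in> {z \<in> cball 0 1. disc_map D z \<in> F}" using z n bd[OF n] by auto
    qed
    moreover have "closed (?g -` ?P r)" if "wf_path C r" for r
      by (rule closed_vimage[OF P[OF that]]) (auto intro!: continuous_intros)
    moreover have "closed {z. 0 \<le> Im z}" "closed {z. Im z \<le> 0}"
      by (auto intro!: closed_Collect_le continuous_intros)
    ultimately show ?thesis using s by (auto intro!: closed_Un closed_Int)
  qed (rule Fd)
  then show ?thesis unfolding closedin_cw_space[OF wf] using E FC sub by blast
qed

lemma cw_points_induced_subset: "cw_points (induced_complex C V) \<subseteq> cw_points C"
proof
  fix y assume "y \<in> cw_points (induced_complex C V)"
  then show "y \<in> cw_points C" by (cases y) (auto simp: cw_points_iff)
qed

text \<open>An open subset of the induced complex is extended by the complement of the induced complex: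
  the result is open, because its complement is closed in the induced complex and hence, by the
  preceding lemma on closed sets, in the whole complex.\<close>

theorem cw_space_induced:
  assumes wf: "wf_complex2 C"
  shows "cw_space (induced_complex C V) = subtopology (cw_space C) (cw_points (induced_complex C V))"
  (is "cw_space ?C = _")
  unfolding topology_eq
proof (intro allI iffI)
  note wf' = wf_induced_complex[OF wf, of V]
  note sub = cw_points_induced_subset[of C V]
  fix U
  show "openin (subtopology (cw_space C) (cw_points ?C)) U" if U: "openin (cw_space ?C) U"
  proof -
    have US: "U \<subseteq> cw_points ?C" using U unfolding openin_cw_space by blast
    have "closedin (cw_space ?C) (cw_points ?C - U)"
      using U closedin_topspace topspace_cw_space[OF wf'] by (metis closedin_diff)
    then have "closedin (cw_space C) (cw_points ?C - U)" by (rule closedin_induced_imp_closedin[OF wf])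
    then have "openin (cw_space C) (cw_points C - (cw_points ?C - U))"
      using topspace_cw_space[OF wf] by (metis openin_diff openin_topspace)
    moreover have "U = (cw_points C - (cw_points ?C - U)) \<inter> cw_points ?C" using US sub by blast
    ultimately show ?thesis unfolding openin_subtopology by blast
  qed
  show "openin (cw_space ?C) U" if U: "openin (subtopology (cw_space C) (cw_points ?C)) U"
  proof -
    obtain T where T: "openin (cw_space C) T" "U = T \<inter> cw_points ?C" using U unfolding openin_subtopology by blast
    have "{x \<in> {0..1}. edge_map e x \<in> U} = {x \<in> {0..1}. edge_map e x \<in> T}" if "e \<in> edges ?C" for e
      using T edge_map_in_cw_points[OF wf' that] by auto
    moreover have "{z \<in> cball 0 1. disc_map D z \<in> U} = {z \<in> cball 0 1. disc_map D z \<in> T}" if "D \<in> discs ?C" for D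
      using T disc_map_in_cw_points[OF wf' that] by auto
    ultimately show ?thesis using T(1) unfolding openin_cw_space T(2) by simp
  qed
qed

lemma open_meets_dense:
  assumes "openin (top_of_set (closure A)) P" "z \<in> P" obtains a where "a \<in> A" "a \<in> P"
proof -
  obtain T where T: "open T" "P = closure A \<inter> T" using assms(1) unfolding openin_open by blast
  then have "T \<inter> A \<noteq> {}" using assms(2) open_Int_closure_eq_empty[OF T(1), of A] by blast
  then show ?thesis using that T closure_subset by blast
qed

lemma edge_closure_contains_ends:
  assumes wf: "wf_complex2 C" and e: "e \<in> edges C" and x: "x \<in> {0..1}"
  shows "edge_map e x \<in> cw_space C closure_of (EdgePt e ` {0<..<1})"
  unfolding in_closure_of topspace_cw_space[OF wf]
proof (intro conjI allI impI)
  show "edge_map e x \<in> cw_points C" by (rule edge_map_in_cw_points[OF wf e])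
  fix T assume T: "edge_map e x \<in> T \<and> openin (cw_space C) T"
  then have "openin (top_of_set (closure {0<..<1::real})) {x \<in> {0..1}. edge_map e x \<in> T}"
    using e unfolding openin_cw_space by simp
  moreover have "x \<in> {x \<in> {0..1}. edge_map e x \<in> T}" using T x by simp
  ultimately obtain y where "y \<in> {0<..<1}" "y \<in> {x \<in> {0..1}. edge_map e x \<in> T}" by (rule open_meets_dense)
  then show "\<exists>y. y \<in> EdgePt e ` {0<..<1} \<and> y \<in> T" unfolding edge_map_def by auto
qed

lemma disc_closure_contains_boundary:
  assumes wf: "wf_complex2 C" and D: "D \<in> discs C" and z: "z \<in> cball 0 1"
  shows "disc_map D z \<in> cw_space C closure_of (DiscPt D ` ball 0 1)"
  unfolding in_closure_of topspace_cw_space[OF wf]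
proof (intro conjI allI impI)
  show "disc_map D z \<in> cw_points C" by (rule disc_map_in_cw_points[OF wf D])
  fix T assume T: "disc_map D z \<in> T \<and> openin (cw_space C) T"
  then have "openin (top_of_set (closure (ball 0 1))) {z \<in> cball 0 1. disc_map D z \<in> T}"
    using D unfolding openin_cw_space by simp
  moreover have "z \<in> {z \<in> cball 0 1. disc_map D z \<in> T}" using T z by simp
  ultimately obtain y where "y \<in> ball 0 1" "y \<in> {z \<in> cball 0 1. disc_map D z \<in> T}" by (rule open_meets_dense)
  then show "\<exists>y. y \<in> DiscPt D ` ball 0 1 \<and> y \<in> T" unfolding disc_map_def by auto
qed

text \<open>The induced complex is closed, so the closures of its cells contain no further vertices.
  Conversely, the closure of an edge contains its ends, and that of a disc all vertices on its two
  paths.\<close>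

theorem full_subcomplex_eq_induced:
  assumes wf: "wf_complex2 C"
  shows "full_subcomplex C V = cw_points (induced_complex C V)"
proof
  let ?C = "induced_complex C V"
  note wf' = wf_induced_complex[OF wf, of V]
  have closed: "closedin (cw_space C) (cw_points ?C)"
    using closedin_induced_imp_closedin[OF wf] closedin_topspace topspace_cw_space[OF wf'] by metis
  have within: "c \<in> cells_within C V" if "c \<in> open_cells C k" "c \<subseteq> cw_points ?C" for c k
  proof -
    have "cw_space C closure_of c \<subseteq> cw_points ?C" by (rule closure_of_minimal[OF that(2) closed])
    then show ?thesis using that(1) cw_points_iff(1)[of _ ?C] unfolding cells_within_def by auto
  qed
  show "cw_points ?C \<subseteq> full_subcomplex C V"
  proof
    fix y assume y: "y \<in> cw_points ?C"
    show "y \<in> full_subcomplex C V"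
    proof (cases y)
      case (Vertex v)
      then show ?thesis using y by (auto simp: cw_points_iff full_subcomplex_def)
    next
      case (EdgePt e x)
      have "EdgePt e ` {0<..<1} \<in> cells_within C V"
        by (rule within[of _ "Suc 0"]) (use y EdgePt in \<open>auto simp: cw_points_iff\<close>)
      moreover have "y \<in> EdgePt e ` {0<..<1}" using y EdgePt by (auto simp: cw_points_iff)
      ultimately show ?thesis unfolding full_subcomplex_def by blast
    next
      case (DiscPt D z)
      have "DiscPt D ` ball 0 1 \<in> cells_within C V"
        by (rule within[of _ 2]) (use y DiscPt in \<open>auto simp: cw_points_iff\<close>)
      moreover have "y \<in> DiscPt D ` ball 0 1" using y DiscPt by (auto simp: cw_points_iff)
      ultimately show ?thesis unfolding full_subcomplex_def by blast
    qed
  qed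
  have "c \<subseteq> cw_points ?C" if c: "c \<in> cells_within C V" for c
  proof -
    obtain k where k: "c \<in> open_cells C k"
      and cl: "\<And>v. v \<in> verts C \<Longrightarrow> Vertex v \<in> cw_space C closure_of c \<Longrightarrow> v \<in> V"
      using c unfolding cells_within_def by blast
    consider v where "c = {Vertex v}" "v \<in> verts C" | e where "c = EdgePt e ` {0<..<1}" "e \<in> edges C"
      | D where "c = DiscPt D ` ball 0 1" "D \<in> discs C"
      using k open_cells_dim[OF k] by fastforce
    then show ?thesis
    proof cases
      case 1
      have "c \<subseteq> cw_space C closure_of c"
        by (rule closure_of_subset) (use 1 topspace_cw_space[OF wf] in \<open>auto simp: cw_points_iff\<close>)
      then show ?thesis using cl[of v] 1 by (auto simp: cw_points_iff)
    next
      case (2 e)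
      have v: "fst e \<in> verts C" "snd e \<in> verts C" using 2 wf unfolding wf_complex2_def by auto
      have "fst e \<in> V" "snd e \<in> V"
        using cl v edge_closure_contains_ends[OF wf 2(2), of 0] edge_closure_contains_ends[OF wf 2(2), of 1]
        unfolding 2(1) by (auto simp: edge_map_def)
      then show ?thesis using 2 by (auto simp: cw_points_iff)
    next
      case (3 D)
      have "v \<in> V" if v: "p \<in> D" "v \<in> set p" for p v
      proof -
        obtain z where z: "norm z = 1" "disc_map D z = Vertex v" by (rule disc_map_hits_vertices[OF wf 3(2) v])
        then have "Vertex v \<in> cw_space C closure_of c"
          using disc_closure_contains_boundary[OF wf 3(2), of z] 3(1) by simp
        moreover have "v \<in> verts C"
          using disc_map_in_cw_points[OF wf 3(2), of z] z by (simp add: cw_points_iff)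
        ultimately show ?thesis using cl by blast
      qed
      then show ?thesis using 3 by (auto simp: cw_points_iff)
    qed
  qed
  then show "full_subcomplex C V \<subseteq> cw_points ?C"
    unfolding full_subcomplex_def by (auto simp: cw_points_iff)
qed

subsection \<open>Isomorphic complexes are homeomorphic\<close>

definition complex_iso :: "('v \<Rightarrow> 'w) \<Rightarrow> 'v complex2 \<Rightarrow> 'w complex2 \<Rightarrow> bool" where
  "complex_iso f C D \<longleftrightarrow> inj_on f (verts C) \<and> verts D = f ` verts C \<and>
     edges D = map_prod f f ` edges C \<and> discs D = (\<lambda>A. map f ` A) ` discs C"

text \<open>The two complexes may choose different upper halves for corresponding discs; then the discs
  are matched by complex conjugation.\<close>

definition disc_flip :: "('v \<Rightarrow> 'w) \<Rightarrow> 'v list set \<Rightarrow> complex \<Rightarrow> complex" where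
  "disc_flip f A = (if disc_sides (map f ` A) = map_prod (map f) (map f) (disc_sides A) then id else cnj)"

primrec iso_map :: "('v \<Rightarrow> 'w) \<Rightarrow> 'v point \<Rightarrow> 'w point" where
  "iso_map f (Vertex v) = Vertex (f v)"
| "iso_map f (EdgePt e x) = EdgePt (map_prod f f e) x"
| "iso_map f (DiscPt A z) = DiscPt (map f ` A) (disc_flip f A z)"

lemma norm_disc_flip [simp]: "norm (disc_flip f A z) = norm z"
  by (simp add: disc_flip_def)

lemma disc_flip_flip [simp]: "disc_flip f A (disc_flip f A z) = z"
  by (simp add: disc_flip_def)

lemma iso_map_edge: "iso_map f (edge_map e x) = edge_map (map_prod f f e) x"
  by (simp add: edge_map_def)

lemma iso_map_path:
  assumes "p \<noteq> []" shows "iso_map f (path_map p x) = path_map (map f p) x"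
proof -
  obtain n where n: "length p = Suc n" using assms by (cases p) auto
  then show ?thesis using assms unfolding path_map_def Let_def length_map n
    by (simp add: iso_map_edge last_map n)
qed

lemma iso_map_disc:
  assumes wfC: "wf_complex2 C" and wfD: "wf_complex2 D" and iso: "complex_iso f C D" and A: "A \<in> discs C"
    and z: "norm z \<le> 1"
  shows "iso_map f (disc_map A z) = disc_map (map f ` A) (disc_flip f A z)"
proof (cases "norm z < 1")
  case True
  then show ?thesis by (simp add: disc_map_def)
next
  case False
  then have n: "norm z = 1" using z by simp
  have B: "map f ` A \<in> discs D" using iso A unfolding complex_iso_def by blast
  obtain p q where s: "disc_sides A = (p, q)" "A = {p, q}" "wf_path C p" "wf_path C q"
    "hd p = hd q" "last p = last q" by (rule disc_sidesE[OF wfC A])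
  obtain p' q' where s': "disc_sides (map f ` A) = (p', q')" "map f ` A = {p', q'}" "wf_path D p'" "wf_path D q'"
    "hd p' = hd q'" "last p' = last q'" by (rule disc_sidesE[OF wfD B])
  have ne: "p \<noteq> []" "q \<noteq> []" "p' \<noteq> []" "q' \<noteq> []" using s s' unfolding wf_path_def by auto
  note bd = disc_map_boundary[OF s(1) ne(1,2) s(5,6) n]
  have n': "norm (disc_flip f A z) = 1" using n by simp
  note bd' = disc_map_boundary[OF s'(1) ne(3,4) s'(5,6) n']
  have Re: "Re (disc_flip f A z) = Re z" by (simp add: disc_flip_def)
  show ?thesis
  proof (cases "p' = map f p \<and> q' = map f q")
    case True
    then have fl: "disc_flip f A z = z" using s s' by (simp add: disc_flip_def)
    show ?thesis using bd bd' True ne iso_map_path fl by (cases "0 \<le> Im z") auto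
  next
    case False
    then have pq: "p' = map f q" "q' = map f p" using s(2) s'(2) by (auto simp: doubleton_eq_iff)
    have fl: "disc_flip f A z = cnj z" using False s s' by (auto simp: disc_flip_def)
    show ?thesis using bd bd' pq ne iso_map_path fl Re by (cases "0 \<le> Im z") auto
  qed
qed

lemma inj_on_iso_map:
  assumes wf: "wf_complex2 C" and iso: "complex_iso f C D" shows "inj_on (iso_map f) (cw_points C)"
proof (rule inj_onI)
  have inj: "inj_on f (verts C)" using iso unfolding complex_iso_def by blast
  have E: "edges C \<subseteq> verts C \<times> verts C" using wf unfolding wf_complex2_def by blast
  have Dv: "A \<subseteq> lists (verts C)" if A: "A \<in> discs C" for A
  proof -
    obtain p q where "A = {p, q}" "wf_path C p" "wf_path C q" using wf A unfolding wf_complex2_def by blast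
    then show ?thesis unfolding wf_path_def by auto
  qed
  have injm: "inj_on (map f) (lists (verts C))"
    by (rule inj_on_mapI) (use inj in \<open>auto intro: inj_on_subset\<close>)
  fix x y assume x: "x \<in> cw_points C" and y: "y \<in> cw_points C" and eq: "iso_map f x = iso_map f y"
  show "x = y"
  proof (cases x)
    case (Vertex v)
    then show ?thesis using x y eq inj by (cases y) (auto simp: cw_points_iff inj_on_def)
  next
    case (EdgePt e r)
    then obtain e' where y': "y = EdgePt e' r" "map_prod f f e = map_prod f f e'" using eq by (cases y) auto
    have "e \<in> verts C \<times> verts C" "e' \<in> verts C \<times> verts C" using x y EdgePt y' E by (auto simp: cw_points_iff)
    then have "e = e'" using inj y'(2) by (cases e; cases e') (auto simp: inj_on_def)
    then show ?thesis using y' EdgePt by simp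
  next
    case (DiscPt A z)
    then obtain A' z' where y': "y = DiscPt A' z'" "map f ` A = map f ` A'" "disc_flip f A z = disc_flip f A' z'"
      using eq by (cases y) auto
    have "A = A'" using inj_on_image_eq_iff[OF injm] Dv x y DiscPt y' by (auto simp: cw_points_iff)
    then show ?thesis using y' DiscPt disc_flip_flip by metis
  qed
qed

lemma iso_map_cells:
  assumes iso: "complex_iso f C D" and c: "c \<in> open_cells C k" shows "iso_map f ` c \<in> open_cells D k"
proof -
  have ball: "disc_flip f A ` ball 0 1 = ball 0 1" for A
  proof
    show "ball 0 1 \<subseteq> disc_flip f A ` ball 0 1"
      by (intro subsetI image_eqI[of _ _ "disc_flip f A _"]) auto
  qed auto
  have "iso_map f ` DiscPt A ` ball 0 1 = DiscPt (map f ` A) ` disc_flip f A ` ball 0 1" for A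
    by (auto simp: image_image)
  then have disc: "iso_map f ` DiscPt A ` ball 0 1 = DiscPt (map f ` A) ` ball 0 1" for A by (simp only: ball)
  have edge: "iso_map f ` EdgePt e ` {0<..<1} = EdgePt (map_prod f f e) ` {0<..<1}" for e
    by (simp add: image_image)
  have "verts D = f ` verts C" "edges D = map_prod f f ` edges C" "discs D = (\<lambda>A. map f ` A) ` discs C"
    using iso unfolding complex_iso_def by auto
  note D = this
  consider "k = 0" | "k = Suc 0" | "k = 2" using open_cells_dim[OF c] by blast
  then show ?thesis
  proof cases
    case 1
    then obtain v where "v \<in> verts C" "c = {Vertex v}" using c by auto
    then show ?thesis using 1 D(1) by simp
  next
    case 2
    then obtain e where "e \<in> edges C" "c = EdgePt e ` {0<..<1}" using c by auto
    then show ?thesis unfolding 2 open_cells_simps D(2) using edge[of e] by blast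
  next
    case 3
    then obtain A where "A \<in> discs C" "c = DiscPt A ` ball 0 1" using c by auto
    then show ?thesis unfolding 3 open_cells_simps D(3) using disc[of A] by blast
  qed
qed

lemma iso_map_image:
  assumes iso: "complex_iso f C D" shows "iso_map f ` cw_points C = cw_points D"
proof
  show "iso_map f ` cw_points C \<subseteq> cw_points D"
    using iso_map_cells[OF iso] unfolding cw_points_def by blast
  show "cw_points D \<subseteq> iso_map f ` cw_points C"
  proof
    fix y assume y: "y \<in> cw_points D"
    show "y \<in> iso_map f ` cw_points C"
    proof (cases y)
      case (Vertex w)
      then obtain v where "v \<in> verts C" "w = f v" using y iso unfolding complex_iso_def by (auto simp: cw_points_iff)
      then show ?thesis using Vertex by (intro image_eqI[of _ _ "Vertex v"]) (auto simp: cw_points_iff)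
    next
      case (EdgePt e x)
      then obtain e' where "e' \<in> edges C" "e = map_prod f f e'" using y iso unfolding complex_iso_def by (auto simp: cw_points_iff)
      then show ?thesis using EdgePt y by (intro image_eqI[of _ _ "EdgePt e' x"]) (auto simp: cw_points_iff)
    next
      case (DiscPt B z)
      then obtain A where "A \<in> discs C" "B = map f ` A" using y iso unfolding complex_iso_def by (auto simp: cw_points_iff)
      then show ?thesis using DiscPt y
        by (intro image_eqI[of _ _ "DiscPt A (disc_flip f A z)"]) (auto simp: cw_points_iff)
    qed
  qed
qed

lemma openin_cball_flip:
  "openin (top_of_set (cball 0 1)) {z \<in> cball 0 1. P (disc_flip f A z)} \<longleftrightarrow>
   openin (top_of_set (cball 0 1)) {z \<in> cball 0 1. P z}"
proof -
  have cont: "continuous_on (cball 0 1) (disc_flip f A)"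
    by (auto simp: disc_flip_def intro!: continuous_intros)
  have "openin (top_of_set (cball 0 1)) {z \<in> cball 0 1. Q (disc_flip f A z)}"
    if "openin (top_of_set (cball 0 1)) {z \<in> cball 0 1. Q z}" for Q
  proof -
    have "openin (top_of_set (cball 0 1)) (cball 0 1 \<inter> disc_flip f A -` {z \<in> cball 0 1. Q z})"
      by (rule continuous_openin_preimage[OF cont _ that]) auto
    moreover have "cball 0 1 \<inter> disc_flip f A -` {z \<in> cball 0 1. Q z} = {z \<in> cball 0 1. Q (disc_flip f A z)}"
      by auto
    ultimately show ?thesis by simp
  qed
  from this[of P] this[of "\<lambda>z. P (disc_flip f A z)"] show ?thesis by auto
qed

theorem homeomorphic_map_iso_map:
  assumes wfC: "wf_complex2 C" and wfD: "wf_complex2 D" and iso: "complex_iso f C D"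
  shows "homeomorphic_map (cw_space C) (cw_space D) (iso_map f)"
  unfolding homeomorphic_map_def quotient_map_def topspace_cw_space[OF wfC] topspace_cw_space[OF wfD]
proof (intro conjI allI impI)
  show "iso_map f ` cw_points C = cw_points D" by (rule iso_map_image[OF iso])
  show "inj_on (iso_map f) (cw_points C)" by (rule inj_on_iso_map[OF wfC iso])
  fix U assume U: "U \<subseteq> cw_points D"
  let ?V = "{x \<in> cw_points C. iso_map f x \<in> U}"
  have E: "{x \<in> {0..1}. edge_map e x \<in> ?V} = {x \<in> {0..1}. edge_map (map_prod f f e) x \<in> U}" if "e \<in> edges C" for e
    using edge_map_in_cw_points[OF wfC that] by (auto simp: iso_map_edge)
  have D: "{z \<in> cball 0 1. disc_map A z \<in> ?V} = {z \<in> cball 0 1. disc_map (map f ` A) (disc_flip f A z) \<in> U}"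
    if "A \<in> discs C" for A
    using disc_map_in_cw_points[OF wfC that] iso_map_disc[OF wfC wfD iso that] by auto
  have eD: "edges D = map_prod f f ` edges C" and dD: "discs D = (\<lambda>A. map f ` A) ` discs C"
    using iso unfolding complex_iso_def by auto
  have "(\<forall>e\<in>edges C. openin (top_of_set {0..1}) {x \<in> {0..1}. edge_map e x \<in> ?V}) \<longleftrightarrow>
      (\<forall>e\<in>edges D. openin (top_of_set {0..1}) {x \<in> {0..1}. edge_map e x \<in> U})"
    unfolding eD Set.ball_simps(9)
  proof (rule ball_cong[OF HOL.refl])
    fix e assume e: "e \<in> edges C"
    show "openin (top_of_set {0..1}) {x \<in> {0..1}. edge_map e x \<in> ?V} \<longleftrightarrow>
        openin (top_of_set {0..1}) {x \<in> {0..1}. edge_map (map_prod f f e) x \<in> U}"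
      unfolding E[OF e] by (rule HOL.refl)
  qed
  moreover have "(\<forall>A\<in>discs C. openin (top_of_set (cball 0 1)) {z \<in> cball 0 1. disc_map A z \<in> ?V}) \<longleftrightarrow>
      (\<forall>B\<in>discs D. openin (top_of_set (cball 0 1)) {z \<in> cball 0 1. disc_map B z \<in> U})"
    unfolding dD Set.ball_simps(9)
  proof (rule ball_cong[OF HOL.refl])
    fix A assume A: "A \<in> discs C"
    show "openin (top_of_set (cball 0 1)) {z \<in> cball 0 1. disc_map A z \<in> ?V} \<longleftrightarrow>
        openin (top_of_set (cball 0 1)) {z \<in> cball 0 1. disc_map (map f ` A) z \<in> U}"
      unfolding D[OF A] by (rule openin_cball_flip)
  qed
  moreover have "?V \<subseteq> cw_points C" by blast
  ultimately show "openin (cw_space C) ?V \<longleftrightarrow> openin (cw_space D) U"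
    unfolding openin_cw_space using U by simp
qed

theorem cell_preserving_homeo_induced:
  assumes wfC: "wf_complex2 C" and wfD: "wf_complex2 D" and iso: "complex_iso f (induced_complex C V) D"
  shows "cell_preserving_homeo C (full_subcomplex C V) D (iso_map f)"
  unfolding cell_preserving_homeo_def
proof (intro conjI allI ballI impI)
  show "homeomorphic_map (subtopology (cw_space C) (full_subcomplex C V)) (cw_space D) (iso_map f)"
    using homeomorphic_map_iso_map[OF wf_induced_complex[OF wfC] wfD iso]
    unfolding cw_space_induced[OF wfC] full_subcomplex_eq_induced[OF wfC] .
  fix k c assume c: "c \<in> open_cells C k" "c \<subseteq> full_subcomplex C V"
  then have sub: "c \<subseteq> cw_points (induced_complex C V)" using full_subcomplex_eq_induced[OF wfC] by blast
  have h: "EdgePt e (1/2) \<in> EdgePt e ` {0<..<1}" "DiscPt A 0 \<in> DiscPt A ` ball 0 1" for e A by auto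
  have "c \<in> open_cells (induced_complex C V) k"
  proof -
    consider "k = 0" | "k = Suc 0" | "k = 2" using open_cells_dim[OF c(1)] by blast
    then show ?thesis
    proof cases
      case 1
      then show ?thesis using c(1) sub by (auto simp: cw_points_iff)
    next
      case 2
      then obtain e where e: "e \<in> edges C" "c = EdgePt e ` {0<..<1}" using c(1) by auto
      then have "EdgePt e (1/2) \<in> cw_points (induced_complex C V)" using h(1)[of e] subsetD[OF sub] by simp
      then have "e \<in> edges (induced_complex C V)" unfolding cw_points_iff by blast
      then show ?thesis using 2 e(2) open_cells_simps(2) by blast
    next
      case 3
      then obtain A where A: "A \<in> discs C" "c = DiscPt A ` ball 0 1" using c(1) by auto
      then have "DiscPt A 0 \<in> cw_points (induced_complex C V)" using h(2)[of A] subsetD[OF sub] by simp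
      then have "A \<in> discs (induced_complex C V)" unfolding cw_points_iff by blast
      then show ?thesis using 3 A(2) open_cells_simps(3) by blast
    qed
  qed
  then show "iso_map f ` c \<in> open_cells D k" by (rule iso_map_cells[OF iso])
qed

section \<open>The graph of reduced steps in terms of maximal elements\<close>

context coxeter_system
begin

text \<open>A \<open>(J,I)\<close>-coset is recorded by its maximal element, so that the vertices for \<open>J\<close> become a
  subset of the vertices for the empty set.\<close>

definition max_pairs :: "'a set \<Rightarrow> ('a set \<times> 'a) set" where
  "max_pairs J = {(I, w). finitary G S I \<and> bimax J I w}"

definition coset_of :: "'a set \<Rightarrow> 'a set \<times> 'a \<Rightarrow> 'a vertex" where
  "coset_of J = (\<lambda>(I, w). (I, DC J I w))"

text \<open>This relation does not mention \<open>J\<close>, so that the graph for \<open>J\<close> is a full subgraph of the graph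
  for the empty set.\<close>

definition max_step :: "'a set \<times> 'a \<Rightarrow> 'a set \<times> 'a \<Rightarrow> bool" where
  "max_step = (\<lambda>(I, w) (I', w').
     (\<exists>s. s \<notin> I \<and> I' = insert s I) \<and> w \<otimes> wl I = w' \<otimes> wl I' \<or>
     (\<exists>s. s \<notin> I' \<and> I = insert s I') \<and> w = w')"

lemma fst_coset_of [simp]: "fst (coset_of J x) = fst x"
  by (simp add: coset_of_def split: prod.split)

lemma cox_vertices_eq: assumes J: "finitary G S J" shows "cox_vertices G S J = coset_of J ` max_pairs J"
proof (intro equalityI subsetI)
  fix x assume "x \<in> cox_vertices G S J"
  then obtain I w where w: "x = (I, DC J I w)" "finitary G S I" "w \<in> carrier G" unfolding cox_vertices_def by blast
  obtain v where "DC J I v = DC J I w" "bimax J I v" using bimax_exists[OF J w(2,3)] by metis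
  then show "x \<in> coset_of J ` max_pairs J" using w
    by (intro image_eqI[of _ _ "(I, v)"]) (auto simp: coset_of_def max_pairs_def)
next
  fix x assume "x \<in> coset_of J ` max_pairs J"
  then show "x \<in> cox_vertices G S J" unfolding coset_of_def max_pairs_def cox_vertices_def bimax_def by auto
qed

lemma coset_max_coset_of:
  assumes "finitary G S J" "x \<in> max_pairs J" shows "coset_max G S (snd (coset_of J x)) = snd x"
  using assms coset_max_eq by (auto simp: coset_of_def max_pairs_def)

lemma inj_on_coset_of: assumes J: "finitary G S J" shows "inj_on (coset_of J) (max_pairs J)"
  by (rule inj_onI) (metis J coset_max_coset_of fst_coset_of prod.expand)

lemma double_coset_mono: "I \<subseteq> I' \<Longrightarrow> DC J I w \<subseteq> DC J I' w"
  using W_mono[of I I'] by (auto simp: double_coset_def r_coset_def set_mult_def)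

text \<open>The two conditions on an upward step are that \<open>m = min p\<close> and \<open>K = J \<inter> m I m\<^sup>-\<^sup>1\<close> do not
  change.  They determine, and are determined by, the product \<open>w w\<^sub>I = w\<^sub>J c\<^sub>K m\<close>: it has \<open>m\<close> as
  minimal element of its left coset under \<open>W\<^sub>J\<close>, and \<open>K\<close> is the descent set of \<open>c\<^sub>K\<close>.\<close>

lemma reduced_up_iff:
  assumes J: "finitary G S J" and x: "(I, w) \<in> max_pairs J" and y: "(I', w') \<in> max_pairs J"
  shows "reduced_up G S J (coset_of J (I, w)) (coset_of J (I', w')) \<longleftrightarrow>
    (\<exists>s. s \<notin> I \<and> I' = insert s I) \<and> w \<otimes> wl I = w' \<otimes> wl I'"
proof -
  have JS: "J \<subseteq> S" using J by (rule finitaryD)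
  have I: "finitary G S I" "I \<subseteq> S" and I': "finitary G S I'" "I' \<subseteq> S"
    and w: "bimax J I w" "w \<in> carrier G" and w': "bimax J I' w'" "w' \<in> carrier G"
    using x y finitaryD unfolding max_pairs_def bimax_def by auto
  obtain m where m: "m \<in> DC J I w" "DC J I m = DC J I w" "bimin J I m"
    by (rule bimin_exists[OF JS I(2) w(2)])
  obtain m' where m': "m' \<in> DC J I' w'" "DC J I' m' = DC J I' w'" "bimin J I' m'"
    by (rule bimin_exists[OF JS I'(2) w'(2)])
  have mc: "m \<in> carrier G" "m' \<in> carrier G" using m m' unfolding bimin_def by auto
  define K where "K = J \<inter> conj_by G m ` I"
  define K' where "K' = J \<inter> conj_by G m' ` I'"
  have K: "finitary G S K" "finitary G S K'" using finitary_mono[OF J] by (auto simp: K_def K'_def)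
  have form: "w \<otimes> wl I = wl J \<otimes> wl K \<otimes> m"
    unfolding K_def using bimax_formula[OF J I(1) m(3) w(1)] m(2) double_coset_self[OF JS I(2) w(2)] by simp
  have form': "w' \<otimes> wl I' = wl J \<otimes> wl K' \<otimes> m'"
    unfolding K'_def using bimax_formula[OF J I'(1) m'(3) w'(1)] m'(2) double_coset_self[OF JS I'(2) w'(2)] by simp
  have min: "coset_min G S (DC J I w) = m" "coset_min G S (DC J I' w') = m'"
    using coset_min_eq[OF JS I(2) m(3)] coset_min_eq[OF JS I'(2) m'(3)] m(2) m'(2) by simp_all
  have "w \<otimes> wl I = w' \<otimes> wl I' \<longleftrightarrow> m = m' \<and> K = K'"
  proof
    assume "m = m' \<and> K = K'" then show "w \<otimes> wl I = w' \<otimes> wl I'" using form form' by simp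
  next
    assume "w \<otimes> wl I = w' \<otimes> wl I'"
    then have eq: "(wl J \<otimes> wl K) \<otimes> m = (wl J \<otimes> wl K') \<otimes> m'" using form form' by simp
    let ?a = "wl J \<otimes> wl K" let ?a' = "wl J \<otimes> wl K'"
    have KJ: "W K \<subseteq> W J" "W K' \<subseteq> W J" by (auto intro!: W_mono simp: K_def K'_def)
    have a: "?a \<in> W J" "?a' \<in> W J" using KJ longest_props(1)[OF J] longest_props(1)[OF K(1)] longest_props(1)[OF K(2)] by auto
    have ac: "?a \<in> carrier G" "?a' \<in> carrier G" using J K by auto
    have "m' = inv ?a' \<otimes> (?a \<otimes> m)" unfolding eq using ac mc by (simp add: m_assoc[symmetric] del: inv_mult_group)
    then have "m' = (inv ?a' \<otimes> ?a) \<otimes> m \<otimes> \<one>" using ac mc by (simp add: m_assoc)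
    moreover have "inv ?a' \<otimes> ?a \<in> W J" using a JS by simp
    ultimately have "m' \<in> DC J {} m" using double_cosetI[of "inv ?a' \<otimes> ?a" J \<one> "{}" m] by simp
    moreover have "bimin J {} m" "bimin J {} m'"
      using m(3) m'(3) unfolding bimin_def by auto
    ultimately have mm: "m' = m" using bimin_unique[OF JS empty_subsetI] by blast
    then have "wl K = wl K'" using eq J K mc by simp
    then show "m = m' \<and> K = K'" using mm left_descents_longest[OF K(1)] left_descents_longest[OF K(2)] by metis
  qed
  moreover have "DC J I w \<subseteq> DC J I' w'" if "m = m'" "I' = insert s I" for s
    using double_coset_mono[of I I' J m] that m(2) m'(2) by auto
  ultimately show ?thesis
    unfolding reduced_up_def coset_of_def using min by (auto simp: K_def K'_def)
qed

lemma reduced_down_iff: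
  assumes J: "finitary G S J" and x: "(I, w) \<in> max_pairs J" and y: "(I', w') \<in> max_pairs J"
  shows "reduced_down G S (coset_of J (I, w)) (coset_of J (I', w')) \<longleftrightarrow>
    (\<exists>s. s \<notin> I' \<and> I = insert s I') \<and> w = w'"
proof -
  have "coset_max G S (DC J I w) = w" "coset_max G S (DC J I' w') = w'"
    using x y coset_max_eq[OF J] unfolding max_pairs_def by auto
  moreover have "DC J I' w \<subseteq> DC J I w" if "I = insert s I'" for s
    using double_coset_mono[of I' I] that by blast
  ultimately show ?thesis unfolding reduced_down_def coset_of_def by auto
qed

lemma cox_edges_iff:
  assumes J: "finitary G S J" and x: "x \<in> max_pairs J" "y \<in> max_pairs J"
  shows "(coset_of J x, coset_of J y) \<in> cox_edges G S J \<longleftrightarrow> max_step x y"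
proof -
  obtain I w I' w' where xy: "x = (I, w)" "y = (I', w')" by (metis surj_pair)
  have "coset_of J x \<in> cox_vertices G S J" "coset_of J y \<in> cox_vertices G S J"
    using x cox_vertices_eq[OF J] by auto
  then show ?thesis
    using reduced_up_iff[OF J x[unfolded xy]] reduced_down_iff[OF J x[unfolded xy]]
    unfolding cox_edges_def max_step_def xy by simp
qed

definition max_edges :: "'a set \<Rightarrow> (('a set \<times> 'a) \<times> ('a set \<times> 'a)) set" where
  "max_edges J = {(x, y). x \<in> max_pairs J \<and> y \<in> max_pairs J \<and> max_step x y}"

lemma cox_edges_eq:
  assumes J: "finitary G S J"
  shows "cox_edges G S J = map_prod (coset_of J) (coset_of J) ` max_edges J"
proof (intro equalityI subsetI)
  fix e assume e: "e \<in> cox_edges G S J"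
  then have v: "fst e \<in> coset_of J ` max_pairs J" "snd e \<in> coset_of J ` max_pairs J"
    unfolding cox_edges_def cox_vertices_eq[OF J] by auto
  obtain x where x: "x \<in> max_pairs J" "fst e = coset_of J x" using v(1) by (rule imageE)
  obtain y where y: "y \<in> max_pairs J" "snd e = coset_of J y" using v(2) by (rule imageE)
  have xy: "x \<in> max_pairs J" "y \<in> max_pairs J" "e = (coset_of J x, coset_of J y)"
    using x y by (simp_all add: prod_eq_iff)
  then show "e \<in> map_prod (coset_of J) (coset_of J) ` max_edges J"
    using e cox_edges_iff[OF J xy(1,2)] unfolding max_edges_def
    by (intro image_eqI[of _ _ "(x, y)"]) auto
next
  fix e assume "e \<in> map_prod (coset_of J) (coset_of J) ` max_edges J"
  then show "e \<in> cox_edges G S J" using cox_edges_iff[OF J] unfolding max_edges_def by auto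
qed

subsection \<open>Every coset has a reduced expression\<close>

text \<open>There are at most as many right descents as letters in a reduced word of \<open>w\<close>, since the letter
  deleted by exchange determines the descent; and the elements of the subgroup they generate are
  suffixes of \<open>w\<close>, which bounds their length.\<close>

lemma finitary_right_descents: assumes w: "w \<in> carrier G" shows "finitary G S (RD w)"
proof -
  obtain u where u: "u \<in> lists S" "wp u = w" "length u = len w" by (rule reduced_word_exists[OF w])
  have "RD w \<subseteq> (\<lambda>i. inv w \<otimes> wp (take i u @ drop (Suc i) u)) ` {..<length u}"
  proof
    fix t assume t: "t \<in> RD w"
    then obtain a r b where ab: "u = a @ r # b" "wp u \<otimes> t = wp (a @ b)"
      using exchange_right[of t u] u by (metis (no_types, lifting) mem_Collect_eq)
    have "t = inv w \<otimes> (w \<otimes> t)" using t w by (simp add: m_assoc[symmetric])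
    also have "w \<otimes> t = wp (take (length a) u @ drop (Suc (length a)) u)" using ab u by simp
    finally show "t \<in> (\<lambda>i. inv w \<otimes> wp (take i u @ drop (Suc i) u)) ` {..<length u}"
      using ab by (intro image_eqI[of _ _ "length a"]) auto
  qed
  then have fin: "finite (RD w)" by (rule finite_subset) simp
  have "W (RD w) \<subseteq> wp ` {v. set v \<subseteq> RD w \<and> length v \<le> len w}"
  proof
    fix b assume b: "b \<in> W (RD w)"
    obtain v where v: "v \<in> lists (RD w)" "wp v = b" "length v = len b"
      by (rule W_reduced_word[OF _ b]) auto
    have "len b \<le> len w" using len_mult_descents[OF w _ b] by simp
    then show "b \<in> wp ` {v. set v \<subseteq> RD w \<and> length v \<le> len w}" using v by (intro image_eqI[of _ _ v]) auto
  qed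
  then have "finite (W (RD w))" by (rule finite_subset) (simp add: finite_lists_length_le[OF fin])
  then show ?thesis unfolding finitary_def by auto
qed

lemma base_pair: assumes J: "finitary G S J" shows "(J, wl J) \<in> max_pairs J"
  using J left_descents_longest[OF J] longest_props(2)[OF J] unfolding max_pairs_def bimax_def by auto

definition max_reach :: "'a set \<Rightarrow> 'a set \<times> 'a \<Rightarrow> 'a set \<times> 'a \<Rightarrow> bool" where
  "max_reach J = (\<lambda>x y. (x, y) \<in> max_edges J)\<^sup>*\<^sup>*"

lemma max_reach_down:
  assumes I': "(I', w) \<in> max_pairs J" and sub: "I \<subseteq> I'" shows "max_reach J (I', w) (I, w)"
proof -
  have fin: "finitary G S I'" and w: "bimax J I' w" using I' unfolding max_pairs_def by auto
  have "I' \<subseteq> W I'" by auto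
  then have "finite (I' - I)" using finitaryD(2)[OF fin] by (meson finite_Diff finite_subset)
  moreover have P: "(I \<union> F, w) \<in> max_pairs J" if "F \<subseteq> I' - I" for F
    using that sub w finitary_mono[OF fin, of "I \<union> F"] unfolding max_pairs_def bimax_def by auto
  have "max_reach J (I \<union> F, w) (I, w)" if "finite F" "F \<subseteq> I' - I" for F
    using that
  proof (induction F rule: finite_induct)
    case (insert s F)
    have "max_step (I \<union> insert s F, w) (I \<union> F, w)"
      unfolding max_step_def using insert by auto
    then have "((I \<union> insert s F, w), (I \<union> F, w)) \<in> max_edges J"
      unfolding max_edges_def using P[of "insert s F"] P[of F] insert.prems by auto
    then show ?case using insert unfolding max_reach_def by (auto intro: converse_rtranclp_into_rtranclp)
  qed (simp add: max_reach_def)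
  moreover have "I \<union> (I' - I) = I'" using sub by auto
  ultimately show ?thesis by (metis subset_refl)
qed

text \<open>By induction on the length of \<open>w\<close>.  The vertex \<open>(I, w)\<close> is reached from \<open>(RD(w), w)\<close> by
  downward steps.  With \<open>m\<close> the minimal element of that coset, \<open>(RD(w), w)\<close> is reached by an upward
  step that adds \<open>s\<close> from a coset with shorter maximum, whenever \<open>m s m\<^sup>-\<^sup>1 \<notin> J\<close>.  If no such \<open>s\<close>
  exists, then \<open>w \<in> W\<^sub>J m\<close>; a right descent of \<open>m\<close> would be one of \<open>w\<close> and contradict the
  minimality of \<open>m\<close>, so \<open>m = 1\<close> and \<open>w\<close> is the longest element of \<open>W\<^sub>J\<close>.\<close>

lemma max_reach_base:
  assumes J: "finitary G S J" and x: "(I, w) \<in> max_pairs J"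
  shows "max_reach J (J, wl J) (I, w)"
  using x
proof (induction "len w" arbitrary: I w rule: less_induct)
  case less
  have JS: "J \<subseteq> S" using J by (rule finitaryD)
  have w: "w \<in> carrier G" and JL: "J \<subseteq> LD w" and IR: "I \<subseteq> RD w"
    using less.prems unfolding max_pairs_def bimax_def by auto
  define R where "R = RD w"
  have R: "finitary G S R" "R \<subseteq> S" unfolding R_def using finitary_right_descents[OF w] by auto
  have Rp: "(R, w) \<in> max_pairs J" and bw: "bimax J R w"
    using w JL R unfolding max_pairs_def bimax_def R_def by auto
  have down: "max_reach J (R, w) (I, w)" by (rule max_reach_down[OF Rp]) (use IR R_def in simp)
  obtain m where m: "m \<in> DC J R w" "DC J R m = DC J R w" "bimin J R m"
    by (rule bimin_exists[OF JS R(2) w])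
  have mc: "m \<in> carrier G" using m unfolding bimin_def by simp
  have "max_reach J (J, wl J) (R, w)"
  proof (cases "\<exists>s\<in>R. conj_by G m s \<notin> J")
    case True
    then obtain s where s: "s \<in> R" "conj_by G m s \<notin> J" by blast
    let ?I = "R - {s}"
    have I0: "finitary G S ?I" "?I \<subseteq> S" using finitary_mono[OF R(1), of ?I] R by auto
    obtain v where v: "v \<in> DC J ?I m" "DC J ?I v = DC J ?I m" "bimax J ?I v"
      using bimax_exists[OF J I0(1) mc] by metis
    have vp: "(?I, v) \<in> max_pairs J" using v I0 unfolding max_pairs_def by simp
    have m0: "bimin J ?I m" by (rule bimin_mono[OF m(3)]) auto
    have min: "coset_min G S (DC J ?I v) = m" "coset_min G S (DC J R w) = m"
      using coset_min_eq[OF JS I0(2) m0] coset_min_eq[OF JS R(2) m(3)] v(2) m(2) by simp_all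
    have "DC J ?I v \<subseteq> DC J R w" using double_coset_mono[of ?I R J m] v(2) m(2) by auto
    moreover have "J \<inter> conj_by G m ` ?I = J \<inter> conj_by G m ` R" using s by auto
    ultimately have up: "reduced_up G S J (coset_of J (?I, v)) (coset_of J (R, w))"
      unfolding reduced_up_def coset_of_def using min s by auto
    then have "v \<otimes> wl ?I = w \<otimes> wl R" using reduced_up_iff[OF J vp Rp] by blast
    moreover have "wl ?I \<noteq> wl R" using left_descents_longest[OF I0(1)] left_descents_longest[OF R(1)] s by auto
    ultimately have ne: "v \<noteq> w" using w I0 R by auto
    have vw: "v \<in> DC J R w" using v(1) double_coset_mono[of ?I R J m] m(2) by auto
    have le: "len v \<le> len w" by (rule bimax_max_length[OF J R(1) bw vw])
    have "len v \<noteq> len w"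
    proof
      assume eq: "len v = len w"
      have "DC J R v = DC J R w" by (rule double_coset_eq[OF JS R(2) w vw])
      then have "bimax J R v"
        using max_length_imp_bimax[OF JS R(2), of v] bimax_max_length[OF J R(1) bw] eq v(3)
        unfolding bimax_def by simp
      then show False using bimax_unique[OF J R(1) bw _ vw] ne by blast
    qed
    then have "max_reach J (J, wl J) (?I, v)" using less.hyps[OF _ vp] le by simp
    moreover have "((?I, v), (R, w)) \<in> max_edges J"
      using vp Rp cox_edges_iff[OF J vp Rp] up cox_vertices_eq[OF J] unfolding max_edges_def cox_edges_def by auto
    ultimately show ?thesis unfolding max_reach_def by (rule rtranclp.rtrancl_into_rtrancl)
  next
    case False
    have "w \<in> DC J R m" using m(2) double_coset_self[OF JS R(2) w] by simp
    then obtain a b where ab: "a \<in> W J" "b \<in> W R" "w = a \<otimes> m \<otimes> b" using double_coset_iff[OF JS R(2) mc] by blast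
    have c: "a \<in> carrier G" "b \<in> carrier G" using ab JS R by auto
    have "R \<subseteq> conj_by G (inv m) ` J"
    proof
      fix s assume s: "s \<in> R"
      then have "conj_by G m s \<in> J" using False by blast
      moreover have "s = conj_by G (inv m) (conj_by G m s)" using s R mc by auto
      ultimately show "s \<in> conj_by G (inv m) ` J" by blast
    qed
    then have "conj_by G (inv (inv m)) b \<in> W J"
      by (intro conj_W[OF JS _ R(2) _ ab(2)]) (use mc in auto)
    then have bJ: "conj_by G m b \<in> W J" using mc by simp
    define e where "e = a \<otimes> conj_by G m b"
    have eJ: "e \<in> W J" unfolding e_def using ab bJ by simp
    have ec: "e \<in> carrier G" using eJ JS by simp
    have we: "w = e \<otimes> m" unfolding ab(3) e_def conj_by_def using c mc by (simp add: m_assoc)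
    have lw: "len w = len e + len m" unfolding we
      by (rule len_mult_left_min[OF JS bimin_mono[OF m(3)] eJ]) auto
    have "m = \<one>"
    proof (rule ccontr)
      assume "m \<noteq> \<one>"
      obtain u where u: "u \<in> lists S" "wp u = m" "length u = len m" by (rule reduced_word_exists[OF mc])
      then have "u \<noteq> []" using \<open>m \<noteq> \<one>\<close> by auto
      then obtain v s where vs: "u = v @ [s]" by (metis rev_exhaust)
      then have vS: "v \<in> lists S" "s \<in> S" using u by auto
      have "m = wp v \<otimes> s" using u(2) vs vS by (simp add: wp_append)
      then have "m \<otimes> s = wp v" using vS by (simp add: m_assoc)
      then have lt: "len (m \<otimes> s) < len m" using len_le[OF vS(1)] u vs by simp
      have "w \<otimes> s = e \<otimes> (m \<otimes> s)" unfolding we using ec mc vS by (simp add: m_assoc)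
      then have "len (w \<otimes> s) < len w" using len_mult_le[of e "m \<otimes> s"] lt lw ec mc vS by simp
      then have "s \<in> R" unfolding R_def using vS by simp
      then show False using m(3) lt unfolding bimin_def by (meson less_asym)
    qed
    then have "w \<in> W J" using we eJ ec by simp
    then have wJ: "w = wl J" using left_descents_eq_longest[OF J] JL by blast
    have "R \<subseteq> J" using False \<open>m = \<one>\<close> R by (auto simp: subset_iff)
    moreover have "J \<subseteq> R" unfolding R_def wJ by (rule longest_props(2)[OF J])
    ultimately show ?thesis unfolding max_reach_def wJ by simp
  qed
  then show ?case using down unfolding max_reach_def by (rule rtranclp_trans)
qed

subsection \<open>Paths and braid loops\<close>

definition max_path :: "'a set \<Rightarrow> ('a set \<times> 'a) list \<Rightarrow> bool" where
  "max_path J xs \<longleftrightarrow> xs \<noteq> [] \<and> set xs \<subseteq> max_pairs J \<and> successively max_step xs"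

text \<open>In contrast to \<open>braid_loops\<close> the paths are not required to be parts of reduced expressions.\<close>

definition max_loops :: "'a set \<Rightarrow> ('a set \<times> 'a) list set set" where
  "max_loops J = {{\<alpha>, \<beta>} | \<alpha> \<beta>. max_path J \<alpha> \<and> max_path J \<beta> \<and> hd \<alpha> = hd \<beta> \<and> last \<alpha> = last \<beta> \<and>
     braid_rel G S (map fst \<alpha>) (map fst \<beta>)}"

lemma max_reach_path:
  assumes "max_reach J x y" "x \<in> max_pairs J" obtains xs where "max_path J xs" "hd xs = x" "last xs = y"
proof -
  have "\<exists>xs. max_path J xs \<and> hd xs = x \<and> last xs = y"
    using assms unfolding max_reach_def
  proof (induction rule: rtranclp_induct)
    case base
    then show ?case by (intro exI[of _ "[x]"]) (simp add: max_path_def)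
  next
    case (step y z)
    then obtain xs where xs: "max_path J xs" "hd xs = x" "last xs = y" by blast
    then have "max_path J (xs @ [z])" using step.hyps unfolding max_path_def max_edges_def
      by (auto simp: successively_append_iff)
    then show ?case using xs by (intro exI[of _ "xs @ [z]"]) (auto simp: max_path_def)
  qed
  then show ?thesis using that by blast
qed

lemma successively_edges_iff:
  assumes J: "finitary G S J" and xs: "set xs \<subseteq> max_pairs J"
  shows "successively (\<lambda>x y. (x, y) \<in> cox_edges G S J) (map (coset_of J) xs) \<longleftrightarrow> successively max_step xs"
proof -
  have P: "xs ! i \<in> max_pairs J" if "i < length xs" for i using that xs by auto
  show ?thesis unfolding successively_conv_nth using P cox_edges_iff[OF J] by auto
qed

lemma forward_path_max_path:
  assumes J: "finitary G S J" and xs: "max_path J xs" "hd xs = (J, wl J)"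
  shows "forward_path G S J (map fst xs) = map (coset_of J) xs"
    and "reduced_expression G S J (map fst xs)"
proof -
  have JS: "J \<subseteq> S" using J by (rule finitaryD)
  have P: "xs ! i \<in> max_pairs J" if "i < length xs" for i
    using that xs(1) unfolding max_path_def by auto
  have ne: "xs \<noteq> []" using xs unfolding max_path_def by simp
  have fc: "forward_coset G S J (map fst xs) i = snd (coset_of J (xs ! i))" if "i < length xs" for i
    using that
  proof (induction i)
    case 0
    have "wl J \<otimes> \<one> \<otimes> \<one> \<in> DC J J \<one>" by (rule double_cosetI[OF longest_props(1)[OF J] W_one])
    then have "DC J J (wl J) = DC J J \<one>" using double_coset_eq[OF JS JS, of \<one> "wl J"] J by simp
    then show ?case using xs(2) ne by (simp add: hd_conv_nth coset_of_def)
  next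
    case (Suc i)
    obtain I w I' w' where e: "xs ! i = (I, w)" "xs ! Suc i = (I', w')" by (metis surj_pair)
    have p: "(I, w) \<in> max_pairs J" "(I', w') \<in> max_pairs J" using P[of i] P[of "Suc i"] Suc.prems e by auto
    have c: "w \<in> carrier G" "w' \<in> carrier G" "finitary G S I" "finitary G S I'" "I' \<subseteq> S"
      using p finitaryD unfolding max_pairs_def bimax_def by auto
    have step: "max_step (I, w) (I', w')"
      using xs(1) Suc.prems e unfolding max_path_def successively_conv_nth by metis
    have "DC J I' w = DC J I' w'"
    proof (cases "w = w'")
      case False
      then have up: "I \<subseteq> I'" "w \<otimes> wl I = w' \<otimes> wl I'" using step unfolding max_step_def by auto
      have "w = (w \<otimes> wl I) \<otimes> wl I" using c by (simp add: m_assoc)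
      then have "w = \<one> \<otimes> w' \<otimes> (wl I' \<otimes> wl I)" using up(2) c by (simp add: m_assoc)
      moreover have "wl I' \<otimes> wl I \<in> W I'"
        using longest_props(1)[OF c(3)] longest_props(1)[OF c(4)] W_mono[OF up(1)] by auto
      ultimately have "w \<in> DC J I' w'" using double_cosetI[OF W_one, of "wl I' \<otimes> wl I" I' w'] by metis
      then show ?thesis by (rule double_coset_eq[OF JS c(5,2)])
    qed simp
    moreover have "coset_max G S (DC J I w) = w" using coset_max_coset_of[OF J p(1)] by (simp add: coset_of_def)
    moreover have "forward_coset G S J (map fst xs) i = DC J I w" using Suc e by (simp add: coset_of_def)
    ultimately show ?case using Suc.prems e by (simp add: coset_of_def)
  qed
  show fp: "forward_path G S J (map fst xs) = map (coset_of J) xs"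
    unfolding forward_path_def by (rule nth_equalityI) (auto simp: fc prod_eq_iff)
  have "finitary G S I" if "I \<in> set (map fst xs)" for I
    using that xs(1) unfolding max_path_def max_pairs_def by auto
  then show "reduced_expression G S J (map fst xs)"
    unfolding reduced_expression_def fp
    using xs ne successively_edges_iff[OF J, of xs] by (auto simp: max_path_def hd_map)
qed

lemma segment_append: "length b = l \<Longrightarrow> segment (a @ b) (length a) l = b"
  by (simp add: segment_def)

lemma fst_forward_path: "map fst (forward_path G S J Is) = Is"
  by (simp add: forward_path_def o_def map_nth)

lemma segment_forward_path:
  assumes J: "finitary G S J" and red: "reduced_expression G S J (A @ l @ B)" and l: "l \<noteq> []"
  obtains \<alpha> where "max_path J \<alpha>" "map fst \<alpha> = l"
    "map (coset_of J) \<alpha> = segment (forward_path G S J (A @ l @ B)) (length A) (length l)"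
proof -
  let ?f = "segment (forward_path G S J (A @ l @ B)) (length A) (length l)"
  have "group G" ..
  then have wf: "wf_path (cox2 G S J) ?f" using wf_path_segment red l by blast
  then have "set ?f \<subseteq> coset_of J ` max_pairs J"
    unfolding wf_path_def cox2_def using cox_vertices_eq[OF J] by simp
  then have "?f \<in> lists (coset_of J ` max_pairs J)" by auto
  then obtain \<alpha> where \<alpha>: "\<alpha> \<in> lists (max_pairs J)" "map (coset_of J) \<alpha> = ?f"
    unfolding lists_image by (metis imageE)
  have "successively (\<lambda>x y. (x, y) \<in> cox_edges G S J) (map (coset_of J) \<alpha>)"
    using wf \<alpha>(2) unfolding wf_path_def cox2_def by simp
  then have "successively max_step \<alpha>" using successively_edges_iff[OF J, of \<alpha>] \<alpha>(1) by auto
  moreover have "\<alpha> \<noteq> []" using wf \<alpha>(2) unfolding wf_path_def by auto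
  ultimately have "max_path J \<alpha>" using \<alpha>(1) unfolding max_path_def by auto
  moreover have "map fst \<alpha> = l"
  proof -
    have "map fst \<alpha> = map fst (map (coset_of J) \<alpha>)" by simp
    also have "\<dots> = segment (A @ l @ B) (length A) (length l)"
      unfolding \<alpha>(2) segment_def take_map[symmetric] drop_map[symmetric] fst_forward_path ..
    finally show ?thesis by (simp add: segment_def)
  qed
  ultimately show ?thesis using that \<alpha>(2) by blast
qed

text \<open>As every vertex is reachable from the base point, each pair of parallel paths of the two types
  of a braid relation occurs as a segment of reduced expressions.\<close>

lemma braid_loops_eq:
  assumes J: "finitary G S J" shows "braid_loops G S J = (\<lambda>L. map (coset_of J) ` L) ` max_loops J"
proof (intro equalityI subsetI)
  have inj: "inj_on (coset_of J) (max_pairs J)" by (rule inj_on_coset_of[OF J])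
  fix D assume "D \<in> braid_loops G S J"
  then obtain A B l r where D: "D = {segment (forward_path G S J (A @ l @ B)) (length A) (length l),
      segment (forward_path G S J (A @ r @ B)) (length A) (length r)}" "braid_rel G S l r"
    "reduced_expression G S J (A @ l @ B)" "reduced_expression G S J (A @ r @ B)"
    "hd (segment (forward_path G S J (A @ l @ B)) (length A) (length l)) =
     hd (segment (forward_path G S J (A @ r @ B)) (length A) (length r))"
    "last (segment (forward_path G S J (A @ l @ B)) (length A) (length l)) =
     last (segment (forward_path G S J (A @ r @ B)) (length A) (length r))"
    unfolding braid_loops_def by blast
  have ne: "l \<noteq> []" "r \<noteq> []" using braid_rel_nonempty[OF D(2)] by auto
  obtain \<alpha> where \<alpha>: "max_path J \<alpha>" "map fst \<alpha> = l"
    "map (coset_of J) \<alpha> = segment (forward_path G S J (A @ l @ B)) (length A) (length l)"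
    by (rule segment_forward_path[OF J D(3) ne(1)])
  obtain \<beta> where \<beta>: "max_path J \<beta>" "map fst \<beta> = r"
    "map (coset_of J) \<beta> = segment (forward_path G S J (A @ r @ B)) (length A) (length r)"
    by (rule segment_forward_path[OF J D(4) ne(2)])
  have ne': "\<alpha> \<noteq> []" "\<beta> \<noteq> []" using \<alpha> \<beta> unfolding max_path_def by auto
  then have mem: "hd \<alpha> \<in> max_pairs J" "hd \<beta> \<in> max_pairs J" "last \<alpha> \<in> max_pairs J" "last \<beta> \<in> max_pairs J"
    using \<alpha>(1) \<beta>(1) unfolding max_path_def by auto
  have "hd \<alpha> = hd \<beta>" "last \<alpha> = last \<beta>"
    using D(5,6) ne' mem inj unfolding \<alpha>(3)[symmetric] \<beta>(3)[symmetric]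
    by (auto simp: hd_map last_map dest: inj_onD)
  then have "{\<alpha>, \<beta>} \<in> max_loops J" unfolding max_loops_def using \<alpha> \<beta> D(2) by blast
  moreover have "D = map (coset_of J) ` {\<alpha>, \<beta>}" unfolding D(1) using \<alpha>(3) \<beta>(3) by simp
  ultimately show "D \<in> (\<lambda>L. map (coset_of J) ` L) ` max_loops J" by blast
next
  fix D assume "D \<in> (\<lambda>L. map (coset_of J) ` L) ` max_loops J"
  then obtain \<alpha> \<beta> where D: "D = {map (coset_of J) \<alpha>, map (coset_of J) \<beta>}" "max_path J \<alpha>" "max_path J \<beta>"
    "hd \<alpha> = hd \<beta>" "last \<alpha> = last \<beta>" "braid_rel G S (map fst \<alpha>) (map fst \<beta>)"
    unfolding max_loops_def by auto
  have ne: "\<alpha> \<noteq> []" "\<beta> \<noteq> []" using D unfolding max_path_def by auto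
  then have "hd \<alpha> \<in> max_pairs J" using D(2) unfolding max_path_def by auto
  then have "max_reach J (J, wl J) (hd \<alpha>)" using max_reach_base[OF J] by (cases "hd \<alpha>") auto
  then obtain g where g: "max_path J g" "hd g = (J, wl J)" "last g = hd \<alpha>"
    by (rule max_reach_path[OF _ base_pair[OF J]])
  \<comment> \<open>Both paths are prolonged by the same path \<open>h\<close> from the base point to their common start.\<close>
  define h where "h = butlast g"
  have gne: "g \<noteq> []" using g unfolding max_path_def by simp
  then have gh: "g = h @ [hd \<alpha>]" unfolding h_def using g(3) by (metis append_butlast_last_id)
  have ext: "max_path J (h @ \<gamma>) \<and> hd (h @ \<gamma>) = (J, wl J)" if "max_path J \<gamma>" "hd \<gamma> = hd \<alpha>" for \<gamma>
  proof -
    have "\<gamma> \<noteq> []" using that unfolding max_path_def by simp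
    then have "hd (h @ \<gamma>) = hd g" using that(2) unfolding gh by (cases h) auto
    moreover have "max_path J (h @ \<gamma>)"
      using g(1) that unfolding gh max_path_def by (auto simp: successively_append_iff)
    ultimately show ?thesis using g(2) by simp
  qed
  have seg: "reduced_expression G S J (map fst h @ map fst \<gamma> @ [])"
    "map (coset_of J) \<gamma> = segment (forward_path G S J (map fst h @ map fst \<gamma> @ [])) (length (map fst h)) (length (map fst \<gamma>))"
    if "max_path J \<gamma>" "hd \<gamma> = hd \<alpha>" for \<gamma>
  proof -
    note e = ext[OF that]
    note fp = forward_path_max_path[OF J conjunct1[OF e] conjunct2[OF e]]
    show "reduced_expression G S J (map fst h @ map fst \<gamma> @ [])" using fp(2) by simp
    show "map (coset_of J) \<gamma> = segment (forward_path G S J (map fst h @ map fst \<gamma> @ [])) (length (map fst h)) (length (map fst \<gamma>))"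
      using fp(1) segment_append[of "map (coset_of J) \<gamma>" "length \<gamma>" "map (coset_of J) h"] by simp
  qed
  have eq: "hd (map (coset_of J) \<alpha>) = hd (map (coset_of J) \<beta>)" "last (map (coset_of J) \<alpha>) = last (map (coset_of J) \<beta>)"
    using D(4,5) ne by (simp_all add: hd_map last_map)
  have hb: "hd \<beta> = hd \<alpha>" using D(4) by simp
  show "D \<in> braid_loops G S J"
    unfolding braid_loops_def mem_Collect_eq
    using D(1,6) seg(1)[OF D(2) HOL.refl] seg(1)[OF D(3) hb] seg(2)[OF D(2) HOL.refl] seg(2)[OF D(3) hb] eq by metis
qed

section \<open>The subcomplex of cosets with given left descents\<close>

lemma max_pairs_iff: "J \<subseteq> S \<Longrightarrow> (I, w) \<in> max_pairs J \<longleftrightarrow> (I, w) \<in> max_pairs {} \<and> J \<subseteq> LD w"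
  unfolding max_pairs_def bimax_def by auto

lemma max_pairs_subset: "max_pairs J \<subseteq> max_pairs {}"
  unfolding max_pairs_def bimax_def by auto

definition same_max_coset :: "'a set \<Rightarrow> 'a vertex \<Rightarrow> 'a vertex" where
  "same_max_coset J = (\<lambda>(I, p). (I, DC J I (coset_max G S p)))"

lemma same_max_coset_coset_of: "x \<in> max_pairs {} \<Longrightarrow> same_max_coset J (coset_of {} x) = coset_of J x"
  using coset_max_coset_of[OF finitary_empty, of x] unfolding same_max_coset_def coset_of_def by (auto split: prod.splits)

text \<open>Both complexes are images of the same data on pairs \<open>(I, w)\<close>: the vertices, edges and loops for
  \<open>J\<close> are those for the empty set that only involve pairs with \<open>J \<subseteq> LD(w)\<close>.\<close>

theorem complex_iso_same_max_coset:
  assumes J: "finitary G S J"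
  defines "V \<equiv> {(I, p). (I, p) \<in> cox_vertices G S {} \<and> J \<subseteq> left_descents G S (coset_max G S p)}"
  shows "complex_iso (same_max_coset J) (induced_complex (cox2 G S {}) V) (cox2 G S J)"
proof -
  note E = finitary_empty
  have JS: "J \<subseteq> S" using J by (rule finitaryD)
  let ?c = "coset_of {}" and ?d = "coset_of J" and ?f = "same_max_coset J"
  have sub: "max_pairs J \<subseteq> max_pairs {}" by (rule max_pairs_subset)
  have inj: "inj_on ?c (max_pairs {})" by (rule inj_on_coset_of[OF E])
  have fc: "?f (?c x) = ?d x" if "x \<in> max_pairs J" for x using same_max_coset_coset_of that sub by blast
  have V_iff: "?c x \<in> V \<longleftrightarrow> x \<in> max_pairs J" if x: "x \<in> max_pairs {}" for x
  proof -
    obtain I w where Iw: "x = (I, w)" by fastforce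
    have "coset_max G S (snd (?c x)) = w" using coset_max_coset_of[OF E x] Iw by simp
    moreover have "?c x \<in> cox_vertices G S {}" using x cox_vertices_eq[OF E] by blast
    ultimately show ?thesis unfolding V_def using max_pairs_iff[OF JS, of I w] x Iw by (auto simp: coset_of_def)
  qed
  have V: "V = ?c ` max_pairs J"
  proof
    show "?c ` max_pairs J \<subseteq> V" using V_iff sub by blast
    have "V \<subseteq> ?c ` max_pairs {}" unfolding V_def cox_vertices_eq[OF E] by auto
    then show "V \<subseteq> ?c ` max_pairs J" using V_iff by blast
  qed
  let ?I = "induced_complex (cox2 G S {}) V"
  have verts: "verts ?I = ?c ` max_pairs J"
    using V sub cox_vertices_eq[OF E] by (auto simp: cox2_def)
  have edges: "edges ?I = map_prod ?c ?c ` max_edges J"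
    using V_iff sub unfolding induced_complex_simps cox2_def complex2.simps cox_edges_eq[OF E] max_edges_def
    by fastforce
  have path: "max_path J p \<longleftrightarrow> max_path {} p \<and> set p \<subseteq> max_pairs J" for p
    using sub unfolding max_path_def by auto
  have pathV: "max_path {} p \<and> set (map ?c p) \<subseteq> V \<longleftrightarrow> max_path {} p \<and> set p \<subseteq> max_pairs J" for p
    using V_iff unfolding max_path_def set_map by blast
  have "L \<in> max_loops J \<longleftrightarrow> L \<in> max_loops {} \<and> (\<forall>p\<in>L. set (map ?c p) \<subseteq> V)" for L
  proof -
    have "L \<in> max_loops {} \<and> (\<forall>p\<in>L. set (map ?c p) \<subseteq> V) \<longleftrightarrow>
      (\<exists>\<alpha> \<beta>. L = {\<alpha>, \<beta>} \<and> (max_path {} \<alpha> \<and> set (map ?c \<alpha>) \<subseteq> V) \<and> (max_path {} \<beta> \<and> set (map ?c \<beta>) \<subseteq> V) \<and>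
        hd \<alpha> = hd \<beta> \<and> last \<alpha> = last \<beta> \<and> braid_rel G S (map fst \<alpha>) (map fst \<beta>))"
      unfolding max_loops_def by blast
    also have "\<dots> \<longleftrightarrow> L \<in> max_loops J"
      unfolding max_loops_def mem_Collect_eq path pathV ..
    finally show ?thesis by simp
  qed
  then have "max_loops J = {L \<in> max_loops {}. \<forall>p\<in>L. set (map ?c p) \<subseteq> V}" by blast
  then have discs: "discs ?I = (\<lambda>L. map ?c ` L) ` max_loops J"
    unfolding induced_complex_simps cox2_def complex2.simps braid_loops_eq[OF E] by blast
  have loopJ: "set p \<subseteq> max_pairs J" if "L \<in> max_loops J" "p \<in> L" for L p
    using that unfolding max_loops_def max_path_def by auto
  have "inj_on ?f (verts ?I)"
    unfolding verts using fc inj_on_coset_of[OF J] by (auto simp: inj_on_def)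
  moreover have "verts (cox2 G S J) = ?f ` verts ?I"
    unfolding verts using cox_vertices_eq[OF J] fc by (simp add: cox2_def image_image)
  moreover have "edges (cox2 G S J) = map_prod ?f ?f ` edges ?I"
  proof -
    have "map_prod ?f ?f (map_prod ?c ?c e) = map_prod ?d ?d e" if "e \<in> max_edges J" for e
      using that fc unfolding max_edges_def by auto
    then show ?thesis unfolding edges using cox_edges_eq[OF J] by (simp add: cox2_def image_image)
  qed
  moreover have "discs (cox2 G S J) = (\<lambda>A. map ?f ` A) ` discs ?I"
  proof -
    have "map ?f ` map ?c ` L = map ?d ` L" if L: "L \<in> max_loops J" for L
    proof -
      have eq: "map ?f (map ?c p) = map ?d p" if "p \<in> L" for p using loopJ[OF L that] fc by auto
      show ?thesis unfolding image_image by (rule image_cong[OF HOL.refl eq])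
    qed
    then show ?thesis unfolding discs using braid_loops_eq[OF J] by (simp add: cox2_def image_image)
  qed
  ultimately show ?thesis unfolding complex_iso_def by blast
qed

lemma same_max_coset_vertex:
  assumes J: "finitary G S J" and p: "(I, p) \<in> cox_vertices G S {}" "J \<subseteq> LD (coset_max G S p)"
  shows "\<exists>q. (I, q) \<in> cox_vertices G S J \<and> coset_max G S p = coset_max G S q \<and> same_max_coset J (I, p) = (I, q)"
proof -
  have JS: "J \<subseteq> S" using J by (rule finitaryD)
  obtain w where w: "(I, w) \<in> max_pairs {}" "(I, p) = coset_of {} (I, w)"
    using p(1) unfolding cox_vertices_eq[OF finitary_empty] by (auto simp: coset_of_def)
  have max: "coset_max G S p = w" using coset_max_coset_of[OF finitary_empty w(1)] w(2)[symmetric] by simp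
  then have wJ: "(I, w) \<in> max_pairs J" using w(1) p(2) max_pairs_iff[OF JS] by simp
  have "same_max_coset J (I, p) = (I, DC J I w)" unfolding same_max_coset_def using max by simp
  moreover have "(I, DC J I w) = coset_of J (I, w)" by (simp add: coset_of_def)
  then have "(I, DC J I w) \<in> cox_vertices G S J" using wJ unfolding cox_vertices_eq[OF J] by auto
  moreover have "coset_max G S (DC J I w) = w" using coset_max_coset_of[OF J wJ] by (simp add: coset_of_def)
  ultimately show ?thesis using max by (intro exI[of _ "DC J I w"]) simp
qed

end

theorem proposition8p10:
  fixes G :: "('a, 'b) monoid_scheme" and S J :: "'a set"
  assumes "coxeter_system G S"
    and "finitary G S J"
  shows "let X = full_subcomplex (cox2 G S {})
               {(I, p). (I, p) \<in> cox_vertices G S {} \<and> J \<subseteq> left_descents G S (coset_max G S p)}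
         in \<exists>h. cell_preserving_homeo (cox2 G S {}) X (cox2 G S J) h \<and>
              (\<forall>I p. (I, p) \<in> cox_vertices G S {} \<and> Vertex (I, p) \<in> X \<longrightarrow>
                (\<exists>q. (I, q) \<in> cox_vertices G S J \<and> coset_max G S p = coset_max G S q \<and>
                  h (Vertex (I, p)) = Vertex (I, q)))"
proof -
  interpret coxeter_system G S by (rule assms(1))
  let ?V = "{(I, p). (I, p) \<in> cox_vertices G S {} \<and> J \<subseteq> left_descents G S (coset_max G S p)}"
  let ?X = "full_subcomplex (cox2 G S {}) ?V"
  have "group G" ..
  then have wf: "wf_complex2 (cox2 G S K)" for K by (rule wf_cox2)
  have "cell_preserving_homeo (cox2 G S {}) ?X (cox2 G S J) (iso_map (same_max_coset J))"
    by (rule cell_preserving_homeo_induced[OF wf wf complex_iso_same_max_coset[OF assms(2)]])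
  moreover have "\<exists>q. (I, q) \<in> cox_vertices G S J \<and> coset_max G S p = coset_max G S q \<and>
      iso_map (same_max_coset J) (Vertex (I, p)) = Vertex (I, q)"
    if "(I, p) \<in> cox_vertices G S {}" "Vertex (I, p) \<in> ?X" for I p
  proof -
    have "J \<subseteq> left_descents G S (coset_max G S p)"
      using that(2) unfolding full_subcomplex_eq_induced[OF wf] cw_points_iff by simp
    then show ?thesis using same_max_coset_vertex[OF assms(2) that(1)] by auto
  qed
  ultimately show ?thesis unfolding Let_def by blast
qed

end
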